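(* Let $d\ge2$, let $G=(\mathbb R\rtimes\mathbb R_+)\times\mathrm{SO}(d)$, and let $\pi$ be the Schrödinger representation of $G$ on $L^2(\mathbb R^d)$, i.e. $$\pi(b,a,R)f=e^{i\frac{b}{2\pi}\Delta}V(a,R)f,\qquad V(a,R)f(x)=a^{-\frac d4}f(a^{-\frac12}R^{-1}x),$$ for $(b,a,R)\in G$, $f\in L^2(\mathbb R^d)$. Then $\pi$ is a reproducing representation of $G$: there exists $\eta\in L^2(\mathbb R^d)$ such that $$\|f\|^2_{L^2(\mathbb R^d)}=\int_G|\langle f,\pi(b,a,R)\eta\rangle|^2\,db\,\frac{da}{a^2}\,dR\qquad\text{for all }f\in L^2(\mathbb R^d).$$
   Context: $\mathbb R_+=(0,\infty)$. $G$ is the direct product of the affine group $\mathbb R\rtimes\mathbb R_+$, with law $(b,a)(b',a')=(b+ab',aa')$, and $\mathrm{SO}(d)$; $dR$ is the Haar measure of $\mathrm{SO}(d)$ of total mass $1$, and $db\,\frac{da}{a^2}\,dR$ is a left Haar measure on $G$. $\Delta$ is the Laplacian on $\mathbb R^d$ and $e^{i\frac b{2\pi}\Delta}$ is defined by spectral calculus; equivalently, with the Fourier transform $\mathcal Ff(\xi)=\int f(x)e^{-2\pi ix\cdot\xi}dx$, one has $(\mathcal F\pi(b,a,R)\mathcal F^{-1}\hat f)(\xi)=a^{\frac d4}e^{-2\pi ib\,\xi\cdot\xi}\hat f(a^{\frac12}R^{-1}\xi)$. A unitary representation of $G$ is called reproducing if there is a vector $\eta$ (an admissible vector) for which the displayed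 identity holds. *)

theory Defs
  imports "HOL-Analysis.Analysis" "HOL-Algebra.Group"
begin

section \<open>Square-integrable functions\<close>

text \<open>
  An element of $L^2(R^d)$ is represented by a Borel function, and equality in $L^2$ is equality
  almost everywhere. The dimension $d$ is the cardinality of the index type.
\<close>

definition L2 :: "(real ^ 'n::finite \<Rightarrow> complex) set" where
  "L2 = {f. f \<in> borel_measurable lborel \<and> integrable lborel (\<lambda>x. (cmod (f x))\<^sup>2)}"

definition L2_inner :: "(real ^ 'n::finite \<Rightarrow> complex) \<Rightarrow> (real ^ 'n \<Rightarrow> complex) \<Rightarrow> complex" where
  "L2_inner f g = (LINT x|lborel. f x * cnj (g x))"

definition L2_norm :: "(real ^ 'n::finite \<Rightarrow> complex) \<Rightarrow> real" where
  "L2_norm f = sqrt (LINT x|lborel. (cmod (f x))\<^sup>2)"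

text \<open>
  The extended integral is used here because the Bochner integral of a non-integrable function is 0,
  so that \<open>L2_norm\<close> does not detect divergence.
\<close>

definition L2_tendsto ::
    "('i \<Rightarrow> real ^ 'n::finite \<Rightarrow> complex) \<Rightarrow> (real ^ 'n \<Rightarrow> complex) \<Rightarrow> 'i filter \<Rightarrow> bool" where
  "L2_tendsto F f net \<longleftrightarrow>
     ((\<lambda>k. \<integral>\<^sup>+ x. ennreal ((cmod (F k x - f x))\<^sup>2) \<partial>lborel) \<longlongrightarrow> 0) net"


section \<open>Fourier transform and functional calculus of the Laplacian\<close>

definition fourier :: "(real ^ 'n::finite \<Rightarrow> complex) \<Rightarrow> real ^ 'n \<Rightarrow> complex" where
  "fourier f \<xi> = (LINT x|lborel. f x * cis (- 2 * pi * (x \<bullet> \<xi>)))"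

text \<open>
  The Fourier transform on $L^2$ is the continuous extension of \<open>fourier\<close> from $L^1 \cap L^2$,
  determined up to null sets.
\<close>

definition is_fourier_L2 :: "(real ^ 'n::finite \<Rightarrow> complex) \<Rightarrow> (real ^ 'n \<Rightarrow> complex) \<Rightarrow> bool" where
  "is_fourier_L2 f g \<longleftrightarrow> f \<in> L2 \<and> g \<in> L2 \<and>
     (\<exists>F :: nat \<Rightarrow> real ^ 'n \<Rightarrow> complex.
        (\<forall>k. F k \<in> L2 \<and> integrable lborel (F k)) \<and>
        L2_tendsto F f sequentially \<and>
        L2_tendsto (\<lambda>k. fourier (F k)) g sequentially)"

definition fourier_L2 :: "(real ^ 'n::finite \<Rightarrow> complex) \<Rightarrow> real ^ 'n \<Rightarrow> complex" where
  "fourier_L2 f = (SOME g. is_fourier_L2 f g)"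

text \<open>
  The Fourier transform diagonalises the Laplacian $\Delta$ as multiplication by
  $-4\pi^2 |\xi|^2$, so for bounded Borel $\varphi$ the operator $\varphi(\Delta)$ is
  multiplication by $\varphi(-4\pi^2 |\xi|^2)$ on the Fourier side.
\<close>

definition laplacian_calculus ::
    "(real \<Rightarrow> complex) \<Rightarrow> (real ^ 'n::finite \<Rightarrow> complex) \<Rightarrow> real ^ 'n \<Rightarrow> complex" where
  "laplacian_calculus \<phi> f =
     (SOME u. u \<in> L2 \<and>
        (AE \<xi> in lborel. fourier_L2 u \<xi> = \<phi> (- 4 * pi\<^sup>2 * (\<xi> \<bullet> \<xi>)) * fourier_L2 f \<xi>))"

definition schrodinger_propagator ::
    "real \<Rightarrow> (real ^ 'n::finite \<Rightarrow> complex) \<Rightarrow> real ^ 'n \<Rightarrow> complex" where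
  "schrodinger_propagator b =
     laplacian_calculus (\<lambda>t. exp (\<i> * complex_of_real (b / (2 * pi)) * complex_of_real t))"


section \<open>The group and its Haar measure\<close>

definition affine_group :: "(real \<times> real) monoid" where
  "affine_group =
     \<lparr>carrier = UNIV \<times> {0<..},
      mult = (\<lambda>(b, a) (b', a'). (b + a * b', a * a')),
      one = (0, 1)\<rparr>"

definition SO_group :: "(real ^ 'n ^ 'n::finite) monoid" where
  "SO_group = \<lparr>carrier = {R. rotation_matrix R}, mult = (**), one = mat 1\<rparr>"

definition schrodinger_group :: "((real \<times> real) \<times> (real ^ 'n ^ 'n::finite)) monoid" where
  "schrodinger_group = affine_group \<times>\<times> SO_group"

definition normalized_haar_SO :: "(real ^ 'n ^ 'n::finite) measure \<Rightarrow> bool" where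
  "normalized_haar_SO \<mu> \<longleftrightarrow>
     sets \<mu> = sets (restrict_space borel (carrier SO_group)) \<and>
     emeasure \<mu> (space \<mu>) = 1 \<and>
     (\<forall>S \<in> carrier SO_group. distr \<mu> \<mu> (\<lambda>R. S ** R) = \<mu>)"

definition schrodinger_haar ::
    "(real ^ 'n ^ 'n::finite) measure \<Rightarrow> ((real \<times> real) \<times> (real ^ 'n ^ 'n)) measure" where
  "schrodinger_haar \<mu> =
     (lborel \<Otimes>\<^sub>M density (restrict_space lborel {0<..}) (\<lambda>a. ennreal (1 / a\<^sup>2))) \<Otimes>\<^sub>M \<mu>"


section \<open>Representations on $L^2$\<close>

definition unitary_rep_L2 ::
    "('g::topological_space) monoid \<Rightarrow>
     ('g \<Rightarrow> (real ^ 'n::finite \<Rightarrow> complex) \<Rightarrow> (real ^ 'n \<Rightarrow> complex)) \<Rightarrow> bool" where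
  "unitary_rep_L2 G \<rho> \<longleftrightarrow>
     group G \<and>
     (\<forall>g \<in> carrier G. \<forall>f \<in> L2. \<rho> g f \<in> L2) \<and>
     (\<forall>g \<in> carrier G. \<forall>f \<in> L2. \<forall>h \<in> L2. \<forall>c.
        AE x in lborel. \<rho> g (\<lambda>y. c * f y + h y) x = c * \<rho> g f x + \<rho> g h x) \<and>
     (\<forall>g \<in> carrier G. \<forall>f \<in> L2. \<forall>h \<in> L2. L2_inner (\<rho> g f) (\<rho> g h) = L2_inner f h) \<and>
     (\<forall>f \<in> L2. AE x in lborel. \<rho> (one G) f x = f x) \<and>
     (\<forall>g \<in> carrier G. \<forall>h \<in> carrier G. \<forall>f \<in> L2.
        AE x in lborel. \<rho> (mult G g h) f x = \<rho> g (\<rho> h f) x) \<and>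
     (\<forall>f \<in> L2. \<forall>g \<in> carrier G. L2_tendsto (\<lambda>h. \<rho> h f) (\<rho> g f) (at g within carrier G))"

definition admissible_vector ::
    "'g measure \<Rightarrow> ('g \<Rightarrow> (real ^ 'n::finite \<Rightarrow> complex) \<Rightarrow> (real ^ 'n \<Rightarrow> complex)) \<Rightarrow>
     (real ^ 'n \<Rightarrow> complex) \<Rightarrow> bool" where
  "admissible_vector \<nu> \<rho> \<eta> \<longleftrightarrow>
     \<eta> \<in> L2 \<and>
     (\<forall>f \<in> L2. ennreal ((L2_norm f)\<^sup>2) =
        (\<integral>\<^sup>+ g. ennreal ((cmod (L2_inner f (\<rho> g \<eta>)))\<^sup>2) \<partial>\<nu>))"

definition reproducing_rep ::
    "('g::topological_space) monoid \<Rightarrow> 'g measure \<Rightarrow>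
     ('g \<Rightarrow> (real ^ 'n::finite \<Rightarrow> complex) \<Rightarrow> (real ^ 'n \<Rightarrow> complex)) \<Rightarrow> bool" where
  "reproducing_rep G \<nu> \<rho> \<longleftrightarrow> unitary_rep_L2 G \<rho> \<and> (\<exists>\<eta>. admissible_vector \<nu> \<rho> \<eta>)"


section \<open>The Schroedinger representation\<close>

definition dilation_rotation ::
    "real \<Rightarrow> real ^ 'n ^ 'n \<Rightarrow> (real ^ 'n::finite \<Rightarrow> complex) \<Rightarrow> real ^ 'n \<Rightarrow> complex" where
  "dilation_rotation a R f = (\<lambda>x.
     complex_of_real (a powr (- real CARD('n) / 4)) *
     f (a powr (- 1 / 2) *\<^sub>R (matrix_inv R *v x)))"

definition schrodinger_rep ::
    "(real \<times> real) \<times> (real ^ 'n ^ 'n) \<Rightarrow> (real ^ 'n::finite \<Rightarrow> complex) \<Rightarrow> real ^ 'n \<Rightarrow> complex" where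
  "schrodinger_rep = (\<lambda>((b, a), R) f. schrodinger_propagator b (dilation_rotation a R f))"

end

theory Submission
  imports Defs "HOL-Probability.Characteristic_Functions"
begin

text \<open>
  Let \<open>\<phi>\<close> and \<open>\<psi>\<close> be the Fourier transforms of \<open>f\<close> and \<open>\<eta>\<close>. On the Fourier side the propagator is
  multiplication by \<open>cis (- 2 * pi * b * (\<xi> \<bullet> \<xi>))\<close>, so the coefficient of \<open>f\<close> against the element of the orbit of
  \<open>\<eta>\<close> with parameters \<open>b\<close>, \<open>a\<close>, \<open>R\<close> is an integral of \<open>\<phi>\<close> times the dilated and rotated \<open>\<psi>\<close> against a character
  of the squared radius. In polar coordinates with the squared radius \<open>t\<close> as variable
  (\<open>lborel_polar\<close>) it becomes the one-dimensional Fourier transform, at \<open>- b\<close>, of a function \<open>H\<close> of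
  \<open>t\<close>, called \<open>radial_coeff\<close> below: the density \<open>w t\<close> of the squared radius times the integral over the sphere
  of \<open>\<phi> (sqrt t *\<^sub>R \<omega>)\<close> against the dilated and rotated \<open>\<psi>\<close>. Plancherel's theorem on the line
  turns the integral over \<open>b\<close> into the integral of \<open>|H t|\<^sup>2\<close> over \<open>t\<close>. It is therefore enough to choose \<open>\<psi>\<close> in
  such a way that, for almost every \<open>t\<close>, integrating \<open>|H t|\<^sup>2\<close> over dilations and rotations gives \<open>w t\<close> times the
  integral of \<open>|\<phi>|\<^sup>2\<close> over the sphere of squared radius \<open>t\<close>. Polar coordinates then return the squared norm of
  \<open>\<phi>\<close>, which is that of \<open>f\<close>.

  Rotations. The polynomials of degree less than \<open>k\<close> form a finite-dimensional rotation invariant space of functions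
  on the sphere. Its reproducing kernel is unique, hence rotation invariant (\<open>repro_kernel_rotate\<close>). The
  difference \<open>zonal k\<close> of two consecutive kernels is the kernel of an orthogonal projection \<open>P\<^sub>k\<close>. If the angular part
  of \<open>\<psi>\<close> is \<open>zonal k \<omega> e\<close> for a fixed pole \<open>e\<close>, then pairing a function \<open>F\<close> on the sphere with the rotation of \<open>\<psi>\<close> by
  \<open>R\<close> evaluates \<open>P\<^sub>k F\<close> at \<open>R *v e\<close>, and the mean square over \<open>R\<close> is the squared norm of \<open>P\<^sub>k F\<close>. By the
  Stone--Weierstrass theorem these squared norms add up to that of \<open>F\<close>
  (\<open>zonal_resolution_of_identity\<close>).

  Dilations. The function \<open>\<psi>\<close>, called \<open>mother\<close>, carries \<open>zonal k\<close> on the shell where the squared radius lies in the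
  \<open>k\<close>-th of a sequence of disjoint intervals. Its radial amplitude is a power of the radius for
  which the contribution of a shell, integrated over all dilations, depends only on the length of
  the interval and on a gain factor, and the factor is chosen to make all weights equal to one
  (\<open>radial_coeff_total\<close>). The intervals approach the origin so fast that \<open>\<psi>\<close> is square integrable
  (\<open>mother_sq_int\<close>), and the Fourier transform is onto (\<open>is_fourier_L2_surj\<close>), so that \<open>\<psi>\<close> is the transform of some \<open>\<eta>\<close>.

  The tools are built from integration theory. Plancherel's theorem (\<open>plancherel_L1_L2\<close>) follows from
  Gaussian regularization of the autocorrelation; it gives the transform on \<open>L\<^sup>2\<close>, the formula for the
  representation on the Fourier side and, with it, unitarity and strong continuity
  (\<open>unitary_schrodinger_rep\<close>). The surface measure of the sphere is the image of the Haar measure of the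
  rotation group. The hypothesis on the dimension enters through the transitivity of the rotation
  group on the sphere.
\<close>

section \<open>Square-integrable functions on a measure space\<close>

text \<open>
  The space \<open>L\<^sup>2\<close> is taken over an arbitrary measure, because it is used for Lebesgue measure in \<open>d\<close>
  dimensions and on the line, for a Gaussian measure and for the surface measure of the sphere.
\<close>

definition sq_int :: "'a measure \<Rightarrow> ('a \<Rightarrow> complex) set" where
  "sq_int M = {f \<in> borel_measurable M. integrable M (\<lambda>x. (cmod (f x))\<^sup>2)}"

definition nrm :: "'a measure \<Rightarrow> ('a \<Rightarrow> complex) \<Rightarrow> real" where
  "nrm M f = sqrt (LINT x|M. (cmod (f x))\<^sup>2)"

definition ip :: "'a measure \<Rightarrow> ('a \<Rightarrow> complex) \<Rightarrow> ('a \<Rightarrow> complex) \<Rightarrow> complex" where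
  "ip M f g = (LINT x|M. f x * cnj (g x))"

lemma sq_int_measurable: "f \<in> sq_int M \<Longrightarrow> f \<in> borel_measurable M"
  by (simp add: sq_int_def)

lemma sq_int_integrable: "f \<in> sq_int M \<Longrightarrow> integrable M (\<lambda>x. (cmod (f x))\<^sup>2)"
  by (simp add: sq_int_def)

lemma nrm_nonneg [simp]: "0 \<le> nrm M f"
  by (simp add: nrm_def)

lemma nrm_sq: "(nrm M f)\<^sup>2 = (LINT x|M. (cmod (f x))\<^sup>2)"
  by (simp add: nrm_def)

lemma nn_integral_sq_eq_nrm:
  assumes "f \<in> sq_int M"
  shows "(\<integral>\<^sup>+x. ennreal ((cmod (f x))\<^sup>2) \<partial>M) = ennreal ((nrm M f)\<^sup>2)"
  unfolding nrm_sq by (rule nn_integral_eq_integral) (use assms in \<open>auto simp: sq_int_def\<close>)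

lemma sq_intI:
  assumes "f \<in> borel_measurable M" "(\<integral>\<^sup>+x. ennreal ((cmod (f x))\<^sup>2) \<partial>M) < \<infinity>"
  shows "f \<in> sq_int M"
  using assms unfolding sq_int_def by (auto intro!: integrableI_bounded)

lemma sq_int_iff_nn:
  "f \<in> sq_int M \<longleftrightarrow> f \<in> borel_measurable M \<and> (\<integral>\<^sup>+x. ennreal ((cmod (f x))\<^sup>2) \<partial>M) < \<infinity>"
  using sq_intI[of f M] nn_integral_sq_eq_nrm[of f M] sq_int_measurable[of f M]
  by (metis ennreal_less_top infinity_ennreal_def)

lemma nrm_eq_enn2real: "f \<in> borel_measurable M \<Longrightarrow> 
   nrm M f = sqrt (enn2real (\<integral>\<^sup>+x. ennreal ((cmod (f x))\<^sup>2) \<partial>M))"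
  unfolding nrm_def by (subst integral_eq_nn_integral) auto

lemma nrm_leI:
  assumes "f \<in> borel_measurable M" "(\<integral>\<^sup>+x. ennreal ((cmod (f x))\<^sup>2) \<partial>M) \<le> ennreal (c\<^sup>2)" "0 \<le> c"
  shows "f \<in> sq_int M" "nrm M f \<le> c"
proof -
  show 1: "f \<in> sq_int M"
    by (rule sq_intI[OF assms(1)]) (use assms(2) in \<open>auto simp: le_less_trans\<close>)
  have "(nrm M f)\<^sup>2 \<le> c\<^sup>2" using assms(2) nn_integral_sq_eq_nrm[OF 1] by simp
  then show "nrm M f \<le> c" using assms(3) by (simp add: power2_le_iff_abs_le)
qed

lemma sq_int_cong_AE:
  assumes "f \<in> sq_int M" "g \<in> borel_measurable M" "AE x in M. f x = g x"
  shows "g \<in> sq_int M" "nrm M g = nrm M f"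
proof -
  have e: "(\<integral>\<^sup>+x. ennreal ((cmod (g x))\<^sup>2) \<partial>M) = (\<integral>\<^sup>+x. ennreal ((cmod (f x))\<^sup>2) \<partial>M)"
    by (rule nn_integral_cong_AE) (use assms(3) in auto)
  show "g \<in> sq_int M" using assms(1) unfolding sq_int_iff_nn e by (simp add: assms(2))
  show "nrm M g = nrm M f"
    unfolding nrm_eq_enn2real[OF assms(2)] nrm_eq_enn2real[OF sq_int_measurable[OF assms(1)]] e ..
qed

lemma norm_mult_le_sq: "cmod (a * cnj b) \<le> (cmod a)\<^sup>2 + (cmod b)\<^sup>2"
proof -
  have "2 * (cmod a * cmod b) \<le> (cmod a)\<^sup>2 + (cmod b)\<^sup>2"
    using sum_squares_bound[of "cmod a" "cmod b"] by (simp add: mult.assoc)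
  moreover have "0 \<le> cmod a * cmod b" by simp
  ultimately show ?thesis by (simp only: norm_mult complex_mod_cnj)
qed

lemma cmod_add_sq_le: "(cmod (a + b))\<^sup>2 \<le> 2 * (cmod a)\<^sup>2 + 2 * (cmod b)\<^sup>2"
proof -
  have "(cmod (a + b))\<^sup>2 \<le> (cmod a + cmod b)\<^sup>2"
    by (intro power_mono norm_triangle_ineq) auto
  also have "\<dots> \<le> 2 * (cmod a)\<^sup>2 + 2 * (cmod b)\<^sup>2"
    using sum_squares_bound[of "cmod a" "cmod b"] by (simp add: power2_sum)
  finally show ?thesis .
qed

lemma sq_int_add:
  assumes "f \<in> sq_int M" "g \<in> sq_int M" shows "(\<lambda>x. f x + g x) \<in> sq_int M"
proof -
  note [measurable] = sq_int_measurable[OF assms(1)] sq_int_measurable[OF assms(2)]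
  have "integrable M (\<lambda>x. (cmod (f x + g x))\<^sup>2)"
    by (rule Bochner_Integration.integrable_bound[where f="\<lambda>x. 2 * (cmod (f x))\<^sup>2 + 2 * (cmod (g x))\<^sup>2"])
       (use assms in \<open>auto simp: sq_int_def cmod_add_sq_le\<close>)
  then show ?thesis by (simp add: sq_int_def)
qed

lemma sq_int_cmult: "f \<in> sq_int M \<Longrightarrow> (\<lambda>x. c * f x) \<in> sq_int M"
  by (auto simp: sq_int_def norm_mult power_mult_distrib)

lemma sq_int_uminus: "f \<in> sq_int M \<Longrightarrow> (\<lambda>x. - f x) \<in> sq_int M"
  by (auto simp: sq_int_def)

lemma sq_int_diff: "f \<in> sq_int M \<Longrightarrow> g \<in> sq_int M \<Longrightarrow> (\<lambda>x. f x - g x) \<in> sq_int M"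
  using sq_int_add[OF _ sq_int_uminus, of f M g] by simp

lemma sq_int_zero [simp]: "(\<lambda>x. 0) \<in> sq_int M"
  by (simp add: sq_int_def)

lemma borel_measurable_cnj [measurable]: "cnj \<in> borel_measurable borel"
  by (intro borel_measurable_continuous_onI continuous_intros)

lemma sq_int_cnj: "f \<in> sq_int M \<Longrightarrow> (\<lambda>x. cnj (f x)) \<in> sq_int M"
  by (auto simp: sq_int_def)

lemma sq_int_mult_bounded:
  assumes "f \<in> sq_int M" "h \<in> borel_measurable M" "\<And>x. cmod (h x) \<le> B"
  shows "(\<lambda>x. h x * f x) \<in> sq_int M"
proof -
  note [measurable] = sq_int_measurable[OF assms(1)] assms(2)
  have "integrable M (\<lambda>x. (cmod (h x * f x))\<^sup>2)"
  proof (rule Bochner_Integration.integrable_bound[where f="\<lambda>x. B\<^sup>2 * (cmod (f x))\<^sup>2"])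
    have "(cmod (h x))\<^sup>2 \<le> B\<^sup>2" for x using assms(3)[of x] by (intro power_mono) auto
    then show "AE x in M. norm ((cmod (h x * f x))\<^sup>2) \<le> norm (B\<^sup>2 * (cmod (f x))\<^sup>2)"
      by (auto simp: norm_mult power_mult_distrib intro!: mult_right_mono)
  qed (use assms in \<open>auto simp: sq_int_def\<close>)
  then show ?thesis by (simp add: sq_int_def)
qed

lemma integrable_ip:
  assumes "f \<in> sq_int M" "g \<in> sq_int M" shows "integrable M (\<lambda>x. f x * cnj (g x))"
proof -
  note [measurable] = sq_int_measurable[OF assms(1)] sq_int_measurable[OF assms(2)]
  show ?thesis
    by (rule Bochner_Integration.integrable_bound[where f="\<lambda>x. (cmod (f x))\<^sup>2 + (cmod (g x))\<^sup>2"])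
       (use assms in \<open>auto simp: sq_int_def norm_mult_le_sq\<close>)
qed

lemma integral_norm_mult_le:
  assumes "f \<in> sq_int M" "g \<in> sq_int M"
  shows "(LINT x|M. cmod (f x) * cmod (g x)) \<le> nrm M f * nrm M g"
proof -
  note [measurable] = sq_int_measurable[OF assms(1)] sq_int_measurable[OF assms(2)]
  have int: "integrable M (\<lambda>x. cmod (f x) * cmod (g x))"
    using integrable_norm[OF integrable_ip[OF assms]] by (simp add: norm_mult)
  have "ennreal ((LINT x|M. cmod (f x) * cmod (g x))\<^sup>2) = (\<integral>\<^sup>+x. ennreal (cmod (f x)) * ennreal (cmod (g x)) \<partial>M)\<^sup>2"
    by (simp add: nn_integral_eq_integral[OF int] ennreal_mult[symmetric] ennreal_power)
  also have "\<dots> \<le> (\<integral>\<^sup>+x. ennreal (cmod (f x))^2 \<partial>M) * (\<integral>\<^sup>+x. ennreal (cmod (g x))^2 \<partial>M)"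
    by (rule Cauchy_Schwarz_nn_integral) auto
  also have "\<dots> = ennreal ((nrm M f * nrm M g)\<^sup>2)"
    using nn_integral_sq_eq_nrm[OF assms(1)] nn_integral_sq_eq_nrm[OF assms(2)]
    by (simp add: ennreal_power ennreal_mult[symmetric] power_mult_distrib)
  finally have "(LINT x|M. cmod (f x) * cmod (g x))\<^sup>2 \<le> (nrm M f * nrm M g)\<^sup>2" by simp
  then show ?thesis by (rule power2_le_imp_le) auto
qed

lemma norm_ip_le:
  assumes "f \<in> sq_int M" "g \<in> sq_int M" shows "cmod (ip M f g) \<le> nrm M f * nrm M g"
proof -
  have "cmod (ip M f g) \<le> (LINT x|M. cmod (f x * cnj (g x)))" unfolding ip_def by (rule integral_norm_bound)
  also have "\<dots> \<le> nrm M f * nrm M g" using integral_norm_mult_le[OF assms] by (simp add: norm_mult)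
  finally show ?thesis .
qed

lemma ip_self: "ip M f f = of_real ((nrm M f)\<^sup>2)"
  unfolding ip_def nrm_sq complex_norm_square[symmetric] by (simp add: complex_norm_square[symmetric] flip: of_real_power)

lemma ip_cnj: "cnj (ip M f g) = ip M g f"
  unfolding ip_def by (subst Bochner_Integration.integral_cnj[symmetric]) (simp add: mult.commute)

lemma ip_cmult_left: "ip M (\<lambda>x. c * f x) g = c * ip M f g"
  unfolding ip_def by (simp add: mult.assoc)

lemma ip_diff_left:
  assumes "f \<in> sq_int M" "g \<in> sq_int M" "h \<in> sq_int M"
  shows "ip M (\<lambda>x. f x - g x) h = ip M f h - ip M g h"
  unfolding ip_def using integrable_ip[OF assms(1,3)] integrable_ip[OF assms(2,3)] by (simp add: left_diff_distrib)

lemma ip_diff_right: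
  assumes "f \<in> sq_int M" "g \<in> sq_int M" "h \<in> sq_int M"
  shows "ip M h (\<lambda>x. f x - g x) = ip M h f - ip M h g"
  unfolding ip_def using integrable_ip[OF assms(3,1)] integrable_ip[OF assms(3,2)] by (simp add: right_diff_distrib)

lemma nrm_add_sq:
  assumes "f \<in> sq_int M" "g \<in> sq_int M"
  shows "(nrm M (\<lambda>x. f x + g x))\<^sup>2 = (nrm M f)\<^sup>2 + (nrm M g)\<^sup>2 + 2 * Re (ip M f g)"
proof -
  have *: "(cmod (f x + g x))\<^sup>2 = (cmod (f x))\<^sup>2 + (cmod (g x))\<^sup>2 + 2 * Re (f x * cnj (g x))" for x
    by (simp only: cmod_power2) (simp add: power2_eq_square algebra_simps)
  have "integrable M (\<lambda>x. Re (f x * cnj (g x)))" by (rule integrable_Re[OF integrable_ip[OF assms]])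
  then show ?thesis
    unfolding nrm_sq * ip_def integral_Re[OF integrable_ip[OF assms], symmetric]
    using sq_int_integrable[OF assms(1)] sq_int_integrable[OF assms(2)] by (simp del: times_complex.simps)
qed

lemma nrm_cmult: "nrm M (\<lambda>x. c * f x) = cmod c * nrm M f"
  unfolding nrm_def by (simp add: norm_mult power_mult_distrib real_sqrt_mult)

lemma nrm_cnj: "nrm M (\<lambda>x. cnj (f x)) = nrm M f" by (simp add: nrm_def)

lemma nrm_triangle:
  assumes "f \<in> sq_int M" "g \<in> sq_int M" shows "nrm M (\<lambda>x. f x + g x) \<le> nrm M f + nrm M g"
proof (rule power2_le_imp_le)
  have "Re (ip M f g) \<le> nrm M f * nrm M g"
    using complex_Re_le_cmod[of "ip M f g"] norm_ip_le[OF assms] by linarith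
  then show "(nrm M (\<lambda>x. f x + g x))\<^sup>2 \<le> (nrm M f + nrm M g)\<^sup>2"
    unfolding nrm_add_sq[OF assms] by (simp add: power2_sum)
qed simp

lemma nrm_minus_commute: "nrm M (\<lambda>x. f x - g x) = nrm M (\<lambda>x. g x - f x)"
  by (simp add: nrm_def norm_minus_commute)

lemma nrm_triangle_diff:
  assumes "f \<in> sq_int M" "g \<in> sq_int M" "h \<in> sq_int M"
  shows "nrm M (\<lambda>x. f x - h x) \<le> nrm M (\<lambda>x. f x - g x) + nrm M (\<lambda>x. g x - h x)"
  using nrm_triangle[OF sq_int_diff[OF assms(1,2)] sq_int_diff[OF assms(2,3)]] by simp

lemma nrm_diff_abs_le:
  assumes "f \<in> sq_int M" "g \<in> sq_int M"
  shows "\<bar>nrm M f - nrm M g\<bar> \<le> nrm M (\<lambda>x. f x - g x)"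
  using nrm_triangle_diff[OF assms sq_int_zero] nrm_triangle_diff[OF assms(2,1) sq_int_zero]
    nrm_minus_commute[of M f g] by auto

lemma nrm_zero_iff:
  assumes "f \<in> sq_int M" shows "nrm M f = 0 \<longleftrightarrow> (AE x in M. f x = 0)"
  unfolding nrm_def using integral_nonneg_eq_0_iff_AE[OF sq_int_integrable[OF assms]] by simp

lemma nrm_diff_zeroD:
  assumes "f \<in> sq_int M" "g \<in> sq_int M" "nrm M (\<lambda>x. f x - g x) = 0"
  shows "AE x in M. f x = g x"
  using assms(3) unfolding nrm_zero_iff[OF sq_int_diff[OF assms(1,2)]] by simp

lemma sq_int_tendsto_nrm:
  assumes "\<And>k. F k \<in> sq_int M" "f \<in> sq_int M" "((\<lambda>k. nrm M (\<lambda>x. F k x - f x)) \<longlongrightarrow> 0) net"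
  shows "((\<lambda>k. nrm M (F k)) \<longlongrightarrow> nrm M f) net"
proof -
  have "((\<lambda>k. nrm M (F k) - nrm M f) \<longlongrightarrow> 0) net"
    by (rule Lim_null_comparison[OF _ assms(3)]) (use nrm_diff_abs_le[OF assms(1,2)] in auto)
  then show ?thesis by (simp add: LIM_zero_iff)
qed

lemma sq_int_tendsto_ip:
  assumes "\<And>k. F k \<in> sq_int M" "f \<in> sq_int M" "(\<lambda>k. nrm M (\<lambda>x. F k x - f x)) \<longlonglongrightarrow> 0"
    and "\<And>k. G k \<in> sq_int M" "g \<in> sq_int M" "(\<lambda>k. nrm M (\<lambda>x. G k x - g x)) \<longlonglongrightarrow> 0"
  shows "(\<lambda>k. ip M (F k) (G k)) \<longlonglongrightarrow> ip M f g"
proof -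
  have "(\<lambda>k. ip M (F k) (G k) - ip M f g) \<longlonglongrightarrow> 0"
  proof (rule Lim_null_comparison)
    show "\<forall>\<^sub>F k in sequentially. norm (ip M (F k) (G k) - ip M f g)
        \<le> nrm M (\<lambda>x. F k x - f x) * nrm M (G k) + nrm M f * nrm M (\<lambda>x. G k x - g x)"
    proof (rule always_eventually, rule allI)
      fix k
      have "ip M (F k) (G k) - ip M f g = ip M (\<lambda>x. F k x - f x) (G k) + ip M f (\<lambda>x. G k x - g x)"
        by (simp add: ip_diff_left ip_diff_right assms)
      also have "norm \<dots> \<le> norm (ip M (\<lambda>x. F k x - f x) (G k)) + norm (ip M f (\<lambda>x. G k x - g x))"
        by (rule norm_triangle_ineq)
      finally show "norm (ip M (F k) (G k) - ip M f g) \<le> nrm M (\<lambda>x. F k x - f x) * nrm M (G k) + nrm M f * nrm M (\<lambda>x. G k x - g x)"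
        using norm_ip_le[OF sq_int_diff[OF assms(1,2)] assms(4), of k k] norm_ip_le[OF assms(2) sq_int_diff[OF assms(4,5)], of k]
        by linarith
    qed
    show "(\<lambda>k. nrm M (\<lambda>x. F k x - f x) * nrm M (G k) + nrm M f * nrm M (\<lambda>x. G k x - g x)) \<longlonglongrightarrow> 0"
      using tendsto_add[OF tendsto_mult[OF assms(3) sq_int_tendsto_nrm[OF assms(4-6)]]
          tendsto_mult[OF tendsto_const[of "nrm M f"] assms(6)]] by simp
  qed
  then show ?thesis by (simp add: LIM_zero_iff)
qed

text \<open>
  Polarization: the values \<open>1\<close>, \<open>-1\<close>, \<open>\<i>\<close>, \<open>-\<i>\<close> of \<open>c\<close> recover both parts of an inner product from norms. Two pairs
  of functions stand in for an operator and its values, because the Fourier transform on \<open>L\<^sup>2\<close> is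
  treated below as a relation.
\<close>

lemma ip_eq_of_nrm_eq:
  assumes "f \<in> sq_int M" "h \<in> sq_int M" "f' \<in> sq_int N" "h' \<in> sq_int N"
    and lin: "\<And>c. nrm N (\<lambda>x. c * f' x + h' x) = nrm M (\<lambda>x. c * f x + h x)"
  shows "ip N f' h' = ip M f h"
proof -
  have nf: "nrm N f' = nrm M f" if "nrm N h' = nrm M h" "Re (ip N f' h') = Re (ip M f h)"
    using that lin[of 1] nrm_add_sq[OF assms(1,2)] nrm_add_sq[OF assms(3,4)] by simp
  have nh: "nrm N h' = nrm M h" using lin[of 0] by simp
  have main: "(cmod c)\<^sup>2 * (nrm N f')\<^sup>2 + 2 * Re (c * ip N f' h') = (cmod c)\<^sup>2 * (nrm M f)\<^sup>2 + 2 * Re (c * ip M f h)" for c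
    using lin[of c] nrm_add_sq[OF sq_int_cmult[OF assms(1)] assms(2), of c]
      nrm_add_sq[OF sq_int_cmult[OF assms(3)] assms(4), of c] nh
    by (simp add: nrm_cmult ip_cmult_left power_mult_distrib)
  show ?thesis
    using main[of 1] main[of "-1"] main[of "\<i>"] main[of "-\<i>"] by (auto intro!: complex_eqI)
qed

subsection \<open>Convergence theorems\<close>

text \<open>
  The Riesz--Fischer theorem. Along a subsequence whose increments \<open>d k\<close> have norm at most \<open>(1/2)^k\<close> the
  function \<open>\<Sum>k. 2^k * (cmod (d k x))\<^sup>2\<close> has finite integral, and the bound \<open>c \<le> (1/2)^k + 2^k * c\<^sup>2\<close> turns this into
  absolute convergence of the increments at almost every point. Fatou's lemma shows that the
  pointwise limit is the limit in norm.
\<close>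

theorem sq_int_complete:
  assumes F: "\<And>k. F k \<in> sq_int M"
    and cauchy: "\<And>e. 0 < e \<Longrightarrow> \<exists>N. \<forall>m\<ge>N. \<forall>n\<ge>N. nrm M (\<lambda>x. F m x - F n x) < e"
  shows "\<exists>g \<in> sq_int M. (\<lambda>k. nrm M (\<lambda>x. F k x - g x)) \<longlonglongrightarrow> 0"
proof -
  note [measurable] = sq_int_measurable[OF F]
  have "\<forall>k::nat. \<exists>N. \<forall>m\<ge>N. \<forall>n\<ge>N. nrm M (\<lambda>x. F m x - F n x) < (1/2)^k"
    using cauchy by simp
  then obtain N where N: "\<And>k m n. m \<ge> N k \<Longrightarrow> n \<ge> N k \<Longrightarrow> nrm M (\<lambda>x. F m x - F n x) < (1/2)^(k::nat)"
    by metis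
  (* The sum dominates N k and makes r increasing; the summand k makes r unbounded. *)
  define r where "r k = (\<Sum>i\<le>k. N i) + k" for k
  have rN: "N k \<le> r k" for k
    unfolding r_def by (rule trans_le_add1) (rule member_le_sum, auto)
  have rmono: "k \<le> l \<Longrightarrow> r k \<le> r l" for k l
    unfolding r_def by (intro add_mono sum_mono2) auto
  define d where "d k x = F (r (Suc k)) x - F (r k) x" for k x
  have d2[measurable]: "d k \<in> sq_int M" "d k \<in> borel_measurable M" for k
    unfolding d_def by (auto intro!: sq_int_diff F)
  have dn: "nrm M (d k) \<le> (1/2)^k" for k
    unfolding d_def using N[of k "r (Suc k)" "r k"] rN[of k] rmono[of k "Suc k"] by simp
  have "(\<integral>\<^sup>+x. (\<Sum>k. ennreal (2^k * (cmod (d k x))\<^sup>2)) \<partial>M) = (\<Sum>k. \<integral>\<^sup>+x. ennreal (2^k * (cmod (d k x))\<^sup>2) \<partial>M)"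
    by (rule nn_integral_suminf) auto
  also have "\<dots> = (\<Sum>k. ennreal (2^k * (nrm M (d k))\<^sup>2))"
    by (simp add: ennreal_mult nn_integral_cmult nn_integral_sq_eq_nrm d2)
  also have "\<dots> \<le> (\<Sum>k. ennreal ((1/2)^k))"
  proof (intro suminf_le ennreal_leI)
    fix k
    have "2^k * (nrm M (d k))\<^sup>2 \<le> 2^k * ((1/2)^k)\<^sup>2" using dn[of k] by (intro mult_left_mono power_mono) auto
    also have "\<dots> = (1/2)^k" by (simp add: power2_eq_square power_one_over)
    finally show "2^k * (nrm M (d k))\<^sup>2 \<le> (1/2)^k" .
  qed auto
  also have "\<dots> < \<infinity>" by (simp add: suminf_ennreal2 summable_geometric)
  finally have "(\<integral>\<^sup>+x. (\<Sum>k. ennreal (2^k * (cmod (d k x))\<^sup>2)) \<partial>M) \<noteq> \<infinity>" by simp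
  then have ae: "AE x in M. (\<Sum>k. ennreal (2^k * (cmod (d k x))\<^sup>2)) \<noteq> \<infinity>"
    by (intro nn_integral_noteq_infinite) auto
  have conv: "convergent (\<lambda>k. F (r k) x)" if "(\<Sum>k. ennreal (2^k * (cmod (d k x))\<^sup>2)) \<noteq> \<infinity>" for x
  proof -
    have "summable (\<lambda>k. 2^k * (cmod (d k x))\<^sup>2)"
      using that by (intro summable_suminf_not_top) auto
    then have s: "summable (\<lambda>k. (1/2)^k + 2^k * (cmod (d k x))\<^sup>2)"
      by (intro summable_add summable_geometric) auto
    have "summable (\<lambda>k. d k x)"
    proof (rule summable_comparison_test'[OF s, of 0])
      fix k
      define c where "c = cmod (d k x)"
      show "norm (d k x) \<le> (1/2)^k + 2^k * (cmod (d k x))\<^sup>2"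
      proof (cases "c \<le> (1/2)^k")
        case True then show ?thesis unfolding c_def by (auto intro!: add_increasing2)
      next
        case False
        then have "1 \<le> 2^k * c" by (simp add: power_one_over field_simps)
        then have "c * 1 \<le> c * (2^k * c)" by (intro mult_left_mono) (auto simp: c_def)
        then show ?thesis unfolding c_def by (simp add: power2_eq_square mult_ac add_increasing)
      qed
    qed
    then have "convergent (\<lambda>k. F (r 0) x + (\<Sum>i<k. d i x))"
      by (intro convergent_add convergent_const) (simp add: summable_iff_convergent)
    moreover have "F (r 0) x + (\<Sum>i<k. d i x) = F (r k) x" for k
      unfolding d_def by (induction k) (simp_all add: algebra_simps)
    ultimately show ?thesis by simp
  qed
  define g where "g x = lim (\<lambda>k. F (r k) x)" for x
  have g[measurable]: "g \<in> borel_measurable M" unfolding g_def by measurable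
  have lim: "AE x in M. (\<lambda>k. F (r k) x) \<longlonglongrightarrow> g x"
    using ae by eventually_elim (use conv in \<open>simp add: g_def convergent_LIMSEQ_iff\<close>)
  have bound: "(\<lambda>x. F n x - g x) \<in> sq_int M \<and> nrm M (\<lambda>x. F n x - g x) \<le> e"
    if "0 < e" and n: "\<And>m. m \<ge> n \<Longrightarrow> nrm M (\<lambda>x. F n x - F m x) \<le> e" for n e
  proof -
    have "(\<integral>\<^sup>+x. ennreal ((cmod (F n x - g x))\<^sup>2) \<partial>M) = (\<integral>\<^sup>+x. liminf (\<lambda>k. ennreal ((cmod (F n x - F (r k) x))\<^sup>2)) \<partial>M)"
    proof (rule nn_integral_cong_AE, use lim in eventually_elim)
      fix x assume "(\<lambda>k. F (r k) x) \<longlonglongrightarrow> g x"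
      then have "(\<lambda>k. ennreal ((cmod (F n x - F (r k) x))\<^sup>2)) \<longlonglongrightarrow> ennreal ((cmod (F n x - g x))\<^sup>2)"
        by (intro tendsto_intros)
      then show "ennreal ((cmod (F n x - g x))\<^sup>2) = liminf (\<lambda>k. ennreal ((cmod (F n x - F (r k) x))\<^sup>2))"
        by (rule lim_imp_Liminf[OF trivial_limit_sequentially, symmetric])
    qed
    also have "\<dots> \<le> liminf (\<lambda>k. \<integral>\<^sup>+x. ennreal ((cmod (F n x - F (r k) x))\<^sup>2) \<partial>M)"
      by (rule nn_integral_liminf) auto
    also have "\<dots> \<le> ennreal (e\<^sup>2)"
    proof (rule Liminf_le)
      have "\<forall>\<^sub>F k in sequentially. r k \<ge> n"
        unfolding r_def by (auto simp: eventually_sequentially intro!: exI[of _ n])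
      then show "\<forall>\<^sub>F k in sequentially. (\<integral>\<^sup>+x. ennreal ((cmod (F n x - F (r k) x))\<^sup>2) \<partial>M) \<le> ennreal (e\<^sup>2)"
        by eventually_elim (use n in \<open>auto simp: nn_integral_sq_eq_nrm sq_int_diff F intro!: power_mono\<close>)
    qed simp
    finally show ?thesis using that(1) by (intro conjI nrm_leI) auto
  qed
  obtain N1 where "\<forall>m\<ge>N1. \<forall>n\<ge>N1. nrm M (\<lambda>x. F m x - F n x) < 1" using cauchy[of 1] by auto
  then have "(\<lambda>x. F N1 x - g x) \<in> sq_int M" using bound[of 1 N1] by (auto intro: less_imp_le)
  from sq_int_diff[OF F[of N1] this] have gs: "g \<in> sq_int M" by simp
  have "(\<lambda>k. nrm M (\<lambda>x. F k x - g x)) \<longlonglongrightarrow> 0"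
  proof (rule LIMSEQ_I)
    fix e :: real assume "0 < e"
    then obtain N2 where N2: "\<forall>m\<ge>N2. \<forall>n\<ge>N2. nrm M (\<lambda>x. F m x - F n x) < e/2" using cauchy[of "e/2"] by auto
    have "nrm M (\<lambda>x. F n x - g x) < e" if "n \<ge> N2" for n
    proof -
      have "nrm M (\<lambda>x. F n x - g x) \<le> e/2"
        using N2 that \<open>0 < e\<close> by (intro bound[THEN conjunct2]) (auto intro: less_imp_le)
      then show ?thesis using \<open>0 < e\<close> by simp
    qed
    then show "\<exists>no. \<forall>n\<ge>no. norm (nrm M (\<lambda>x. F n x - g x) - 0) < e" by auto
  qed
  with gs show ?thesis by auto
qed

text \<open>
  Fatou's lemma is applied to \<open>2 * |F k|\<^sup>2 + 2 * |f|\<^sup>2 - |F k - f|\<^sup>2\<close>. Equality of the norms takes the place of a dominating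
  function; it is what unitary operators provide.
\<close>

lemma sq_int_scheffe:
  assumes F: "\<And>k. F k \<in> sq_int M" and f: "f \<in> sq_int M"
    and lim: "AE x in M. (\<lambda>k. F k x) \<longlonglongrightarrow> f x" and eq: "\<And>k. nrm M (F k) = nrm M f"
  shows "(\<lambda>k. nrm M (\<lambda>x. F k x - f x)) \<longlonglongrightarrow> 0"
proof -
  note [measurable] = sq_int_measurable[OF F] sq_int_measurable[OF f]
  define a where "a k = (nrm M (\<lambda>x. F k x - f x))\<^sup>2" for k
  define h where "h k x = 2 * (cmod (F k x))\<^sup>2 + 2 * (cmod (f x))\<^sup>2 - (cmod (F k x - f x))\<^sup>2" for k x
  define C where "C = 4 * (nrm M f)\<^sup>2"
  have h0: "0 \<le> h k x" for k x
    unfolding h_def using cmod_add_sq_le[of "F k x" "- f x"] by simp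
  have hi: "integrable M (h k)" for k
    unfolding h_def using sq_int_integrable[OF F] sq_int_integrable[OF f] sq_int_integrable[OF sq_int_diff[OF F f]] by auto
  have hI: "(LINT x|M. h k x) = C - a k" for k
    unfolding h_def C_def a_def
    using sq_int_integrable[OF F] sq_int_integrable[OF f] sq_int_integrable[OF sq_int_diff[OF F f]] eq[of k]
    by (simp add: nrm_sq[symmetric])
  have "ennreal C = (\<integral>\<^sup>+x. ennreal (4 * (cmod (f x))\<^sup>2) \<partial>M)"
    unfolding C_def by (simp add: ennreal_mult nn_integral_cmult nn_integral_sq_eq_nrm[OF f])
  also have "\<dots> = (\<integral>\<^sup>+x. liminf (\<lambda>k. ennreal (h k x)) \<partial>M)"
  proof (rule nn_integral_cong_AE, use lim in eventually_elim)
    fix x assume l: "(\<lambda>k. F k x) \<longlonglongrightarrow> f x"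
    have "(\<lambda>k. ennreal (h k x)) \<longlonglongrightarrow> ennreal (2 * (cmod (f x))\<^sup>2 + 2 * (cmod (f x))\<^sup>2 - (cmod (f x - f x))\<^sup>2)"
      unfolding h_def by (intro tendsto_intros l)
    from lim_imp_Liminf[OF trivial_limit_sequentially this]
    show "ennreal (4 * (cmod (f x))\<^sup>2) = liminf (\<lambda>k. ennreal (h k x))" by simp
  qed
  also have "\<dots> \<le> liminf (\<lambda>k. \<integral>\<^sup>+x. ennreal (h k x) \<partial>M)"
    by (rule nn_integral_liminf) (auto simp: h_def)
  also have "(\<lambda>k. \<integral>\<^sup>+x. ennreal (h k x) \<partial>M) = (\<lambda>k. ennreal (C - a k))"
    using hi h0 by (auto simp: nn_integral_eq_integral hI)
  finally have le: "ennreal C \<le> liminf (\<lambda>k. ennreal (C - a k))" .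
  have "a \<longlonglongrightarrow> 0"
  proof (rule LIMSEQ_I)
    fix e :: real assume "0 < e"
    show "\<exists>no. \<forall>n\<ge>no. norm (a n - 0) < e"
    proof (cases "C = 0")
      case True
      have "0 \<le> C - a n" for n unfolding hI[symmetric] using h0 by simp
      with True have "a n \<le> 0" for n by simp
      then have "a n = 0" for n by (simp add: a_def)
      with \<open>0 < e\<close> show ?thesis by simp
    next
      case False
      then have "C > 0" unfolding C_def by simp
      then have "ennreal (C - e) < ennreal C" using \<open>0 < e\<close> by (simp add: ennreal_lessI)
      with le have "ennreal (C - e) < liminf (\<lambda>k. ennreal (C - a k))" by simp
      then have "\<forall>\<^sub>F k in sequentially. ennreal (C - e) < ennreal (C - a k)" by (rule less_LiminfD)
      then have "\<forall>\<^sub>F k in sequentially. norm (a k - 0) < e"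
      proof eventually_elim
        case (elim k)
        have "\<not> e \<le> a k"
        proof
          assume "e \<le> a k"
          then have "ennreal (C - a k) \<le> ennreal (C - e)" by (intro ennreal_leI) simp
          with elim show False by simp
        qed
        then show ?case by (simp add: a_def)
      qed
      then show ?thesis by (simp add: eventually_sequentially)
    qed
  qed
  then have "(\<lambda>k. sqrt (a k)) \<longlonglongrightarrow> sqrt 0" by (rule tendsto_real_sqrt)
  then show ?thesis by (simp add: a_def)
qed

lemma sq_int_dominated:
  assumes F: "\<And>k. F k \<in> sq_int M" and f: "f \<in> sq_int M"
    and lim: "AE x in M. (\<lambda>k. F k x) \<longlonglongrightarrow> f x" and g: "g \<in> sq_int M" and dom: "\<And>k x. cmod (F k x - f x) \<le> cmod (g x)"
  shows "(\<lambda>k. nrm M (\<lambda>x. F k x - f x)) \<longlonglongrightarrow> 0"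
proof -
  note [measurable] = sq_int_measurable[OF F] sq_int_measurable[OF f]
  have "(\<lambda>k. LINT x|M. (cmod (F k x - f x))\<^sup>2) \<longlonglongrightarrow> (LINT x|M. 0)"
  proof (rule integral_dominated_convergence[where w="\<lambda>x. (cmod (g x))\<^sup>2"])
    show "AE x in M. (\<lambda>k. (cmod (F k x - f x))\<^sup>2) \<longlonglongrightarrow> 0"
      using lim by eventually_elim (auto intro!: tendsto_eq_intros)
  qed (use sq_int_integrable[OF g] dom in \<open>auto intro!: power_mono\<close>)
  then have "(\<lambda>k. sqrt (LINT x|M. (cmod (F k x - f x))\<^sup>2)) \<longlonglongrightarrow> sqrt 0" by (intro tendsto_real_sqrt) simp
  then show ?thesis by (simp add: nrm_def)
qed

lemma nn_integral_tendsto_iff_nrm: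
  assumes "\<And>k. (\<lambda>x. F k x - f x) \<in> sq_int M"
  shows "((\<lambda>k. \<integral>\<^sup>+x. ennreal ((cmod (F k x - f x))\<^sup>2) \<partial>M) \<longlongrightarrow> 0) net \<longleftrightarrow>
         ((\<lambda>k. nrm M (\<lambda>x. F k x - f x)) \<longlongrightarrow> 0) net"
proof -
  have "((\<lambda>k. \<integral>\<^sup>+x. ennreal ((cmod (F k x - f x))\<^sup>2) \<partial>M) \<longlongrightarrow> 0) net \<longleftrightarrow>
    ((\<lambda>k. ennreal ((nrm M (\<lambda>x. F k x - f x))\<^sup>2)) \<longlongrightarrow> ennreal 0) net"
    using assms by (simp add: nn_integral_sq_eq_nrm)
  also have "\<dots> \<longleftrightarrow> ((\<lambda>k. (nrm M (\<lambda>x. F k x - f x))\<^sup>2) \<longlongrightarrow> 0) net"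
    by (rule tendsto_ennreal_iff) auto
  also have "\<dots> \<longleftrightarrow> ((\<lambda>k. nrm M (\<lambda>x. F k x - f x)) \<longlongrightarrow> 0) net"
  proof
    assume "((\<lambda>k. (nrm M (\<lambda>x. F k x - f x))\<^sup>2) \<longlongrightarrow> 0) net"
    then have "((\<lambda>k. sqrt ((nrm M (\<lambda>x. F k x - f x))\<^sup>2)) \<longlongrightarrow> sqrt 0) net" by (rule tendsto_real_sqrt)
    then show "((\<lambda>k. nrm M (\<lambda>x. F k x - f x)) \<longlongrightarrow> 0) net" by simp
  next
    assume "((\<lambda>k. nrm M (\<lambda>x. F k x - f x)) \<longlongrightarrow> 0) net"
    from tendsto_power[OF this, of 2] show "((\<lambda>k. (nrm M (\<lambda>x. F k x - f x))\<^sup>2) \<longlongrightarrow> 0) net" by simp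
  qed
  finally show ?thesis .
qed

subsection \<open>Density of continuous functions and continuity of translations\<close>

lemma sq_int_bounded_finite:
  assumes "finite_measure M" "f \<in> borel_measurable M" "\<And>x. cmod (f x) \<le> B"
  shows "f \<in> sq_int M"
proof -
  interpret finite_measure M by fact
  note [measurable] = assms(2)
  have "(cmod (f x))\<^sup>2 \<le> B\<^sup>2" for x using assms(3)[of x] by (intro power_mono) auto
  then have "integrable M (\<lambda>x. (cmod (f x))\<^sup>2)"
    by (intro integrable_const_bound[where B="B\<^sup>2"]) auto
  then show ?thesis using assms(2) by (simp add: sq_int_def)
qed

lemma nrm_le_of_bounded_support:
  assumes "finite_measure M" "f \<in> borel_measurable M" "A \<in> sets M" "\<And>x. cmod (f x) \<le> indicator A x"
  shows "nrm M f \<le> sqrt (measure M A)"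
proof -
  interpret finite_measure M by fact
  note [measurable] = assms(2,3)
  have "(\<integral>\<^sup>+x. ennreal ((cmod (f x))\<^sup>2) \<partial>M) \<le> (\<integral>\<^sup>+x. indicator A x \<partial>M)"
  proof (rule nn_integral_mono)
    fix x
    have "(cmod (f x))\<^sup>2 \<le> (indicator A x)\<^sup>2" using assms(4)[of x] by (intro power_mono) auto
    also have "(indicator A x :: real)\<^sup>2 = indicator A x" by (simp add: indicator_def)
    finally show "ennreal ((cmod (f x))\<^sup>2) \<le> indicator A x"
      unfolding ennreal_indicator[symmetric] by (rule ennreal_leI)
  qed
  also have "\<dots> = ennreal ((sqrt (measure M A))\<^sup>2)" by (simp add: emeasure_eq_measure)
  finally show ?thesis by (intro nrm_leI(2)[OF assms(2)]) auto
qed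

text \<open>
  By regularity the set lies between a compact \<open>K\<close> and an open \<open>U\<close> with \<open>U - K\<close> small, and a Urysohn function for \<open>K\<close> and
  the complement of \<open>U\<close> differs from the indicator only on \<open>U - K\<close>.
\<close>

lemma continuous_approx_indicator:
  fixes M :: "'a::euclidean_space measure"
  assumes "finite_measure M" and sets: "sets M = sets borel" and A: "A \<in> sets borel" and "0 < e"
  shows "\<exists>\<psi>. continuous_on UNIV \<psi> \<and> (\<forall>x. cmod (\<psi> x) \<le> 1) \<and> nrm M (\<lambda>x. indicator A x - \<psi> x) < e"
proof -
  interpret finite_measure M by fact
  have [measurable_cong]: "sets M = sets borel" by fact
  define \<delta> where "\<delta> = e\<^sup>2 / 4"
  have \<delta>: "0 < \<delta>" using \<open>0 < e\<close> by (simp add: \<delta>_def)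
  have fin: "emeasure M (space M) \<noteq> \<infinity>" by (simp add: emeasure_eq_measure)
  note ir = inner_regular[OF sets fin A] and our = outer_regular[OF sets fin A]
  have "\<exists>K. K \<subseteq> A \<and> compact K \<and> emeasure M A < emeasure M K + \<delta>"
  proof (rule ccontr)
    assume "\<not> ?thesis"
    then have *: "emeasure M K + \<delta> \<le> emeasure M A" if "K \<subseteq> A" "compact K" for K
      using that by (meson not_less)
    have "emeasure M A \<le> ennreal (measure M A - \<delta>)"
      unfolding ir
    proof (rule SUP_least)
      fix K assume "K \<in> {K. K \<subseteq> A \<and> compact K}"
      then have "ennreal (measure M K + \<delta>) \<le> ennreal (measure M A)"
        using *[of K] \<delta> by (simp add: emeasure_eq_measure ennreal_plus)
      then show "emeasure M K \<le> ennreal (measure M A - \<delta>)"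
        by (auto simp: emeasure_eq_measure intro!: ennreal_leI)
    qed
    moreover have "\<delta> \<le> measure M A" using *[of "{}"] by (auto simp: emeasure_eq_measure)
    ultimately show False using \<delta> by (simp add: emeasure_eq_measure)
  qed
  then obtain K where K: "K \<subseteq> A" "compact K" "emeasure M A < emeasure M K + \<delta>" by auto
  have "\<exists>U. A \<subseteq> U \<and> open U \<and> emeasure M U < emeasure M A + \<delta>"
  proof (rule ccontr)
    assume "\<not> ?thesis"
    then have "emeasure M A + \<delta> \<le> emeasure M A"
      by (subst (2) our) (auto intro!: INF_greatest simp: not_less)
    then show False using \<delta> by (simp add: emeasure_eq_measure ennreal_plus[symmetric] del: ennreal_plus)
  qed
  then obtain U where U: "A \<subseteq> U" "open U" "emeasure M U < emeasure M A + \<delta>" by auto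
  have [measurable]: "K \<in> sets borel" "U \<in> sets borel" using K(2) U(2) by (auto simp: compact_imp_closed)
  have "measure M (U - K) = measure M U - measure M K"
    using K(1) U(1) by (intro finite_measure_Diff) (auto simp: sets)
  moreover have "measure M U < measure M A + \<delta>" "measure M A < measure M K + \<delta>"
    using U(3) K(3) \<delta> by (auto simp: emeasure_eq_measure ennreal_plus[symmetric] ennreal_less_iff simp del: ennreal_plus)
  moreover have "e\<^sup>2 = 4 * \<delta>" by (simp add: \<delta>_def)
  ultimately have mUK: "measure M (U - K) < e\<^sup>2" using \<delta> by linarith
  obtain \<psi> :: "'a \<Rightarrow> real" where \<psi>: "continuous_on UNIV \<psi>" "\<And>x. \<psi> x \<in> closed_segment 0 1" "\<And>x. x \<in> - U \<Longrightarrow> \<psi> x = 0" "\<And>x. x \<in> K \<Longrightarrow> \<psi> x = 1"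
    by (rule Urysohn[of "- U" K 0 1]) (use U K in \<open>auto simp: compact_imp_closed\<close>)
  have \<psi>01: "0 \<le> \<psi> x" "\<psi> x \<le> 1" for x using \<psi>(2)[of x] by (auto simp: closed_segment_eq_real_ivl)
  have [measurable]: "\<psi> \<in> borel_measurable borel" using \<psi>(1) by (rule borel_measurable_continuous_onI)
  have "nrm M (\<lambda>x. indicator A x - complex_of_real (\<psi> x)) \<le> sqrt (measure M (U - K))"
  proof (rule nrm_le_of_bounded_support)
    fix x
    have "cmod (indicator A x - complex_of_real (\<psi> x)) = \<bar>indicator A x - \<psi> x\<bar>"
      by (metis norm_of_real of_real_diff of_real_indicator)
    also have "\<dots> \<le> indicator (U - K) x"
      using \<psi>(3)[of x] \<psi>(4)[of x] \<psi>01[of x] K(1) U(1) by (auto simp: indicator_def)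
    finally show "cmod (indicator A x - complex_of_real (\<psi> x)) \<le> indicator (U - K) x" .
  qed (use A in \<open>auto simp: sets assms(1)\<close>)
  also have "\<dots> < e" using mUK \<open>0 < e\<close> by (intro real_less_lsqrt) auto
  finally show ?thesis using \<psi>01 \<psi>(1)
    by (intro exI[of _ "\<lambda>x. complex_of_real (\<psi> x)"]) (auto intro!: continuous_intros)
qed

text \<open>
  The functions that admit approximation form a linear space that contains the indicators, hence the
  simple functions, which are dense by dominated convergence.
\<close>

lemma continuous_dense_finite:
  fixes M :: "'a::euclidean_space measure"
  assumes fin: "finite_measure M" and sets: "sets M = sets borel" and f: "f \<in> sq_int M" and "0 < e"
  shows "\<exists>\<psi> B. continuous_on UNIV \<psi> \<and> (\<forall>x. cmod (\<psi> x) \<le> B) \<and> nrm M (\<lambda>x. f x - \<psi> x) < e"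
proof -
  interpret finite_measure M by fact
  have [measurable_cong]: "sets M = sets borel" by fact
  define P where "P h \<longleftrightarrow> h \<in> sq_int M \<and> (\<forall>e>0. \<exists>\<psi> B. continuous_on UNIV \<psi> \<and> (\<forall>x. cmod (\<psi> x) \<le> B) \<and> nrm M (\<lambda>x. h x - \<psi> x) < e)" for h
  have cb: "\<psi> \<in> sq_int M" if "continuous_on UNIV \<psi>" "\<forall>x. cmod (\<psi> x) \<le> B" for \<psi> B
    using that fin borel_measurable_continuous_onI[OF that(1)] by (intro sq_int_bounded_finite) auto
  have P_ind: "P (indicator A)" if "A \<in> sets borel" for A
    unfolding P_def
  proof (intro conjI allI impI)
    show "indicator A \<in> sq_int M" using that
      by (intro sq_int_bounded_finite[OF fin, of _ 1]) (auto simp: indicator_def)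
    fix e :: real assume "0 < e"
    then show "\<exists>\<psi> B. continuous_on UNIV \<psi> \<and> (\<forall>x. cmod (\<psi> x) \<le> B) \<and> nrm M (\<lambda>x. indicator A x - \<psi> x) < e"
      using continuous_approx_indicator[OF fin sets that] by blast
  qed
  have P_add: "P (\<lambda>x. c * g x + h x)" if Pg: "P g" and Ph: "P h" for g h c
    unfolding P_def
  proof (intro conjI allI impI)
    show "(\<lambda>x. c * g x + h x) \<in> sq_int M" using Pg Ph unfolding P_def by (intro sq_int_add sq_int_cmult) auto
    fix e :: real assume "0 < e"
    define d where "d = e / (2 * (cmod c + 1))"
    have d: "0 < d" using \<open>0 < e\<close> by (simp add: d_def add_nonneg_pos)
    obtain \<psi> B where 1: "continuous_on UNIV \<psi>" "\<forall>x. cmod (\<psi> x) \<le> B" "nrm M (\<lambda>x. g x - \<psi> x) < d"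
      using Pg d unfolding P_def by blast
    obtain \<phi> C where 2: "continuous_on UNIV \<phi>" "\<forall>x. cmod (\<phi> x) \<le> C" "nrm M (\<lambda>x. h x - \<phi> x) < e/2"
      using Ph half_gt_zero[OF \<open>0 < e\<close>] unfolding P_def by blast
    have gs: "(\<lambda>x. g x - \<psi> x) \<in> sq_int M" "(\<lambda>x. h x - \<phi> x) \<in> sq_int M"
      using Pg Ph cb[OF 1(1,2)] cb[OF 2(1,2)] unfolding P_def by (auto intro: sq_int_diff)
    have "nrm M (\<lambda>x. c * g x + h x - (c * \<psi> x + \<phi> x)) = nrm M (\<lambda>x. c * (g x - \<psi> x) + (h x - \<phi> x))"
      by (simp add: algebra_simps)
    also have "\<dots> \<le> cmod c * nrm M (\<lambda>x. g x - \<psi> x) + nrm M (\<lambda>x. h x - \<phi> x)"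
      using nrm_triangle[OF sq_int_cmult[OF gs(1)] gs(2), of c] by (simp add: nrm_cmult)
    also have "\<dots> < (cmod c + 1) * d + e/2"
    proof (rule add_le_less_mono[OF _ 2(3)])
      show "cmod c * nrm M (\<lambda>x. g x - \<psi> x) \<le> (cmod c + 1) * d" using 1(3) d by (intro mult_mono) auto
    qed
    also have "(cmod c + 1) * d = e / 2"
      using add_nonneg_pos[OF norm_ge_zero[of c] zero_less_one] by (simp add: d_def divide_simps)
    finally have n: "nrm M (\<lambda>x. c * g x + h x - (c * \<psi> x + \<phi> x)) < e" by simp
    have "cmod (c * \<psi> x + \<phi> x) \<le> cmod c * B + C" for x
    proof -
      have "cmod (c * \<psi> x + \<phi> x) \<le> cmod c * cmod (\<psi> x) + cmod (\<phi> x)"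
        using norm_triangle_ineq[of "c * \<psi> x" "\<phi> x"] by (simp add: norm_mult)
      also have "\<dots> \<le> cmod c * B + C" using 1(2) 2(2) by (intro add_mono mult_left_mono) auto
      finally show ?thesis .
    qed
    with n show "\<exists>\<psi> B. continuous_on UNIV \<psi> \<and> (\<forall>x. cmod (\<psi> x) \<le> B) \<and> nrm M (\<lambda>x. c * g x + h x - \<psi> x) < e"
      using 1(1) 2(1) by (intro exI[of _ "\<lambda>x. c * \<psi> x + \<phi> x"] exI[of _ "cmod c * B + C"]) (auto intro!: continuous_intros)
  qed
  have P_zero: "P (\<lambda>x. 0)" unfolding P_def
    by (auto intro!: exI[of _ "\<lambda>x. 0"] exI[of _ 0] simp: nrm_def)
  have P_sum: "P (\<lambda>x. \<Sum>y\<in>Y. y * indicator (A y) x)" if "finite Y" "\<And>y. A y \<in> sets borel" for Y A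
    using that(1)
  proof induction
    case empty show ?case using P_zero by simp
  next
    case (insert y Y)
    show ?case using P_add[OF P_ind[OF that(2)] insert(3), of y y] by (simp only: sum.insert[OF insert(1,2)])
  qed
  have P_simple: "P F" if "simple_function M F" for F
  proof -
    have sp: "space M = UNIV" using sets_eq_imp_space_eq[OF sets] by simp
    have fi: "finite (range F)" using that sp unfolding simple_function_def by simp
    have [measurable]: "F \<in> borel_measurable borel"
      using borel_measurable_simple_function[OF that] by (simp cong: measurable_cong_sets add: sets)
    have A: "F -` {y} \<in> sets borel" for y
      using measurable_sets[OF \<open>F \<in> borel_measurable borel\<close>, of "{y}"] by simp
    have "F = (\<lambda>x. \<Sum>y\<in>range F. y * indicator (F -` {y}) x)"
      using fi by (auto simp: indicator_def fun_eq_iff if_distrib cong: if_cong)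
    then show ?thesis using P_sum[of "range F" "\<lambda>y. F -` {y}", OF fi A] by simp
  qed
  obtain F where F: "\<And>i. simple_function M (F i)" "\<And>x. x \<in> space M \<Longrightarrow> (\<lambda>i. F i x) \<longlonglongrightarrow> f x" 
     "\<And>i x. x \<in> space M \<Longrightarrow> dist (F i x) 0 \<le> 2 * dist (f x) 0"
    using borel_measurable_implies_sequence_metric[OF sq_int_measurable[OF f], of 0] by blast
  have sp: "space M = UNIV" using sets_eq_imp_space_eq[OF sets] by simp
  have Fs: "F i \<in> sq_int M" for i using P_simple[OF F(1)[of i]] unfolding P_def by auto
  have "(\<lambda>k. nrm M (\<lambda>x. F k x - f x)) \<longlonglongrightarrow> 0"
  proof (rule sq_int_dominated[OF Fs f _ sq_int_cmult[OF f, of 3]])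
    show "AE x in M. (\<lambda>k. F k x) \<longlonglongrightarrow> f x" using F(2) by simp
    show "cmod (F k x - f x) \<le> cmod (3 * f x)" for k x
      using norm_triangle_ineq4[of "F k x" "f x"] F(3)[of x k] sp by (simp add: norm_mult)
  qed
  then have "\<forall>\<^sub>F k in sequentially. nrm M (\<lambda>x. F k x - f x) < e / 2"
    by (rule order_tendstoD) (use \<open>0 < e\<close> in simp)
  then obtain k where k: "nrm M (\<lambda>x. F k x - f x) < e / 2" by (auto simp: eventually_sequentially)
  obtain \<psi> B where \<psi>: "continuous_on UNIV \<psi>" "\<forall>x. cmod (\<psi> x) \<le> B" "nrm M (\<lambda>x. F k x - \<psi> x) < e/2"
    using P_simple[OF F(1)[of k]] half_gt_zero[OF \<open>0 < e\<close>] unfolding P_def by blast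
  have "nrm M (\<lambda>x. f x - \<psi> x) < e"
    using nrm_triangle_diff[OF f Fs[of k] cb[OF \<psi>(1,2)]] k \<psi>(3) nrm_minus_commute[of M f "F k"] by linarith
  with \<psi> show ?thesis by blast
qed

lemma norm_sq_eq_sum_Basis: "(norm (x::'a::euclidean_space))\<^sup>2 = (\<Sum>b\<in>Basis. (x \<bullet> b)\<^sup>2)"
  unfolding power2_norm_eq_inner by (subst euclidean_inner) (simp add: power2_eq_square)

lemma nn_integral_gaussian_finite:
  "(\<integral>\<^sup>+x. ennreal (exp (- (norm (x::'a::euclidean_space))\<^sup>2 / 2)) \<partial>lborel) < \<infinity>"
proof -
  have g: "exp (- y\<^sup>2 / 2) = sqrt (2 * pi) * std_normal_density y" for y :: real
    by (simp add: std_normal_density_def)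
  have "integrable lborel (\<lambda>y::real. exp (- y\<^sup>2 / 2))" unfolding g by simp
  then have 1: "(\<integral>\<^sup>+(y::real). ennreal (exp (- y\<^sup>2 / 2)) \<partial>lborel) < \<infinity>"
    by (simp add: integrable_iff_bounded)
  have "(\<integral>\<^sup>+x. ennreal (exp (- (norm (x::'a))\<^sup>2 / 2)) \<partial>lborel) =
     (\<integral>\<^sup>+(x::'a). (\<Prod>b\<in>Basis. ennreal (exp (- (x \<bullet> b)\<^sup>2 / 2))) \<partial>lborel)"
    by (simp add: norm_sq_eq_sum_Basis prod_ennreal exp_sum[symmetric] sum_negf sum_divide_distrib)
  also have "\<dots> = (\<Prod>b\<in>(Basis::'a set). \<integral>\<^sup>+y. ennreal (exp (- y\<^sup>2 / 2)) \<partial>lborel)"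
    by (rule nn_integral_lborel_prod) auto
  also have "\<dots> < \<infinity>" using 1 by (simp add: power_less_top_ennreal)
  finally show ?thesis .
qed

text \<open>Lebesgue measure is turned into a finite measure by a Gaussian weight, whose square root
  transports functions back and forth isometrically.\<close>

lemma continuous_dense_lborel:
  fixes f :: "'a::euclidean_space \<Rightarrow> complex"
  assumes f: "f \<in> sq_int lborel" and "0 < e"
  shows "\<exists>\<psi>. continuous_on UNIV \<psi> \<and> \<psi> \<in> sq_int lborel \<and> nrm lborel (\<lambda>x. f x - \<psi> x) < e"
proof -
  note [measurable] = sq_int_measurable[OF f]
  define w where "w x = exp (- (norm x)\<^sup>2 / 4)" for x :: 'a
  have [measurable]: "w \<in> borel_measurable borel" unfolding w_def by measurable
  have wpos: "0 < w x" for x by (simp add: w_def)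
  have w2: "(w x)\<^sup>2 = exp (- (norm x)\<^sup>2 / 2)" for x by (simp add: w_def power2_eq_square exp_add[symmetric])
  define M where "M = density lborel (\<lambda>x. ennreal ((w x)\<^sup>2))"
  have setsM[measurable_cong]: "sets M = sets borel" by (simp add: M_def)
  have fin: "finite_measure M"
    by (rule finite_measureI) (use nn_integral_gaussian_finite[where 'a='a] in \<open>auto simp: M_def emeasure_density w2\<close>)
  have trans: "(\<integral>\<^sup>+x. ennreal ((cmod (h x))\<^sup>2) \<partial>M) = (\<integral>\<^sup>+x. ennreal ((cmod (complex_of_real (w x) * h x))\<^sup>2) \<partial>lborel)"
    if [measurable]: "h \<in> borel_measurable borel" for h
    unfolding M_def by (subst nn_integral_density)
      (auto simp: ennreal_mult[symmetric] norm_mult power_mult_distrib abs_of_pos[OF wpos])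
  (* w is continuous and positive, so division by it keeps the function measurable, and
     multiplication brings continuous approximants back. *)
  define f' where "f' x = f x / complex_of_real (w x)" for x
  have [measurable]: "f' \<in> borel_measurable borel" unfolding f'_def by measurable
  have wf': "complex_of_real (w x) * f' x = f x" for x using wpos[of x] by (simp add: f'_def)
  have f': "f' \<in> sq_int M" using f trans[of f'] unfolding sq_int_iff_nn by (simp add: wf')
  obtain \<psi> B where \<psi>: "continuous_on UNIV \<psi>" "\<forall>x. cmod (\<psi> x) \<le> B" "nrm M (\<lambda>x. f' x - \<psi> x) < e"
    using continuous_dense_finite[OF fin setsM f' \<open>0 < e\<close>] by blast
  have [measurable]: "\<psi> \<in> borel_measurable borel" by (rule borel_measurable_continuous_onI) fact
  have \<psi>s: "\<psi> \<in> sq_int M" by (rule sq_int_bounded_finite[OF fin]) (use \<psi>(2) in auto)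
  have "(\<lambda>x. complex_of_real (w x) * \<psi> x) \<in> sq_int lborel" using \<psi>s trans[of \<psi>] unfolding sq_int_iff_nn by simp
  moreover have "nrm lborel (\<lambda>x. f x - complex_of_real (w x) * \<psi> x) = nrm M (\<lambda>x. f' x - \<psi> x)"
    using trans[of "\<lambda>x. f' x - \<psi> x"] by (simp add: nrm_eq_enn2real right_diff_distrib wf')
  moreover have "continuous_on UNIV (\<lambda>x. complex_of_real (w x) * \<psi> x)"
    unfolding w_def by (intro continuous_intros \<psi>(1)) auto
  ultimately show ?thesis using \<psi>(3) by (intro exI[of _ "\<lambda>x. complex_of_real (w x) * \<psi> x"]) auto
qed

lemma lborel_translation: "distr lborel borel (\<lambda>x::'a::euclidean_space. t + x) = lborel"
  using lborel_affine[of 1 t] by (simp add: density_1)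

lemma sq_int_translate:
  fixes f :: "'a::euclidean_space \<Rightarrow> complex"
  assumes "f \<in> sq_int lborel"
  shows "(\<lambda>x. f (t + x)) \<in> sq_int lborel" "nrm lborel (\<lambda>x. f (t + x)) = nrm lborel f"
proof -
  note [measurable] = sq_int_measurable[OF assms]
  have e: "(\<integral>\<^sup>+x. ennreal ((cmod (f (t + x)))\<^sup>2) \<partial>lborel) = (\<integral>\<^sup>+x. ennreal ((cmod (f x))\<^sup>2) \<partial>lborel)"
    by (subst (2) lborel_translation[of t, symmetric], subst nn_integral_distr) auto
  show "(\<lambda>x. f (t + x)) \<in> sq_int lborel" using assms e by (simp add: sq_int_iff_nn)
  show "nrm lborel (\<lambda>x. f (t + x)) = nrm lborel f" using e by (simp add: nrm_eq_enn2real)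
qed

text \<open>
  For continuous \<open>f\<close> the translates converge pointwise and keep their norm; the general case follows by density.
\<close>

lemma nrm_translate_tendsto:
  fixes f :: "'a::euclidean_space \<Rightarrow> complex"
  assumes f: "f \<in> sq_int lborel" and t: "t \<longlonglongrightarrow> 0"
  shows "(\<lambda>k. nrm lborel (\<lambda>x. f (t k + x) - f x)) \<longlonglongrightarrow> 0"
proof (rule LIMSEQ_I)
  fix e :: real assume "0 < e"
  obtain \<psi> where \<psi>: "continuous_on UNIV \<psi>" "\<psi> \<in> sq_int lborel" "nrm lborel (\<lambda>x. f x - \<psi> x) < e/3"
    using continuous_dense_lborel[OF f, of "e/3"] \<open>0 < e\<close> by auto
  have "(\<lambda>k. nrm lborel (\<lambda>x. \<psi> (t k + x) - \<psi> x)) \<longlonglongrightarrow> 0"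
  proof (rule sq_int_scheffe)
    show "AE x in lborel. (\<lambda>k. \<psi> (t k + x)) \<longlonglongrightarrow> \<psi> x"
    proof (rule AE_I2)
      fix x
      have "(\<lambda>k. t k + x) \<longlonglongrightarrow> x" using tendsto_add[OF t tendsto_const[of x]] by simp
      then show "(\<lambda>k. \<psi> (t k + x)) \<longlonglongrightarrow> \<psi> x"
        by (intro continuous_on_tendsto_compose[OF \<psi>(1)]) simp_all
    qed
  qed (use \<psi>(2) sq_int_translate in auto)
  then obtain N where N: "\<And>k. k \<ge> N \<Longrightarrow> nrm lborel (\<lambda>x. \<psi> (t k + x) - \<psi> x) < e/3"
    using LIMSEQ_D[of _ 0 "e/3"] \<open>0 < e\<close> by fastforce
  have "nrm lborel (\<lambda>x. f (t k + x) - f x) < e" if "k \<ge> N" for k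
  proof -
    have 1: "nrm lborel (\<lambda>x. f (t k + x) - \<psi> (t k + x)) < e/3"
      using sq_int_translate(2)[OF sq_int_diff[OF f \<psi>(2)], of "t k"] \<psi>(3) by simp
    show ?thesis
      using nrm_triangle_diff[OF sq_int_translate(1)[OF f, of "t k"] sq_int_translate(1)[OF \<psi>(2), of "t k"] f]
        nrm_triangle_diff[OF sq_int_translate(1)[OF \<psi>(2), of "t k"] \<psi>(2) f] 1 N[OF that] \<psi>(3) nrm_minus_commute[of lborel f \<psi>]
      by linarith
  qed
  then show "\<exists>no. \<forall>k\<ge>no. norm (nrm lborel (\<lambda>x. f (t k + x) - f x) - 0) < e" by auto
qed

section \<open>The Fourier transform of integrable functions and Plancherel's theorem\<close>

text \<open>
  The formula of \<^const>\<open>fourier\<close> on every Euclidean space: Plancherel's theorem is applied in \<open>d\<close>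
  dimensions to define the transform on \<open>L\<^sup>2\<close>, and on the line to integrate over the parameter \<open>b\<close>.
\<close>

definition FT :: "('a::euclidean_space \<Rightarrow> complex) \<Rightarrow> 'a \<Rightarrow> complex" where
  "FT f \<xi> = (LINT x|lborel. f x * cis (- 2 * pi * (x \<bullet> \<xi>)))"

lemma borel_measurable_cis [measurable]: "cis \<in> borel_measurable borel"
  by (intro borel_measurable_continuous_onI continuous_intros)

lemma FT_measurable [measurable]:
  assumes [measurable]: "f \<in> borel_measurable borel" shows "FT f \<in> borel_measurable borel"
  unfolding FT_def by measurable

lemma norm_FT_le: "cmod (FT f \<xi>) \<le> (LINT x|lborel. cmod (f x))"
  unfolding FT_def using integral_norm_bound[of lborel "\<lambda>x. f x * cis (- 2 * pi * (x \<bullet> \<xi>))"] by (simp add: norm_mult)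

lemma integrable_mult_cis:
  assumes "integrable M f" and [measurable]: "g \<in> borel_measurable M"
  shows "integrable M (\<lambda>x. f x * cis (g x))"
  by (rule Bochner_Integration.integrable_bound[OF assms(1)]) (use borel_measurable_integrable[OF assms(1)] in \<open>auto simp: norm_mult\<close>)

lemma integrable_mult_bounded:
  fixes f g :: "'a \<Rightarrow> complex"
  assumes "integrable M f" and [measurable]: "g \<in> borel_measurable M" and "\<And>x. cmod (g x) \<le> B"
  shows "integrable M (\<lambda>x. f x * g x)"
proof (rule Bochner_Integration.integrable_bound[where f="\<lambda>x. of_real B * f x"])
  show "AE x in M. norm (f x * g x) \<le> norm (of_real B * f x)"
  proof (rule AE_I2)
    fix x
    have "cmod (g x) \<le> \<bar>B\<bar>" using assms(3)[of x] by linarith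
    then have "cmod (f x) * cmod (g x) \<le> cmod (f x) * \<bar>B\<bar>" by (intro mult_left_mono) auto
    then show "norm (f x * g x) \<le> norm (of_real B * f x)" by (simp add: norm_mult mult.commute)
  qed
qed (use assms borel_measurable_integrable[OF assms(1)] in auto)

text \<open>
  Fubini's theorem and the symmetry of the kernel of the transform.
\<close>

lemma FT_mult_formula:
  assumes f: "integrable lborel f" and g: "integrable lborel g"
  shows "(LINT \<xi>|lborel. FT f \<xi> * g \<xi>) = (LINT x|lborel. f x * FT g x)"
proof -
  have [measurable]: "f \<in> borel_measurable borel" "g \<in> borel_measurable borel"
    using borel_measurable_integrable[OF f] borel_measurable_integrable[OF g] by simp_all
  define F where "F = (\<lambda>(x, \<xi>). f x * cis (- 2 * pi * (x \<bullet> \<xi>)) * g \<xi>)"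
  have F: "integrable (lborel \<Otimes>\<^sub>M lborel) F"
  proof (rule lborel_pair.Fubini_integrable)
    show "F \<in> borel_measurable (lborel \<Otimes>\<^sub>M lborel)" unfolding F_def by measurable
    have "integrable lborel (\<lambda>x. norm (f x) * (LINT \<xi>|lborel. norm (g \<xi>)))" using f by auto
    then show "integrable lborel (\<lambda>x. LINT \<xi>|lborel. norm (F (x, \<xi>)))" by (simp add: F_def norm_mult)
    have "integrable lborel (\<lambda>\<xi>. f x * cis (- 2 * pi * (x \<bullet> \<xi>)) * g \<xi>)" for x
      using integrable_mult_cis[OF integrable_mult_right[OF g, of "f x"], of "\<lambda>\<xi>. - 2 * pi * (x \<bullet> \<xi>)"]
      by (simp add: mult_ac)
    then show "AE x in lborel. integrable lborel (\<lambda>\<xi>. F (x, \<xi>))" by (simp add: F_def)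
  qed
  have "(LINT \<xi>|lborel. FT f \<xi> * g \<xi>) = (LINT \<xi>|lborel. LINT x|lborel. F (x, \<xi>))"
    unfolding FT_def F_def by simp
  also have "\<dots> = (LINT x|lborel. LINT \<xi>|lborel. F (x, \<xi>))"
    using lborel_pair.Fubini_integral[of "\<lambda>x \<xi>. F (x, \<xi>)"] F by simp
  also have "\<dots> = (LINT x|lborel. f x * FT g x)"
    unfolding FT_def F_def by (simp add: mult_ac inner_commute)
  finally show ?thesis .
qed

lemma integrable_translate:
  fixes f :: "'a::euclidean_space \<Rightarrow> complex"
  assumes f: "integrable lborel f"
  shows "integrable lborel (\<lambda>x. f (t + x))" "(LINT x|lborel. f (t + x)) = (LINT x|lborel. f x)"
proof -
  have [measurable]: "f \<in> borel_measurable borel" using borel_measurable_integrable[OF f] by simp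
  have "integrable (distr lborel borel (\<lambda>x. t + x)) f" using f by (simp add: lborel_translation)
  then show "integrable lborel (\<lambda>x. f (t + x))" by (subst (asm) integrable_distr_eq) auto
  show "(LINT x|lborel. f (t + x)) = (LINT x|lborel. f x)"
    by (subst (2) lborel_translation[of t, symmetric], subst integral_distr) auto
qed

text \<open>
  The autocorrelation \<open>\<rho>\<close> is the convolution of \<open>f\<close> with its reflected conjugate, which explains its transform. Since
  \<open>\<rho> 0\<close> is the squared norm of \<open>f\<close>, Plancherel's theorem for \<open>f\<close> becomes Fourier inversion for \<open>\<rho>\<close> at the origin.
\<close>

lemma FT_autocorrelation:
  fixes f :: "'a::euclidean_space \<Rightarrow> complex"
  assumes f: "integrable lborel f"
  defines "\<rho> \<equiv> \<lambda>z. ip lborel (\<lambda>x. f (z + x)) f"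
  shows "integrable lborel \<rho>" "FT \<rho> \<xi> = complex_of_real ((cmod (FT f \<xi>))\<^sup>2)"
proof -
  have [measurable]: "f \<in> borel_measurable borel" using borel_measurable_integrable[OF f] by simp
  define F where "F = (\<lambda>(x, z). f (z + x) * cnj (f x))"
  have norm_f: "integrable lborel (\<lambda>x. complex_of_real (cmod (f x)))" using f by auto
  have F: "integrable (lborel \<Otimes>\<^sub>M lborel) F"
  proof (rule lborel_pair.Fubini_integrable)
    show "F \<in> borel_measurable (lborel \<Otimes>\<^sub>M lborel)" unfolding F_def by measurable
    have "(LINT z|lborel. cmod (f (z + x))) = (LINT z|lborel. cmod (f z))" for x
      using integrable_translate(2)[OF norm_f, of x] by (simp add: add.commute)
    then show "integrable lborel (\<lambda>x. LINT z|lborel. norm (F (x, z)))" using f by (simp add: F_def norm_mult)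
    show "AE x in lborel. integrable lborel (\<lambda>z. F (x, z))"
      using integrable_translate(1)[OF f] by (simp add: F_def add.commute)
  qed
  have \<rho>: "\<rho> z = (LINT x|lborel. F (x, z))" for z by (simp add: \<rho>_def F_def ip_def)
  show "integrable lborel \<rho>"
    unfolding \<rho> using lborel_pair.integrable_snd[of "\<lambda>x z. F (x, z)"] F by simp
  define G where "G = (\<lambda>(x, z). F (x, z) * cis (- 2 * pi * (z \<bullet> \<xi>)))"
  have G: "integrable (lborel \<Otimes>\<^sub>M lborel) G"
    using integrable_mult_cis[OF F, of "\<lambda>(x,z). - 2 * pi * (z \<bullet> \<xi>)"] by (simp add: G_def case_prod_unfold)
  have "FT \<rho> \<xi> = (LINT z|lborel. LINT x|lborel. G (x, z))"
    unfolding FT_def \<rho> G_def by simp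
  also have "\<dots> = (LINT x|lborel. LINT z|lborel. G (x, z))"
    using lborel_pair.Fubini_integral[of "\<lambda>x z. G (x, z)"] G by simp
  also have "\<dots> = (LINT x|lborel. FT f \<xi> * cnj (f x * cis (- 2 * pi * (x \<bullet> \<xi>))))"
  proof (rule Bochner_Integration.integral_cong[OF refl])
    fix x
    have c: "cis (- 2 * pi * (z \<bullet> \<xi>)) = cis (- 2 * pi * ((x + z) \<bullet> \<xi>)) * cnj (cis (- 2 * pi * (x \<bullet> \<xi>)))" for z
      by (simp add: cis_cnj cis_mult inner_add_left algebra_simps)
    have "G (x, z) = cnj (f x * cis (- 2 * pi * (x \<bullet> \<xi>))) * (f (x + z) * cis (- 2 * pi * ((x + z) \<bullet> \<xi>)))" for z
      unfolding G_def F_def prod.case by (subst c) (simp only: complex_cnj_mult add.commute mult_ac)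
    then have "(LINT z|lborel. G (x, z)) = cnj (f x * cis (- 2 * pi * (x \<bullet> \<xi>))) * (LINT z|lborel. f (x + z) * cis (- 2 * pi * ((x + z) \<bullet> \<xi>)))"
      by simp
    also have "(LINT z|lborel. f (x + z) * cis (- 2 * pi * ((x + z) \<bullet> \<xi>))) = FT f \<xi>"
      unfolding FT_def by (rule integrable_translate(2)) (rule integrable_mult_cis[OF f], simp)
    finally show "(LINT z|lborel. G (x, z)) = FT f \<xi> * cnj (f x * cis (- 2 * pi * (x \<bullet> \<xi>)))" by simp
  qed
  also have "\<dots> = FT f \<xi> * (LINT x|lborel. cnj (f x * cis (- 2 * pi * (x \<bullet> \<xi>))))"
    by (rule integral_mult_right_zero)
  also have "(LINT x|lborel. cnj (f x * cis (- 2 * pi * (x \<bullet> \<xi>)))) = cnj (FT f \<xi>)"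
    unfolding FT_def by (rule Bochner_Integration.integral_cnj)
  finally show "FT \<rho> \<xi> = complex_of_real ((cmod (FT f \<xi>))\<^sup>2)" by (simp only: complex_norm_square)
qed

subsection \<open>Gaussian regularization\<close>

lemma lborel_integral_prod:
  fixes f :: "'a::euclidean_space \<Rightarrow> real \<Rightarrow> 'c::{real_normed_field,banach,second_countable_topology}"
  assumes int: "\<And>b. b \<in> Basis \<Longrightarrow> integrable lborel (f b)"
  shows "(LINT x|lborel. (\<Prod>b\<in>Basis. f b (x \<bullet> b))) = (\<Prod>b\<in>Basis. LINT y|lborel. f b y)"
    and "integrable lborel (\<lambda>x. \<Prod>b\<in>Basis. f b (x \<bullet> b))"
proof -
  interpret product_sigma_finite "\<lambda>_. lborel :: real measure" by unfold_locales
  have [measurable]: "b \<in> Basis \<Longrightarrow> f b \<in> borel_measurable borel" for b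
    using borel_measurable_integrable[OF int[of b]] by simp
  have c: "(\<Prod>b\<in>Basis. f b ((\<Sum>b\<in>Basis. y b *\<^sub>R b) \<bullet> b)) = (\<Prod>b\<in>Basis. f b (y b))" for y :: "'a \<Rightarrow> real"
    by (rule prod.cong) (auto simp: inner_sum_left_Basis)
  have m[measurable]: "(\<lambda>x. \<Prod>b\<in>Basis. f b (x \<bullet> b)) \<in> borel_measurable borel"
    by measurable
  show "(LINT x|lborel. (\<Prod>b\<in>Basis. f b (x \<bullet> b))) = (\<Prod>b\<in>Basis. LINT y|lborel. f b y)"
    by (subst lborel_eq, subst integral_distr)
       (auto simp: c int intro!: product_integral_prod)
  show "integrable lborel (\<lambda>x. \<Prod>b\<in>Basis. f b (x \<bullet> b))"
    by (subst lborel_eq, subst integrable_distr_eq)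
       (auto simp: c int intro!: product_integrable_prod)
qed

text \<open>
  The characteristic function of the standard normal distribution, after scaling by \<open>2 * pi * s\<close>.
\<close>

lemma FT_gaussian_1d:
  assumes "0 < s"
  shows "integrable lborel (\<lambda>x::real. complex_of_real (exp (- 2 * pi\<^sup>2 * s\<^sup>2 * x\<^sup>2)) * cis (- 2 * pi * (x * z)))" (is ?I)
    and "(LINT x|lborel. complex_of_real (exp (- 2 * pi\<^sup>2 * s\<^sup>2 * x\<^sup>2)) * cis (- 2 * pi * (x * z))) = complex_of_real (normal_density 0 s z)" (is ?E)
proof -
  define c where "c = 2 * pi * s"
  have c: "0 < c" using assms by (simp add: c_def)
  define t where "t = - z / s"
  define g where "g u = complex_of_real (std_normal_density u) * cis (t * u)" for u
  have "integrable lborel (\<lambda>u. complex_of_real (std_normal_density u))" by (intro integrable_of_real integrable_normal_density) simp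
  then have gi: "integrable lborel g" unfolding g_def by (rule integrable_mult_cis) simp
  have "char std_normal_distribution t = (LINT u|lborel. std_normal_density u *\<^sub>R iexp (t * u))"
    unfolding char_def by (subst integral_density) (auto simp: normal_density_nonneg)
  then have gI: "(LINT u|lborel. g u) = complex_of_real (exp (- t\<^sup>2 / 2))"
    unfolding char_std_normal_distribution g_def by (simp add: cis_conv_exp scaleR_conv_of_real)
  have eq: "complex_of_real (exp (- 2 * pi\<^sup>2 * s\<^sup>2 * x\<^sup>2)) * cis (- 2 * pi * (x * z)) = complex_of_real (sqrt (2 * pi)) * g (0 + c * x)" for x
  proof -
    have "exp (- 2 * pi\<^sup>2 * s\<^sup>2 * x\<^sup>2) = sqrt (2 * pi) * std_normal_density (c * x)"
      by (simp add: std_normal_density_def c_def power_mult_distrib)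
    moreover have "- 2 * pi * (x * z) = t * (c * x)" using assms by (simp add: t_def c_def field_simps)
    ultimately show ?thesis by (simp add: g_def)
  qed
  have "integrable lborel (\<lambda>x. g (0 + c * x))"
    using gi c by (subst lborel_integrable_real_affine_iff) auto
  then show ?I unfolding eq by (rule integrable_mult_right)
  have "(LINT u|lborel. g u) = c *\<^sub>R (LINT x|lborel. g (0 + c * x))"
    using c by (subst lborel_integral_real_affine[of c _ 0]) auto
  then have "(LINT x|lborel. g (0 + c * x)) = complex_of_real (exp (- t\<^sup>2 / 2) / c)"
    using c unfolding gI by (simp add: scaleR_conv_of_real field_simps)
  then have "(LINT x|lborel. complex_of_real (sqrt (2 * pi)) * g (0 + c * x)) = complex_of_real (sqrt (2 * pi) * (exp (- t\<^sup>2 / 2) / c))"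
    by simp
  also have "sqrt (2 * pi) * (exp (- t\<^sup>2 / 2) / c) = normal_density 0 s z"
  proof -
    have "2 * pi = sqrt (2 * pi) * sqrt (2 * pi)" by simp
    then have "c = sqrt (2 * pi) * (sqrt (2 * pi) * s)" unfolding c_def by (metis mult.assoc)
    moreover have "sqrt (2 * pi * s\<^sup>2) = sqrt (2 * pi) * s" using assms by (simp add: real_sqrt_mult)
    moreover have "- t\<^sup>2 / 2 = - z\<^sup>2 / (2 * s\<^sup>2)" by (simp add: t_def power_divide)
    ultimately show ?thesis using assms by (simp add: normal_density_def)
  qed
  finally show ?E unfolding eq .
qed

definition gauss :: "real \<Rightarrow> 'a::euclidean_space \<Rightarrow> real" where
  "gauss s z = (\<Prod>b\<in>Basis. normal_density 0 s (z \<bullet> b))"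

lemma gauss_nonneg: "0 \<le> gauss s z" unfolding gauss_def by (intro prod_nonneg) (simp add: normal_density_nonneg)

lemma gauss_measurable [measurable]: "gauss s \<in> borel_measurable borel"
  unfolding gauss_def by measurable

lemma gauss_integrable: "0 < s \<Longrightarrow> integrable lborel (gauss s :: 'a::euclidean_space \<Rightarrow> real)"
  unfolding gauss_def by (rule lborel_integral_prod(2)) auto

lemma gauss_integral: "0 < s \<Longrightarrow> (LINT z|lborel. gauss s (z::'a::euclidean_space)) = 1"
  unfolding gauss_def by (subst lborel_integral_prod(1)) auto

lemma gauss_scale:
  assumes "0 < s" shows "s ^ DIM('a) * gauss s (s *\<^sub>R u) = gauss 1 (u::'a::euclidean_space)"
proof -
  have "s * normal_density 0 s (s * x) = normal_density 0 1 x" for x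
    using assms by (simp add: normal_density_def real_sqrt_mult power_mult_distrib)
  then have "(\<Prod>b\<in>(Basis::'a set). s * normal_density 0 s (s * (u \<bullet> b))) = (\<Prod>b\<in>Basis. normal_density 0 1 (u \<bullet> b))"
    by simp
  then show ?thesis by (simp add: gauss_def prod.distrib)
qed

lemma FT_gaussian:
  assumes "0 < s"
  defines "W \<equiv> \<lambda>x::'a::euclidean_space. complex_of_real (exp (- 2 * pi\<^sup>2 * s\<^sup>2 * (norm x)\<^sup>2))"
  shows "integrable lborel W" "FT W z = complex_of_real (gauss s z)"
proof -
  have W: "W x * cis (- 2 * pi * (x \<bullet> z)) = 
     (\<Prod>b\<in>Basis. complex_of_real (exp (- 2 * pi\<^sup>2 * s\<^sup>2 * (x \<bullet> b)\<^sup>2)) * cis (- 2 * pi * ((x \<bullet> b) * (z \<bullet> b))))" for x z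
  proof -
    have 1: "exp (- 2 * pi\<^sup>2 * s\<^sup>2 * (norm x)\<^sup>2) = (\<Prod>b\<in>Basis. exp (- 2 * pi\<^sup>2 * s\<^sup>2 * (x \<bullet> b)\<^sup>2))"
      unfolding norm_sq_eq_sum_Basis sum_distrib_left by (rule exp_sum) simp
    have 2: "cis (- 2 * pi * (x \<bullet> z)) = (\<Prod>b\<in>Basis. cis (- 2 * pi * ((x \<bullet> b) * (z \<bullet> b))))"
      unfolding cis_conv_exp by (subst exp_sum[symmetric]) (auto simp: euclidean_inner[of x z] sum_distrib_left)
    show ?thesis unfolding W_def 1 2 by (simp add: prod.distrib)
  qed
  have Wz: "W x = W x * cis (- 2 * pi * (x \<bullet> 0))" for x by simp
  show "integrable lborel W"
    by (subst Wz[abs_def], unfold W) (rule lborel_integral_prod(2), rule FT_gaussian_1d(1)[OF assms(1)])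
  show "FT W z = complex_of_real (gauss s z)"
    unfolding FT_def W gauss_def
    by (subst lborel_integral_prod(1)) (simp_all only: FT_gaussian_1d[OF assms(1)] of_real_prod)
qed

lemma lborel_integral_scale:
  fixes f :: "'a::euclidean_space \<Rightarrow> complex"
  assumes [measurable]: "f \<in> borel_measurable borel" and "0 < s"
  shows "(LINT x|lborel. f x) = complex_of_real (s ^ DIM('a)) * (LINT x|lborel. f (s *\<^sub>R x))"
proof -
  have "(LINT x|lborel. f x) = (LINT x|density (distr lborel borel (\<lambda>x. 0 + s *\<^sub>R x)) (\<lambda>_. ennreal (\<bar>s\<bar> ^ DIM('a))). f x)"
    using lborel_affine[of s "0::'a"] \<open>0 < s\<close> by simp
  also have "\<dots> = (LINT x|distr lborel borel (\<lambda>x. s *\<^sub>R x). (s ^ DIM('a)) *\<^sub>R f x)"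
    using \<open>0 < s\<close> by (subst integral_density) auto
  also have "\<dots> = (LINT x|lborel. (s ^ DIM('a)) *\<^sub>R f (s *\<^sub>R x))"
    by (subst integral_distr) auto
  finally show ?thesis by (simp add: scaleR_conv_of_real)
qed

text \<open>
  The substitution \<open>z = s k *\<^sub>R u\<close> moves the limit from the Gaussian into \<open>\<rho>\<close>, where dominated convergence applies.
\<close>

lemma gauss_approximate_identity:
  fixes \<rho> :: "'a::euclidean_space \<Rightarrow> complex"
  assumes [measurable]: "\<rho> \<in> borel_measurable borel" and bd: "\<And>z. cmod (\<rho> z) \<le> B"
    and cont: "\<And>t. t \<longlonglongrightarrow> 0 \<Longrightarrow> (\<lambda>k. \<rho> (t k)) \<longlonglongrightarrow> \<rho> 0" and s: "\<And>k. 0 < s k" "s \<longlonglongrightarrow> 0"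
  shows "(\<lambda>k. LINT z|lborel. \<rho> z * complex_of_real (gauss (s k) z)) \<longlonglongrightarrow> \<rho> 0"
proof -
  have eq: "(LINT z|lborel. \<rho> z * complex_of_real (gauss (s k) z)) = (LINT u|lborel. \<rho> (s k *\<^sub>R u) * complex_of_real (gauss 1 u))" for k
  proof -
    have "(LINT z|lborel. \<rho> z * complex_of_real (gauss (s k) z)) =
      (LINT u|lborel. complex_of_real (s k ^ DIM('a)) * (\<rho> (s k *\<^sub>R u) * complex_of_real (gauss (s k) (s k *\<^sub>R u))))"
      by (subst lborel_integral_scale[OF _ s(1)[of k]]) auto
    also have "\<dots> = (LINT u|lborel. \<rho> (s k *\<^sub>R u) * complex_of_real (s k ^ DIM('a) * gauss (s k) (s k *\<^sub>R u)))"
      by (simp add: mult_ac)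
    finally show ?thesis by (simp only: gauss_scale[OF s(1)])
  qed
  have g: "integrable lborel (\<lambda>u::'a. complex_of_real (gauss 1 u))" by (intro integrable_of_real gauss_integrable) simp
  have "(\<lambda>k. LINT u|lborel. \<rho> (s k *\<^sub>R u) * complex_of_real (gauss 1 u)) \<longlonglongrightarrow> (LINT u|lborel. \<rho> 0 * complex_of_real (gauss 1 (u::'a)))"
  proof (rule integral_dominated_convergence[where w="\<lambda>u. B * gauss 1 u"])
    show "integrable lborel (\<lambda>u::'a. B * gauss 1 u)" using gauss_integrable[of 1, where 'a='a] by simp
    show "AE u in lborel. (\<lambda>k. \<rho> (s k *\<^sub>R u) * complex_of_real (gauss 1 u)) \<longlonglongrightarrow> \<rho> 0 * complex_of_real (gauss 1 u)"
    proof (rule AE_I2)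
      fix u :: 'a
      have "(\<lambda>k. s k *\<^sub>R u) \<longlonglongrightarrow> 0" using tendsto_scaleR[OF s(2) tendsto_const[of u]] by simp
      then show "(\<lambda>k. \<rho> (s k *\<^sub>R u) * complex_of_real (gauss 1 u)) \<longlonglongrightarrow> \<rho> 0 * complex_of_real (gauss 1 u)"
        by (intro tendsto_mult cont tendsto_const)
    qed
    show "AE u in lborel. norm (\<rho> (s k *\<^sub>R u) * complex_of_real (gauss 1 u)) \<le> B * gauss 1 u" for k
      using bd by (auto simp: norm_mult abs_of_nonneg[OF gauss_nonneg] intro!: mult_right_mono gauss_nonneg AE_I2)
  qed auto
  also have "(LINT u|lborel. \<rho> 0 * complex_of_real (gauss 1 (u::'a))) = \<rho> 0"
    using gauss_integral[of 1, where 'a='a] by (simp add: integral_complex_of_real)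
  finally show ?thesis unfolding eq .
qed

text \<open>
  The multiplication formula gives \<open>\<integral> |FT f|\<^sup>2 W = \<integral> \<rho> g\<close>, where \<open>\<rho>\<close> is the autocorrelation of \<open>f\<close>, \<open>W\<close> is a Gaussian
  with value \<open>1\<close> at the origin and \<open>g\<close> is its transform, a Gaussian density. As \<open>W\<close> increases to \<open>1\<close>, the left side
  increases to the squared norm of \<open>FT f\<close>, and the right side tends to \<open>\<rho> 0\<close>. Finiteness of the norm of \<open>FT f\<close> is part of
  the conclusion.
\<close>

theorem plancherel_L1_L2:
  fixes f :: "'a::euclidean_space \<Rightarrow> complex"
  assumes f1: "integrable lborel f" and f2: "f \<in> sq_int lborel"
  shows "FT f \<in> sq_int lborel" "nrm lborel (FT f) = nrm lborel f"
proof -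
  have [measurable]: "f \<in> borel_measurable borel" using borel_measurable_integrable[OF f1] by simp
  define \<rho> where "\<rho> z = ip lborel (\<lambda>x. f (z + x)) f" for z
  note \<rho> = FT_autocorrelation[OF f1, folded \<rho>_def]
  have \<rho>int: "integrable lborel \<rho>" using \<rho>(1) unfolding \<rho>_def .
  have [measurable]: "\<rho> \<in> borel_measurable borel" using borel_measurable_integrable[OF \<rho>int] by simp
  define s where "s k = 1 / real (Suc k)" for k
  have s: "0 < s k" for k by (simp add: s_def)
  have s0: "s \<longlonglongrightarrow> 0" unfolding s_def by (rule LIMSEQ_Suc[OF lim_1_over_n])
  define W where "W k x = exp (- 2 * pi\<^sup>2 * (s k)\<^sup>2 * (norm (x::'a))\<^sup>2)" for k x
  have [measurable]: "W k \<in> borel_measurable borel" for k unfolding W_def by measurable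
  have Wi: "integrable lborel (\<lambda>x. complex_of_real (W k x))" for k
    unfolding W_def by (rule FT_gaussian(1)[OF s])
  have eq: "(LINT \<xi>|lborel. complex_of_real ((cmod (FT f \<xi>))\<^sup>2 * W k \<xi>)) = (LINT z|lborel. \<rho> z * complex_of_real (gauss (s k) z))" for k
  proof -
    have "(LINT \<xi>|lborel. FT \<rho> \<xi> * complex_of_real (W k \<xi>)) = (LINT z|lborel. \<rho> z * FT (\<lambda>x. complex_of_real (W k x)) z)"
      by (rule FT_mult_formula[OF \<rho>int Wi])
    then show ?thesis using FT_gaussian(2)[OF s[of k], where 'a='a] \<rho>(2) by (simp add: W_def \<rho>_def)
  qed
  have lim: "(\<lambda>k. LINT z|lborel. \<rho> z * complex_of_real (gauss (s k) z)) \<longlonglongrightarrow> \<rho> 0"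
  proof (rule gauss_approximate_identity[OF _ _ _ s s0])
    show "cmod (\<rho> z) \<le> nrm lborel f * nrm lborel f" for z
      unfolding \<rho>_def using norm_ip_le[OF sq_int_translate(1)[OF f2, of z] f2] by (simp add: sq_int_translate(2)[OF f2])
    fix t :: "nat \<Rightarrow> 'a" assume t: "t \<longlonglongrightarrow> 0"
    have "(\<lambda>k. ip lborel (\<lambda>x. f (t k + x)) f) \<longlonglongrightarrow> ip lborel f f"
      by (rule sq_int_tendsto_ip[OF sq_int_translate(1)[OF f2] f2 nrm_translate_tendsto[OF f2 t] f2 f2]) (simp add: nrm_def)
    then show "(\<lambda>k. \<rho> (t k)) \<longlonglongrightarrow> \<rho> 0" by (simp add: \<rho>_def)
  qed simp
  have \<rho>0: "\<rho> 0 = complex_of_real ((nrm lborel f)\<^sup>2)" using ip_self[of lborel f] by (simp add: \<rho>_def)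
  have Fb: "cmod (FT f \<xi>) \<le> (LINT x|lborel. cmod (f x))" for \<xi> by (rule norm_FT_le)
  have int: "integrable lborel (\<lambda>\<xi>. (cmod (FT f \<xi>))\<^sup>2 * W k \<xi>)" for k
  proof -
    have "cmod (complex_of_real ((cmod (FT f \<xi>))\<^sup>2)) \<le> (LINT x|lborel. cmod (f x))\<^sup>2" for \<xi>
      using power_mono[OF Fb[of \<xi>], of 2] by (simp add: norm_power)
    from integrable_mult_bounded[OF Wi[of k] _ this]
    have "integrable lborel (\<lambda>\<xi>. complex_of_real (W k \<xi> * (cmod (FT f \<xi>))\<^sup>2))" by simp
    then show ?thesis unfolding complex_of_real_integrable_eq by (simp add: mult.commute)
  qed
  have "(\<lambda>k. LINT \<xi>|lborel. (cmod (FT f \<xi>))\<^sup>2 * W k \<xi>) \<longlonglongrightarrow> (nrm lborel f)\<^sup>2"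
    using lim unfolding eq[symmetric] \<rho>0 integral_complex_of_real tendsto_of_real_iff .
  then have "(\<lambda>k. \<integral>\<^sup>+\<xi>. ennreal ((cmod (FT f \<xi>))\<^sup>2 * W k \<xi>) \<partial>lborel) \<longlonglongrightarrow> ennreal ((nrm lborel f)\<^sup>2)"
    by (subst nn_integral_eq_integral[OF int]) (auto simp: W_def)
  moreover have "(\<lambda>k. \<integral>\<^sup>+\<xi>. ennreal ((cmod (FT f \<xi>))\<^sup>2 * W k \<xi>) \<partial>lborel) \<longlonglongrightarrow> (\<integral>\<^sup>+\<xi>. ennreal ((cmod (FT f \<xi>))\<^sup>2) \<partial>lborel)"
  proof (rule nn_integral_LIMSEQ)
    have "W k \<xi> \<le> W (Suc k) \<xi>" for k \<xi>
    proof -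
      have "(s (Suc k))\<^sup>2 \<le> (s k)\<^sup>2" by (intro power_mono) (auto simp: s_def field_simps)
      then have "2 * pi\<^sup>2 * (s (Suc k))\<^sup>2 * (norm \<xi>)\<^sup>2 \<le> 2 * pi\<^sup>2 * (s k)\<^sup>2 * (norm \<xi>)\<^sup>2"
        by (intro mult_right_mono mult_left_mono) auto
      then show ?thesis unfolding W_def by simp
    qed
    then show "incseq (\<lambda>k \<xi>. ennreal ((cmod (FT f \<xi>))\<^sup>2 * W k \<xi>))"
      by (intro incseq_SucI le_funI ennreal_leI mult_left_mono) auto
    fix \<xi>
    have "(\<lambda>k. (cmod (FT f \<xi>))\<^sup>2 * W k \<xi>) \<longlonglongrightarrow> (cmod (FT f \<xi>))\<^sup>2 * exp (- 2 * pi\<^sup>2 * 0\<^sup>2 * (norm \<xi>)\<^sup>2)"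
      unfolding W_def by (intro tendsto_intros s0)
    then show "(\<lambda>k. ennreal ((cmod (FT f \<xi>))\<^sup>2 * W k \<xi>)) \<longlonglongrightarrow> ennreal ((cmod (FT f \<xi>))\<^sup>2)"
      by (intro tendsto_ennrealI) simp
  qed simp
  ultimately have *: "(\<integral>\<^sup>+\<xi>. ennreal ((cmod (FT f \<xi>))\<^sup>2) \<partial>lborel) = ennreal ((nrm lborel f)\<^sup>2)"
    using LIMSEQ_unique by blast
  then show "FT f \<in> sq_int lborel" by (intro sq_intI) auto
  show "nrm lborel (FT f) = nrm lborel f" by (subst nrm_eq_enn2real) (auto simp: *)
qed

section \<open>The Fourier transform on square-integrable functions\<close>

lemma L2_eq_sq_int: "L2 = sq_int lborel"
  by (auto simp: L2_def sq_int_def)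

lemma L2_norm_eq_nrm: "L2_norm f = nrm lborel f"
  by (simp add: L2_norm_def nrm_def)

lemma L2_inner_eq_ip: "L2_inner f g = ip lborel f g"
  by (simp add: L2_inner_def ip_def)

lemma fourier_eq_FT: "fourier f = FT f"
  by (simp add: fourier_def FT_def fun_eq_iff)

lemma L2_tendsto_iff_nrm:
  assumes "\<And>k. F k \<in> sq_int lborel" "f \<in> sq_int lborel"
  shows "L2_tendsto F f net \<longleftrightarrow> ((\<lambda>k. nrm lborel (\<lambda>x. F k x - f x)) \<longlongrightarrow> 0) net"
  unfolding L2_tendsto_def by (rule nn_integral_tendsto_iff_nrm) (rule sq_int_diff[OF assms])

text \<open>
  The relation \<^const>\<open>is_fourier_L2\<close> speaks about extended integrals. By Plancherel's theorem all functions in it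
  are square integrable, so that convergence can be expressed with \<^const>\<open>nrm\<close>.
\<close>

lemma is_fourier_L2I:
  assumes "f \<in> sq_int lborel" "g \<in> sq_int lborel" "\<And>k. F k \<in> sq_int lborel" "\<And>k. integrable lborel (F k)"
    "(\<lambda>k. nrm lborel (\<lambda>x. F k x - f x)) \<longlonglongrightarrow> 0" "(\<lambda>k. nrm lborel (\<lambda>x. FT (F k) x - g x)) \<longlonglongrightarrow> 0"
  shows "is_fourier_L2 f g"
  unfolding is_fourier_L2_def L2_eq_sq_int fourier_eq_FT
  using assms plancherel_L1_L2(1)[OF assms(4,3)]
  by (auto simp: L2_tendsto_iff_nrm intro!: exI[of _ F])

lemma is_fourier_L2E:
  assumes "is_fourier_L2 f g"
  obtains F where "f \<in> sq_int lborel" "g \<in> sq_int lborel" "\<And>k. F k \<in> sq_int lborel" "\<And>k. integrable lborel (F k)"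
    "(\<lambda>k. nrm lborel (\<lambda>x. F k x - f x)) \<longlonglongrightarrow> 0" "(\<lambda>k. nrm lborel (\<lambda>x. FT (F k) x - g x)) \<longlonglongrightarrow> 0"
proof -
  from assms obtain F where F: "f \<in> sq_int lborel" "g \<in> sq_int lborel" "\<And>k. F k \<in> sq_int lborel" "\<And>k. integrable lborel (F k)"
    "L2_tendsto F f sequentially" "L2_tendsto (\<lambda>k. FT (F k)) g sequentially"
    unfolding is_fourier_L2_def L2_eq_sq_int fourier_eq_FT by auto
  then show thesis using that[of F] plancherel_L1_L2(1)[OF F(4,3)] by (simp add: L2_tendsto_iff_nrm)
qed

lemma is_fourier_L2_sq_int:
  assumes "is_fourier_L2 f g" shows "f \<in> sq_int lborel" "g \<in> sq_int lborel"
  using assms by (auto elim: is_fourier_L2E)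

lemma FT_lincomb:
  assumes "integrable lborel f" "integrable lborel g"
  shows "FT (\<lambda>x. c * f x + g x) \<xi> = c * FT f \<xi> + FT g \<xi>"
proof -
  have "FT (\<lambda>x. c * f x + g x) \<xi> = (LINT x|lborel. c * (f x * cis (- 2 * pi * (x \<bullet> \<xi>))) + g x * cis (- 2 * pi * (x \<bullet> \<xi>)))"
    unfolding FT_def by (simp add: distrib_right mult.assoc)
  also have "\<dots> = (LINT x|lborel. c * (f x * cis (- 2 * pi * (x \<bullet> \<xi>)))) + (LINT x|lborel. g x * cis (- 2 * pi * (x \<bullet> \<xi>)))"
    by (intro Bochner_Integration.integral_add integrable_mult_right integrable_mult_cis assms) auto
  finally show ?thesis unfolding FT_def by simp
qed

lemma tendsto_nrm_lincomb:
  assumes "\<And>k. F k \<in> sq_int M" "f \<in> sq_int M" "(\<lambda>k. nrm M (\<lambda>x. F k x - f x)) \<longlonglongrightarrow> 0"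
    and "\<And>k. G k \<in> sq_int M" "g \<in> sq_int M" "(\<lambda>k. nrm M (\<lambda>x. G k x - g x)) \<longlonglongrightarrow> 0"
  shows "(\<lambda>k. nrm M (\<lambda>x. (c * F k x + G k x) - (c * f x + g x))) \<longlonglongrightarrow> 0"
proof (rule Lim_null_comparison)
  show "\<forall>\<^sub>F k in sequentially. norm (nrm M (\<lambda>x. (c * F k x + G k x) - (c * f x + g x)))
      \<le> cmod c * nrm M (\<lambda>x. F k x - f x) + nrm M (\<lambda>x. G k x - g x)"
  proof (rule always_eventually, rule allI)
    fix k
    have "nrm M (\<lambda>x. (c * F k x + G k x) - (c * f x + g x)) = nrm M (\<lambda>x. c * (F k x - f x) + (G k x - g x))"
      by (simp add: algebra_simps)
    also have "\<dots> \<le> cmod c * nrm M (\<lambda>x. F k x - f x) + nrm M (\<lambda>x. G k x - g x)"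
      using nrm_triangle[OF sq_int_cmult[OF sq_int_diff[OF assms(1,2)]] sq_int_diff[OF assms(4,5)], of c k k]
      by (simp add: nrm_cmult)
    finally show "norm (nrm M (\<lambda>x. (c * F k x + G k x) - (c * f x + g x))) \<le> cmod c * nrm M (\<lambda>x. F k x - f x) + nrm M (\<lambda>x. G k x - g x)"
      by simp
  qed
  show "(\<lambda>k. cmod c * nrm M (\<lambda>x. F k x - f x) + nrm M (\<lambda>x. G k x - g x)) \<longlonglongrightarrow> 0"
    using tendsto_add[OF tendsto_mult[OF tendsto_const[of "cmod c"] assms(3)] assms(6)] by simp
qed

lemma is_fourier_L2_lincomb:
  assumes "is_fourier_L2 f g" "is_fourier_L2 f' g'"
  shows "is_fourier_L2 (\<lambda>x. c * f x + f' x) (\<lambda>\<xi>. c * g \<xi> + g' \<xi>)"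
proof -
  obtain F where F: "f \<in> sq_int lborel" "g \<in> sq_int lborel" "\<And>k. F k \<in> sq_int lborel" "\<And>k. integrable lborel (F k)"
    "(\<lambda>k. nrm lborel (\<lambda>x. F k x - f x)) \<longlonglongrightarrow> 0" "(\<lambda>k. nrm lborel (\<lambda>x. FT (F k) x - g x)) \<longlonglongrightarrow> 0"
    by (rule is_fourier_L2E[OF assms(1)]) (erule that, assumption+)
  obtain G where G: "f' \<in> sq_int lborel" "g' \<in> sq_int lborel" "\<And>k. G k \<in> sq_int lborel" "\<And>k. integrable lborel (G k)"
    "(\<lambda>k. nrm lborel (\<lambda>x. G k x - f' x)) \<longlonglongrightarrow> 0" "(\<lambda>k. nrm lborel (\<lambda>x. FT (G k) x - g' x)) \<longlonglongrightarrow> 0"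
    by (rule is_fourier_L2E[OF assms(2)]) (erule that, assumption+)
  show ?thesis
  proof (rule is_fourier_L2I)
    show "(\<lambda>k. nrm lborel (\<lambda>x. (c * F k x + G k x) - (c * f x + f' x))) \<longlonglongrightarrow> 0"
      by (rule tendsto_nrm_lincomb[OF F(3,1,5) G(3,1,5)])
    show "(\<lambda>k. nrm lborel (\<lambda>x. FT (\<lambda>x. c * F k x + G k x) x - (c * g x + g' x))) \<longlonglongrightarrow> 0"
      unfolding FT_lincomb[OF F(4) G(4)]
      by (rule tendsto_nrm_lincomb[OF plancherel_L1_L2(1)[OF F(4,3)] F(2,6) plancherel_L1_L2(1)[OF G(4,3)] G(2,6)])
    show "integrable lborel (\<lambda>x. c * F k x + G k x)" for k using F(4)[of k] G(4)[of k] by simp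
  qed (use F G in \<open>auto intro!: sq_int_add sq_int_cmult\<close>)
qed

lemma is_fourier_L2_nrm:
  assumes "is_fourier_L2 f g" shows "nrm lborel g = nrm lborel f"
proof -
  obtain F where F: "f \<in> sq_int lborel" "g \<in> sq_int lborel" "\<And>k. F k \<in> sq_int lborel" "\<And>k. integrable lborel (F k)"
    "(\<lambda>k. nrm lborel (\<lambda>x. F k x - f x)) \<longlonglongrightarrow> 0" "(\<lambda>k. nrm lborel (\<lambda>x. FT (F k) x - g x)) \<longlonglongrightarrow> 0"
    by (rule is_fourier_L2E[OF assms(1)]) (erule that, assumption+)
  have "(\<lambda>k. nrm lborel (F k)) \<longlonglongrightarrow> nrm lborel g"
    using sq_int_tendsto_nrm[OF plancherel_L1_L2(1)[OF F(4,3)] F(2,6)] by (simp add: plancherel_L1_L2(2)[OF F(4,3)])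
  then show ?thesis using sq_int_tendsto_nrm[OF F(3,1,5)] LIMSEQ_unique by blast
qed

lemma is_fourier_L2_ip:
  assumes "is_fourier_L2 f g" "is_fourier_L2 f' g'" shows "ip lborel g g' = ip lborel f f'"
  by (rule ip_eq_of_nrm_eq)
    (use is_fourier_L2_sq_int[OF assms(1)] is_fourier_L2_sq_int[OF assms(2)] is_fourier_L2_nrm[OF is_fourier_L2_lincomb[OF assms]] in auto)

text \<open>
  Uniqueness of the transform and injectivity at once: the two differences correspond to each other and therefore have
  the same norm.
\<close>

lemma is_fourier_L2_AE_iff:
  assumes "is_fourier_L2 f g" "is_fourier_L2 f' g'"
  shows "(AE x in lborel. f x = f' x) \<longleftrightarrow> (AE \<xi> in lborel. g \<xi> = g' \<xi>)"
proof -
  note s = is_fourier_L2_sq_int[OF assms(1)] is_fourier_L2_sq_int[OF assms(2)]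
  have "nrm lborel (\<lambda>\<xi>. g' \<xi> - g \<xi>) = nrm lborel (\<lambda>x. f' x - f x)"
    using is_fourier_L2_nrm[OF is_fourier_L2_lincomb[OF assms, of "-1"]] by simp
  moreover have "(AE x in lborel. f x = f' x) \<longleftrightarrow> nrm lborel (\<lambda>x. f' x - f x) = 0"
    unfolding nrm_zero_iff[OF sq_int_diff[OF s(3,1)]] by (auto elim!: eventually_mono)
  moreover have "(AE x in lborel. g x = g' x) \<longleftrightarrow> nrm lborel (\<lambda>x. g' x - g x) = 0"
    unfolding nrm_zero_iff[OF sq_int_diff[OF s(4,2)]] by (auto elim!: eventually_mono)
  ultimately show ?thesis by simp
qed

lemma is_fourier_L2_cong_AE:
  assumes "is_fourier_L2 f g" "g' \<in> sq_int lborel" "AE \<xi> in lborel. g \<xi> = g' \<xi>"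
  shows "is_fourier_L2 f g'"
proof -
  obtain F where F: "f \<in> sq_int lborel" "g \<in> sq_int lborel" "\<And>k. F k \<in> sq_int lborel" "\<And>k. integrable lborel (F k)"
    "(\<lambda>k. nrm lborel (\<lambda>x. F k x - f x)) \<longlonglongrightarrow> 0" "(\<lambda>k. nrm lborel (\<lambda>x. FT (F k) x - g x)) \<longlonglongrightarrow> 0"
    by (rule is_fourier_L2E[OF assms(1)]) (erule that, assumption+)
  note P = plancherel_L1_L2(1)[OF F(4,3)]
  have "nrm lborel (\<lambda>x. FT (F k) x - g' x) = nrm lborel (\<lambda>x. FT (F k) x - g x)" for k
    by (rule sq_int_cong_AE(2)[OF sq_int_diff[OF P F(2)] sq_int_measurable[OF sq_int_diff[OF P assms(2)]]])
       (use assms(3) in auto)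
  then show ?thesis using F by (intro is_fourier_L2I[OF F(1) assms(2) F(3,4,5)]) simp
qed

text \<open>Cutting a function off outside growing balls approximates it by integrable functions; their
  transforms are a Cauchy sequence by Plancherel's theorem.\<close>

lemma is_fourier_L2_exists:
  fixes f :: "real ^ 'n::finite \<Rightarrow> complex"
  assumes f: "f \<in> sq_int lborel" shows "\<exists>g. is_fourier_L2 f g"
proof -
  note [measurable] = sq_int_measurable[OF f]
  define F where "F k x = indicator (cball 0 (real k)) x * f x" for k :: nat and x
  have Fs: "F k \<in> sq_int lborel" for k
    unfolding F_def by (rule sq_int_mult_bounded[OF f, of _ 1]) (auto simp: indicator_def)
  have Fi: "integrable lborel (F k)" for k
  proof -
    have "(\<lambda>x::real^'n. indicator (cball 0 (real k)) x :: complex) \<in> sq_int lborel"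
    proof -
      have "(\<integral>\<^sup>+x. ennreal ((cmod (indicator (cball (0::real^'n) (real k)) x))\<^sup>2) \<partial>lborel) = (\<integral>\<^sup>+x. indicator (cball 0 (real k)) (x::real^'n) \<partial>lborel)"
        by (rule nn_integral_cong) (auto simp: indicator_def)
      also have "\<dots> < \<infinity>" using emeasure_lborel_cball_finite[of "0::real^'n" "real k"] by (simp add: less_top)
      finally show ?thesis by (intro sq_intI borel_measurable_indicator) auto
    qed
    from integrable_ip[OF this sq_int_cnj[OF f]] show ?thesis by (simp add: F_def[abs_def])
  qed
  have lim: "(\<lambda>k. nrm lborel (\<lambda>x. F k x - f x)) \<longlonglongrightarrow> 0"
  proof (rule sq_int_dominated[OF Fs f _ f])
    show "AE x in lborel. (\<lambda>k. F k x) \<longlonglongrightarrow> f x"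
    proof (rule AE_I2)
      fix x :: "real ^ 'n"
      obtain N where "norm x \<le> real N" using real_arch_simple by blast
      then have "\<forall>\<^sub>F k in sequentially. F k x = f x"
        by (auto simp: eventually_sequentially F_def intro!: exI[of _ N])
      then show "(\<lambda>k. F k x) \<longlonglongrightarrow> f x" by (rule tendsto_eventually)
    qed
    show "cmod (F k x - f x) \<le> cmod (f x)" for k x by (auto simp: F_def indicator_def)
  qed
  have "\<exists>g \<in> sq_int lborel. (\<lambda>k. nrm lborel (\<lambda>x. FT (F k) x - g x)) \<longlonglongrightarrow> 0"
  proof (rule sq_int_complete[OF plancherel_L1_L2(1)[OF Fi Fs]])
    fix e :: real assume "0 < e"
    then obtain N where N: "\<And>k. k \<ge> N \<Longrightarrow> nrm lborel (\<lambda>x. F k x - f x) < e/2"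
      using LIMSEQ_D[OF lim, of "e/2"] by auto
    have "nrm lborel (\<lambda>x. FT (F m) x - FT (F n) x) < e" if "m \<ge> N" "n \<ge> N" for m n
    proof -
      have "FT (F m) x - FT (F n) x = FT (\<lambda>x. F m x - F n x) x" for x
        using FT_lincomb[OF Fi[of n] Fi[of m], of "-1"] by simp
      then have "nrm lborel (\<lambda>x. FT (F m) x - FT (F n) x) = nrm lborel (\<lambda>x. F m x - F n x)"
        using plancherel_L1_L2(2)[of "\<lambda>x. F m x - F n x"] Fi sq_int_diff[OF Fs Fs] by simp
      also have "\<dots> < e"
        using nrm_triangle_diff[OF Fs f Fs, of m n] N[OF that(1)] N[OF that(2)] nrm_minus_commute[of lborel f "F n"] by linarith
      finally show ?thesis .
    qed
    then show "\<exists>N. \<forall>m\<ge>N. \<forall>n\<ge>N. nrm lborel (\<lambda>x. FT (F m) x - FT (F n) x) < e" by blast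
  qed
  then show ?thesis using is_fourier_L2I[OF f _ Fs Fi lim] by blast
qed

lemma is_fourier_L2_fourier_L2:
  "f \<in> sq_int lborel \<Longrightarrow> is_fourier_L2 f (fourier_L2 f)"
  unfolding fourier_L2_def using is_fourier_L2_exists by (rule someI_ex)

subsection \<open>Covariance under similarities\<close>

(* The transpose is kept in place, so that it can be recognized as the inverse of an orthogonal matrix. *)
declare transpose_matrix_vector [simp del]

text \<open>
  The unitary operator on \<open>L\<^sup>2\<close> that is induced by the similarity \<open>x \<mapsto> c *\<^sub>R (S *v x)\<close>. Dilations, rotations and the
  reflection at the origin are instances.
\<close>

definition sim :: "real \<Rightarrow> real ^ 'n ^ 'n \<Rightarrow> (real ^ 'n::finite \<Rightarrow> complex) \<Rightarrow> real ^ 'n \<Rightarrow> complex" where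
  "sim c S f = (\<lambda>x. complex_of_real (c powr (real CARD('n) / 2)) * f (c *\<^sub>R (S *v x)))"

lemma borel_measurable_matrix_vector [measurable]: "(\<lambda>x. (S::real ^ 'n ^ 'n::finite) *v x) \<in> borel_measurable borel"
  by (intro borel_measurable_continuous_onI matrix_vector_mult_linear_continuous_on)

text \<open>Haar's uniqueness argument: integrate \<open>indicator B y * f (S x + y)\<close> in both orders, where \<open>B\<close>
  is the unit ball, which \<open>S\<close> preserves.\<close>

lemma nn_integral_orthogonal:
  fixes S :: "real ^ 'n ^ 'n::finite"
  assumes S: "orthogonal_matrix S" and [measurable]: "f \<in> borel_measurable borel"
  shows "(\<integral>\<^sup>+x. f (S *v x) \<partial>lborel) = (\<integral>\<^sup>+x. f x \<partial>lborel)"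
proof -
  have tr: "(\<integral>\<^sup>+x. h (t + x) \<partial>lborel) = (\<integral>\<^sup>+x. h x \<partial>lborel)" if [measurable]: "h \<in> borel_measurable borel" for h :: "real ^ 'n \<Rightarrow> ennreal" and t
    by (subst (2) lborel_translation[of t, symmetric], subst nn_integral_distr) auto
  have inv: "S *v (transpose S *v y) = y" for y
    using S by (simp add: matrix_vector_mul_assoc orthogonal_matrix_def)
  have no: "norm (S *v x) = norm x" for x
    using S orthogonal_transformation_matrix[of "\<lambda>x. S *v x"]
    by (simp add: matrix_vector_mul_linear orthogonal_transformation_norm)
  define g where "g x = (indicator (ball 0 1) x :: ennreal)" for x :: "real ^ 'n"
  have [measurable]: "g \<in> borel_measurable borel" unfolding g_def by (intro borel_measurable_indicator) auto
  have g_cong: "g x = g y" if "norm x = norm y" for x y using that by (simp add: g_def indicator_def)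
  define V where "V = (\<integral>\<^sup>+x. g x \<partial>lborel)"
  have V: "V = emeasure lborel (ball (0::real^'n) 1)" by (simp add: V_def g_def)
  have V0: "V \<noteq> 0" "V \<noteq> \<infinity>"
    unfolding V using emeasure_lborel_ball_finite[of "0::real^'n" 1] using unit_ball_vol_pos[of "real CARD('n)"] by (auto simp: emeasure_ball simp del: unit_ball_vol_pos)
  have "V * (\<integral>\<^sup>+x. f (S *v x) \<partial>lborel) = (\<integral>\<^sup>+y. g y * (\<integral>\<^sup>+x. f (S *v x) \<partial>lborel) \<partial>lborel)"
    unfolding V_def by (rule nn_integral_multc[symmetric]) simp
  also have "\<dots> = (\<integral>\<^sup>+y. (\<integral>\<^sup>+x. g y * f (y + S *v x) \<partial>lborel) \<partial>lborel)"
  proof (rule nn_integral_cong)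
    fix y
    have "(\<integral>\<^sup>+x. f (S *v x) \<partial>lborel) = (\<integral>\<^sup>+x. f (S *v (transpose S *v y + x)) \<partial>lborel)"
      by (rule tr[symmetric]) simp
    then show "g y * (\<integral>\<^sup>+x. f (S *v x) \<partial>lborel) = (\<integral>\<^sup>+x. g y * f (y + S *v x) \<partial>lborel)"
      by (simp add: matrix_vector_right_distrib inv nn_integral_cmult)
  qed
  also have "\<dots> = (\<integral>\<^sup>+x. (\<integral>\<^sup>+y. g y * f (y + S *v x) \<partial>lborel) \<partial>lborel)"
    by (rule lborel_pair.Fubini') measurable
  also have "\<dots> = (\<integral>\<^sup>+x. (\<integral>\<^sup>+y. g (y - S *v x) * f y \<partial>lborel) \<partial>lborel)"
  proof (rule nn_integral_cong)
    fix x
    show "(\<integral>\<^sup>+y. g y * f (y + S *v x) \<partial>lborel) = (\<integral>\<^sup>+y. g (y - S *v x) * f y \<partial>lborel)"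
      using tr[of "\<lambda>y. g (y - S *v x) * f y" "S *v x"] by (simp add: add.commute)
  qed
  also have "\<dots> = (\<integral>\<^sup>+y. (\<integral>\<^sup>+x. g (y - S *v x) * f y \<partial>lborel) \<partial>lborel)"
    by (rule lborel_pair.Fubini') measurable
  also have "\<dots> = (\<integral>\<^sup>+y. V * f y \<partial>lborel)"
  proof (rule nn_integral_cong)
    fix y
    have eq: "g (y - S *v x) = g (- (transpose S *v y) + x)" for x
    proof (rule g_cong)
      have "y - S *v x = - (S *v (- (transpose S *v y) + x))"
        by (simp add: matrix_vector_mult_diff_distrib inv)
      then show "norm (y - S *v x) = norm (- (transpose S *v y) + x)" by (simp only: norm_minus_cancel no)
    qed
    have "(\<integral>\<^sup>+x. g (y - S *v x) * f y \<partial>lborel) = (\<integral>\<^sup>+x. g (y - S *v x) \<partial>lborel) * f y"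
      by (rule nn_integral_multc) simp
    also have "(\<integral>\<^sup>+x. g (y - S *v x) \<partial>lborel) = (\<integral>\<^sup>+x. g (- (transpose S *v y) + x) \<partial>lborel)"
      by (simp only: eq)
    also have "\<dots> = V" unfolding V_def by (rule tr) simp
    finally show "(\<integral>\<^sup>+x. g (y - S *v x) * f y \<partial>lborel) = V * f y" .
  qed
  also have "\<dots> = V * (\<integral>\<^sup>+y. f y \<partial>lborel)" by (rule nn_integral_cmult) simp
  finally show ?thesis using V0 by (simp add: ennreal_mult_cancel_left)
qed

lemma lborel_orthogonal:
  fixes S :: "real ^ 'n ^ 'n::finite"
  assumes "orthogonal_matrix S"
  shows "distr lborel borel (\<lambda>x. S *v x) = lborel"
proof (rule measure_eqI)
  fix A assume "A \<in> sets (distr lborel borel (\<lambda>x. S *v x))"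
  then have [measurable]: "A \<in> sets borel" by simp
  have "emeasure (distr lborel borel (\<lambda>x. S *v x)) A = (\<integral>\<^sup>+x. indicator A x \<partial>distr lborel borel (\<lambda>x. S *v x))"
    by simp
  also have "\<dots> = (\<integral>\<^sup>+x. indicator A (S *v x) \<partial>lborel)" by (rule nn_integral_distr) auto
  also have "\<dots> = (\<integral>\<^sup>+x. indicator A x \<partial>lborel)" by (rule nn_integral_orthogonal[OF assms]) simp
  finally show "emeasure (distr lborel borel (\<lambda>x. S *v x)) A = emeasure lborel A" by simp
qed simp

lemma nn_integral_similarity:
  fixes S :: "real ^ 'n ^ 'n::finite"
  assumes S: "orthogonal_matrix S" and "0 < c" and [measurable]: "f \<in> borel_measurable borel"
  shows "(\<integral>\<^sup>+x. f x \<partial>lborel) = ennreal (c ^ CARD('n)) * (\<integral>\<^sup>+x. f (c *\<^sub>R (S *v x)) \<partial>lborel)"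
proof -
  have "(\<integral>\<^sup>+x. f x \<partial>lborel) = (\<integral>\<^sup>+x. f x \<partial>density (distr lborel borel (\<lambda>x. 0 + c *\<^sub>R x)) (\<lambda>_. ennreal (\<bar>c\<bar> ^ CARD('n))))"
    using lborel_affine[of c "0::real^'n"] \<open>0 < c\<close> by simp
  also have "\<dots> = (\<integral>\<^sup>+x. ennreal (c ^ CARD('n)) * f (c *\<^sub>R x) \<partial>lborel)"
    using \<open>0 < c\<close> by (simp add: nn_integral_density nn_integral_distr)
  also have "\<dots> = ennreal (c ^ CARD('n)) * (\<integral>\<^sup>+x. f (c *\<^sub>R x) \<partial>lborel)"
    by (rule nn_integral_cmult) simp
  also have "(\<integral>\<^sup>+x. f (c *\<^sub>R x) \<partial>lborel) = (\<integral>\<^sup>+x. f (c *\<^sub>R (S *v x)) \<partial>lborel)"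
    by (subst (1) lborel_orthogonal[OF S, symmetric], subst nn_integral_distr) auto
  finally show ?thesis .
qed

lemma integral_similarity:
  fixes S :: "real ^ 'n ^ 'n::finite" and f :: "real ^ 'n \<Rightarrow> complex"
  assumes S: "orthogonal_matrix S" and "0 < c" and [measurable]: "f \<in> borel_measurable borel"
  shows "(LINT x|lborel. f x) = complex_of_real (c ^ CARD('n)) * (LINT x|lborel. f (c *\<^sub>R (S *v x)))"
proof -
  have "(LINT x|lborel. f (c *\<^sub>R x)) = (LINT x|lborel. f (c *\<^sub>R (S *v x)))"
    by (subst (1) lborel_orthogonal[OF S, symmetric], subst integral_distr) auto
  then show ?thesis using lborel_integral_scale[of f c] \<open>0 < c\<close> by simp
qed

lemma sim_measurable [measurable]:
  assumes [measurable]: "f \<in> borel_measurable borel" shows "sim c S f \<in> borel_measurable borel"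
  unfolding sim_def by measurable

lemma powr_half_sq: "0 < c \<Longrightarrow> (c powr (real n / 2))\<^sup>2 = c ^ n"
  by (simp add: powr_realpow[symmetric] power2_eq_square powr_add[symmetric])

lemma sim_sq_int:
  fixes S :: "real ^ 'n ^ 'n::finite"
  assumes S: "orthogonal_matrix S" and "0 < c" and f: "f \<in> sq_int lborel"
  shows "sim c S f \<in> sq_int lborel" "nrm lborel (sim c S f) = nrm lborel f"
proof -
  have [measurable]: "f \<in> borel_measurable borel" using sq_int_measurable[OF f] by simp
  have "(\<integral>\<^sup>+x. ennreal ((cmod (sim c S f x))\<^sup>2) \<partial>lborel) = (\<integral>\<^sup>+x. ennreal (c ^ CARD('n)) * ennreal ((cmod (f (c *\<^sub>R (S *v x))))\<^sup>2) \<partial>lborel)"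
    using \<open>0 < c\<close> by (simp add: sim_def norm_mult power_mult_distrib powr_half_sq ennreal_mult)
  also have "\<dots> = (\<integral>\<^sup>+x. ennreal ((cmod (f x))\<^sup>2) \<partial>lborel)"
    by (subst nn_integral_cmult) (auto simp: nn_integral_similarity[OF S \<open>0 < c\<close>, of "\<lambda>x. ennreal ((cmod (f x))\<^sup>2)"])
  finally have e: "(\<integral>\<^sup>+x. ennreal ((cmod (sim c S f x))\<^sup>2) \<partial>lborel) = (\<integral>\<^sup>+x. ennreal ((cmod (f x))\<^sup>2) \<partial>lborel)" .
  show "sim c S f \<in> sq_int lborel" using f unfolding sq_int_iff_nn e by simp
  show "nrm lborel (sim c S f) = nrm lborel f" using e by (simp add: nrm_eq_enn2real)
qed

lemma sim_diff: "sim c S (\<lambda>x. f x - g x) = (\<lambda>x. sim c S f x - sim c S g x)"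
  by (simp add: sim_def right_diff_distrib)

text \<open>
  The substitution \<open>x = c *\<^sub>R (transpose S *v y)\<close>. The dilation factor is inverted by the transform while the orthogonal part
  stays the same, because the inverse of \<open>S\<close> is its adjoint.
\<close>

lemma FT_sim:
  fixes S :: "real ^ 'n ^ 'n::finite"
  assumes S: "orthogonal_matrix S" and "0 < c" and f: "integrable lborel f"
  shows "FT (sim (1 / c) S f) = sim c S (FT f)" "integrable lborel (sim c S f)"
proof -
  have [measurable]: "f \<in> borel_measurable borel" using borel_measurable_integrable[OF f] by simp
  have oT: "orthogonal_matrix (transpose S)" using S by simp
  have inv: "S *v (transpose S *v x) = x" for x
    using S by (simp add: matrix_vector_mul_assoc orthogonal_matrix_def)
  have adj: "(transpose S *v x) \<bullet> \<xi> = x \<bullet> (S *v \<xi>)" for x \<xi>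
    unfolding transpose_matrix_vector by (rule dot_lmul_matrix)
  have "(\<integral>\<^sup>+x. ennreal (cmod (f x)) \<partial>lborel) = ennreal (c ^ CARD('n)) * (\<integral>\<^sup>+x. ennreal (cmod (f (c *\<^sub>R (S *v x)))) \<partial>lborel)"
    by (rule nn_integral_similarity[OF S \<open>0 < c\<close>]) auto
  moreover have "(\<integral>\<^sup>+x. ennreal (cmod (f x)) \<partial>lborel) < \<infinity>" using f by (simp add: integrable_iff_bounded)
  ultimately have "(\<integral>\<^sup>+x. ennreal (cmod (f (c *\<^sub>R (S *v x)))) \<partial>lborel) < \<infinity>"
    using \<open>0 < c\<close> by (auto simp: ennreal_mult_less_top)
  then have "integrable lborel (\<lambda>x. f (c *\<^sub>R (S *v x)))" by (intro integrableI_bounded) auto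
  then show "integrable lborel (sim c S f)" unfolding sim_def by (rule integrable_mult_right)
  show "FT (sim (1 / c) S f) = sim c S (FT f)"
  proof
    fix \<xi>
    have "FT (sim (1 / c) S f) \<xi> = complex_of_real (c ^ CARD('n)) * (LINT x|lborel. sim (1/c) S f (c *\<^sub>R (transpose S *v x)) * cis (- 2 * pi * ((c *\<^sub>R (transpose S *v x)) \<bullet> \<xi>)))"
      unfolding FT_def by (rule integral_similarity[OF oT \<open>0 < c\<close>]) auto
    also have "(\<lambda>x. sim (1/c) S f (c *\<^sub>R (transpose S *v x)) * cis (- 2 * pi * ((c *\<^sub>R (transpose S *v x)) \<bullet> \<xi>))) =
       (\<lambda>x. complex_of_real ((1/c) powr (real CARD('n) / 2)) * (f x * cis (- 2 * pi * (x \<bullet> (c *\<^sub>R (S *v \<xi>))))))"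
      using \<open>0 < c\<close> by (simp add: sim_def fun_eq_iff inv adj matrix_vector_mult_scaleR mult.assoc)
    also have "complex_of_real (c ^ CARD('n)) * (LINT x|lborel. complex_of_real ((1/c) powr (real CARD('n) / 2)) * (f x * cis (- 2 * pi * (x \<bullet> (c *\<^sub>R (S *v \<xi>)))))) = 
       complex_of_real (c ^ CARD('n) * (1/c) powr (real CARD('n) / 2)) * FT f (c *\<^sub>R (S *v \<xi>))"
      unfolding FT_def by simp
    also have "c ^ CARD('n) * (1/c) powr (real CARD('n) / 2) = c powr (real CARD('n) / 2)"
      using \<open>0 < c\<close> by (simp add: powr_half_sq[symmetric] powr_divide power2_eq_square)
    finally show "FT (sim (1 / c) S f) \<xi> = sim c S (FT f) \<xi>" by (simp add: sim_def)
  qed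
qed

lemma is_fourier_L2_sim:
  assumes S: "orthogonal_matrix S" and "0 < c" and "is_fourier_L2 f g"
  shows "is_fourier_L2 (sim (1 / c) S f) (sim c S g)"
proof -
  obtain F where F: "f \<in> sq_int lborel" "g \<in> sq_int lborel" "\<And>k. F k \<in> sq_int lborel" "\<And>k. integrable lborel (F k)"
    "(\<lambda>k. nrm lborel (\<lambda>x. F k x - f x)) \<longlonglongrightarrow> 0" "(\<lambda>k. nrm lborel (\<lambda>x. FT (F k) x - g x)) \<longlonglongrightarrow> 0"
    by (rule is_fourier_L2E[OF assms(3)]) (erule that, assumption+)
  have c': "0 < 1 / c" using \<open>0 < c\<close> by simp
  show ?thesis
  proof (rule is_fourier_L2I[where F="\<lambda>k. sim (1 / c) S (F k)"])
    show "(\<lambda>k. nrm lborel (\<lambda>x. sim (1 / c) S (F k) x - sim (1 / c) S f x)) \<longlonglongrightarrow> 0"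
      using F(5) unfolding sim_diff[symmetric] by (simp add: sim_sq_int(2)[OF S c'] sq_int_diff F)
    show "(\<lambda>k. nrm lborel (\<lambda>x. FT (sim (1 / c) S (F k)) x - sim c S g x)) \<longlonglongrightarrow> 0"
      using F(6) unfolding FT_sim(1)[OF S \<open>0 < c\<close> F(4)] sim_diff[symmetric]
      by (simp add: sim_sq_int(2)[OF S \<open>0 < c\<close>] sq_int_diff F plancherel_L1_L2(1)[OF F(4,3)])
  qed (use F S c' \<open>0 < c\<close> in \<open>auto intro!: sim_sq_int(1) FT_sim(2)\<close>)
qed

lemma minus_one_vector: "(- mat 1 :: real ^ 'n ^ 'n::finite) *v x = - x"
  using matrix_vector_mult_diff_rdistrib[of "0 :: real ^ 'n ^ 'n" "mat 1" x] by simp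

lemma orthogonal_matrix_minus_one: "orthogonal_matrix (- mat 1 :: real ^ 'n ^ 'n::finite)"
proof -
  have "(\<lambda>x::real ^ 'n. (- mat 1 :: real ^ 'n ^ 'n) *v x) = (\<lambda>x. - x)" by (simp add: minus_one_vector)
  then have "matrix (\<lambda>x::real ^ 'n. - x) = - mat 1"
    by (metis matrix_of_matrix_vector_mul)
  moreover have "orthogonal_transformation (\<lambda>x::real ^ 'n. - x)"
    by (simp add: orthogonal_transformation_neg orthogonal_transformation_def linear_id[unfolded id_def])
  ultimately show ?thesis using orthogonal_transformation_matrix by metis
qed

lemma is_fourier_L2_reflect:
  fixes f g :: "real ^ 'n::finite \<Rightarrow> complex"
  assumes "is_fourier_L2 f g" shows "is_fourier_L2 (\<lambda>x. f (- x)) (\<lambda>\<xi>. g (- \<xi>))"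
proof -
  have "orthogonal_matrix (- mat 1 :: real ^ 'n ^ 'n)"
    by (rule orthogonal_matrix_minus_one)
  moreover have "sim 1 (- mat 1) h = (\<lambda>x. h (- x))" for h :: "real ^ 'n \<Rightarrow> complex"
    by (simp add: sim_def fun_eq_iff minus_one_vector)
  ultimately show ?thesis using is_fourier_L2_sim[of "- mat 1" 1 f g] assms by simp
qed

lemma FT_cnj: "FT (\<lambda>x. cnj (f x)) \<xi> = cnj (FT f (- \<xi>))"
  unfolding FT_def by (subst Bochner_Integration.integral_cnj[symmetric]) (simp add: cis_cnj)

lemma is_fourier_L2_cnj:
  assumes "is_fourier_L2 f g" shows "is_fourier_L2 (\<lambda>x. cnj (f (- x))) (\<lambda>\<xi>. cnj (g \<xi>))"
proof -
  obtain F where F: "(\<lambda>x. f (- x)) \<in> sq_int lborel" "(\<lambda>\<xi>. g (- \<xi>)) \<in> sq_int lborel" "\<And>k. F k \<in> sq_int lborel" "\<And>k. integrable lborel (F k)"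
    "(\<lambda>k. nrm lborel (\<lambda>x. F k x - f (- x))) \<longlonglongrightarrow> 0" "(\<lambda>k. nrm lborel (\<lambda>x. FT (F k) x - g (- x))) \<longlonglongrightarrow> 0"
    by (rule is_fourier_L2E[OF is_fourier_L2_reflect[OF assms]]) (erule that, assumption+)
  note s = is_fourier_L2_sq_int[OF assms]
  have n1: "nrm lborel (\<lambda>x. cnj (F k x) - cnj (f (- x))) = nrm lborel (\<lambda>x. F k x - f (- x))" for k
    using nrm_cnj[of lborel "\<lambda>x. F k x - f (- x)"] by simp
  have n2: "nrm lborel (\<lambda>x. FT (\<lambda>x. cnj (F k x)) x - cnj (g x)) = nrm lborel (\<lambda>x. FT (F k) x - g (- x))" for k
  proof -
    have "nrm lborel (\<lambda>x. FT (\<lambda>x. cnj (F k x)) x - cnj (g x)) = nrm lborel (\<lambda>x. FT (F k) (- x) - g x)"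
      using nrm_cnj[of lborel "\<lambda>x. FT (F k) (- x) - g x"] by (simp add: FT_cnj)
    also have "\<dots> = nrm lborel (sim 1 (- mat 1) (\<lambda>x. FT (F k) x - g (- x)))" by (simp add: sim_def minus_one_vector)
    also have "\<dots> = nrm lborel (\<lambda>x. FT (F k) x - g (- x))"
    proof (rule sim_sq_int(2))
      show "orthogonal_matrix (- mat 1 :: real ^ 'a ^ 'a)"
        by (rule orthogonal_matrix_minus_one)
    qed (auto intro!: sq_int_diff plancherel_L1_L2(1) F)
    finally show ?thesis .
  qed
  show ?thesis
    by (rule is_fourier_L2I[where F="\<lambda>k x. cnj (F k x)"]) (use F s in \<open>auto simp: n1 n2 intro!: sq_int_cnj\<close>)
qed

subsection \<open>Surjectivity and the propagator\<close>

lemma is_fourier_L2_mult_formula: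
  assumes "is_fourier_L2 f g" "is_fourier_L2 f' g'"
  shows "ip lborel g (\<lambda>x. cnj (f' x)) = ip lborel f (\<lambda>x. cnj (g' x))"
proof -
  obtain F where F: "f \<in> sq_int lborel" "g \<in> sq_int lborel" "\<And>k. F k \<in> sq_int lborel" "\<And>k. integrable lborel (F k)"
    "(\<lambda>k. nrm lborel (\<lambda>x. F k x - f x)) \<longlonglongrightarrow> 0" "(\<lambda>k. nrm lborel (\<lambda>x. FT (F k) x - g x)) \<longlonglongrightarrow> 0"
    by (rule is_fourier_L2E[OF assms(1)]) (erule that, assumption+)
  obtain G where G: "f' \<in> sq_int lborel" "g' \<in> sq_int lborel" "\<And>k. G k \<in> sq_int lborel" "\<And>k. integrable lborel (G k)"
    "(\<lambda>k. nrm lborel (\<lambda>x. G k x - f' x)) \<longlonglongrightarrow> 0" "(\<lambda>k. nrm lborel (\<lambda>x. FT (G k) x - g' x)) \<longlonglongrightarrow> 0"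
    by (rule is_fourier_L2E[OF assms(2)]) (erule that, assumption+)
  have c: "nrm lborel (\<lambda>x. cnj (h x) - cnj (h' x)) = nrm lborel (\<lambda>x. h x - h' x)" for h h' :: "real ^ 'a \<Rightarrow> complex"
    using nrm_cnj[of lborel "\<lambda>x. h x - h' x"] by simp
  have "(\<lambda>k. ip lborel (FT (F k)) (\<lambda>x. cnj (G k x))) \<longlonglongrightarrow> ip lborel g (\<lambda>x. cnj (f' x))"
    by (rule sq_int_tendsto_ip) (use F G in \<open>auto intro!: plancherel_L1_L2(1) sq_int_cnj simp: c\<close>)
  moreover have "(\<lambda>k. ip lborel (F k) (\<lambda>x. cnj (FT (G k) x))) \<longlonglongrightarrow> ip lborel f (\<lambda>x. cnj (g' x))"
    by (rule sq_int_tendsto_ip) (use F G in \<open>auto intro!: plancherel_L1_L2(1) sq_int_cnj simp: c\<close>)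
  moreover have "ip lborel (FT (F k)) (\<lambda>x. cnj (G k x)) = ip lborel (F k) (\<lambda>x. cnj (FT (G k) x))" for k
    using FT_mult_formula[OF F(4) G(4), of k k] by (simp add: ip_def)
  ultimately show ?thesis using LIMSEQ_unique by fastforce
qed

text \<open>
  Applying the transform twice gives the reflection at the origin: tested against \<open>k\<close>, one transform
  is moved to the other side by the multiplication formula, and unitarity removes the second. Hence
  the reflected transform of \<open>g\<close> is mapped to \<open>g\<close>.
\<close>

lemma is_fourier_L2_surj:
  fixes g :: "real ^ 'n::finite \<Rightarrow> complex"
  assumes g: "g \<in> sq_int lborel" shows "\<exists>f. is_fourier_L2 f g"
proof -
  obtain h where h: "is_fourier_L2 g h" using is_fourier_L2_exists[OF g] by blast
  note hs = is_fourier_L2_sq_int[OF h]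
  obtain p where p: "is_fourier_L2 h p" using is_fourier_L2_exists[OF hs(2)] by blast
  note ps = is_fourier_L2_sq_int[OF p]
  have gr: "(\<lambda>x. g (- x)) \<in> sq_int lborel" using is_fourier_L2_sq_int[OF is_fourier_L2_reflect[OF h]] by simp
  have eq: "ip lborel p k = ip lborel (\<lambda>x. g (- x)) k" if k: "k \<in> sq_int lborel" for k
  proof -
    obtain k' where k': "is_fourier_L2 (\<lambda>x. cnj (k x)) k'" using is_fourier_L2_exists[OF sq_int_cnj[OF k]] by blast
    have "ip lborel p (\<lambda>x. cnj (cnj (k x))) = ip lborel h (\<lambda>x. cnj (k' x))"
      by (rule is_fourier_L2_mult_formula[OF p k'])
    also have "\<dots> = ip lborel g (\<lambda>x. cnj (cnj (k (- x))))"
      by (rule is_fourier_L2_ip[OF h is_fourier_L2_cnj[OF k']])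
    also have "\<dots> = (LINT x|lborel. g (- (- x)) * cnj (k (- x)))" by (simp add: ip_def)
    also have "\<dots> = ip lborel (\<lambda>x. g (- x)) k"
    proof -
      have [measurable]: "g \<in> borel_measurable borel" "k \<in> borel_measurable borel"
        using sq_int_measurable[OF g] sq_int_measurable[OF k] by simp_all
      have "orthogonal_matrix (- mat 1 :: real ^ 'n ^ 'n)"
        by (rule orthogonal_matrix_minus_one)
      from integral_similarity[OF this, of 1 "\<lambda>x. g (- x) * cnj (k x)"] show ?thesis by (simp add: ip_def minus_one_vector)
    qed
    finally show ?thesis by simp
  qed
  have d: "(\<lambda>x. p x - g (- x)) \<in> sq_int lborel" by (rule sq_int_diff[OF ps(2) gr])
  have "ip lborel (\<lambda>x. p x - g (- x)) (\<lambda>x. p x - g (- x)) = 0"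
    by (subst ip_diff_left[OF ps(2) gr d]) (simp add: eq[OF d])
  then have "nrm lborel (\<lambda>x. p x - g (- x)) = 0" unfolding ip_self by simp
  then have "AE x in lborel. p x = g (- x)" by (rule nrm_diff_zeroD[OF ps(2) gr])
  from is_fourier_L2_reflect[OF is_fourier_L2_cong_AE[OF p gr this]] show ?thesis by auto
qed

text \<open>
  The propagator is defined by a choice among the functions with the prescribed transform. One exists by surjectivity,
  and the transform of the chosen one is known almost everywhere.
\<close>

lemma is_fourier_L2_schrodinger_propagator:
  assumes fg: "is_fourier_L2 f g"
  shows "is_fourier_L2 (schrodinger_propagator b f) (\<lambda>\<xi>. cis (- 2 * pi * b * (\<xi> \<bullet> \<xi>)) * g \<xi>)"
proof -
  define \<phi> where "\<phi> t = exp (\<i> * complex_of_real (b / (2 * pi)) * complex_of_real t)" for t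
  have \<phi>: "\<phi> (- 4 * pi\<^sup>2 * (\<xi> \<bullet> \<xi>)) = cis (- 2 * pi * b * (\<xi> \<bullet> \<xi>))" for \<xi> :: "real ^ 'a"
  proof -
    have "b / (2 * pi) * (- 4 * pi\<^sup>2 * (\<xi> \<bullet> \<xi>)) = - 2 * pi * b * (\<xi> \<bullet> \<xi>)"
      by (simp add: field_simps power2_eq_square)
    then show ?thesis unfolding \<phi>_def cis_conv_exp mult.assoc of_real_mult[symmetric] by simp
  qed
  note s = is_fourier_L2_sq_int[OF fg]
  have [measurable]: "g \<in> borel_measurable borel" using sq_int_measurable[OF s(2)] by simp
  have sm: "(\<lambda>\<xi>. cis (- 2 * pi * b * (\<xi> \<bullet> \<xi>)) * g \<xi>) \<in> sq_int lborel"
    by (rule sq_int_mult_bounded[OF s(2), of _ 1]) auto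
  have fe: "AE \<xi> in lborel. fourier_L2 f \<xi> = g \<xi>"
    using is_fourier_L2_AE_iff[OF is_fourier_L2_fourier_L2[OF s(1)] fg] by simp
  obtain u where u: "is_fourier_L2 u (\<lambda>\<xi>. cis (- 2 * pi * b * (\<xi> \<bullet> \<xi>)) * g \<xi>)"
    using is_fourier_L2_surj[OF sm] by blast
  note us = is_fourier_L2_sq_int(1)[OF u]
  have "AE \<xi> in lborel. fourier_L2 u \<xi> = cis (- 2 * pi * b * (\<xi> \<bullet> \<xi>)) * g \<xi>"
    using is_fourier_L2_AE_iff[OF is_fourier_L2_fourier_L2[OF us] u] by simp
  with fe have "AE \<xi> in lborel. fourier_L2 u \<xi> = \<phi> (- 4 * pi\<^sup>2 * (\<xi> \<bullet> \<xi>)) * fourier_L2 f \<xi>"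
    unfolding \<phi> by eventually_elim simp
  with us have "\<exists>u. u \<in> L2 \<and> (AE \<xi> in lborel. fourier_L2 u \<xi> = \<phi> (- 4 * pi\<^sup>2 * (\<xi> \<bullet> \<xi>)) * fourier_L2 f \<xi>)"
    unfolding L2_eq_sq_int by blast
  from someI_ex[OF this]
  have v: "schrodinger_propagator b f \<in> sq_int lborel"
    "AE \<xi> in lborel. fourier_L2 (schrodinger_propagator b f) \<xi> = \<phi> (- 4 * pi\<^sup>2 * (\<xi> \<bullet> \<xi>)) * fourier_L2 f \<xi>"
    unfolding schrodinger_propagator_def laplacian_calculus_def \<phi>_def[symmetric, abs_def] L2_eq_sq_int by auto
  have "AE \<xi> in lborel. fourier_L2 (schrodinger_propagator b f) \<xi> = cis (- 2 * pi * b * (\<xi> \<bullet> \<xi>)) * g \<xi>"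
    using v(2) fe unfolding \<phi> by eventually_elim simp
  from is_fourier_L2_cong_AE[OF is_fourier_L2_fourier_L2[OF v(1)] sm this] show ?thesis .
qed

section \<open>The representation on the Fourier side\<close>

type_synonym 'n aff_rot = "(real \<times> real) \<times> (real ^ 'n ^ 'n)"

text \<open>
  The representation conjugated by the Fourier transform. It acts on functions rather than on classes
  modulo null sets, so that the homomorphism property holds pointwise.
\<close>

definition frep :: "'n aff_rot \<Rightarrow> (real ^ 'n::finite \<Rightarrow> complex) \<Rightarrow> real ^ 'n \<Rightarrow> complex" where
  "frep = (\<lambda>((b, a), R) \<phi> \<xi>. cis (- 2 * pi * b * (\<xi> \<bullet> \<xi>)) * sim (sqrt a) (transpose R) \<phi> \<xi>)"

lemma rotation_orthogonal:
  assumes "rotation_matrix R" shows "orthogonal_matrix R" "orthogonal_matrix (transpose R)"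
  using assms by (auto simp: rotation_matrix_def)

lemma matrix_inv_orthogonal:
  fixes R :: "real ^ 'n ^ 'n::finite"
  assumes "orthogonal_matrix R" shows "matrix_inv R = transpose R"
proof -
  have R: "R ** transpose R = mat 1" "transpose R ** R = mat 1" using assms by (auto simp: orthogonal_matrix_def)
  then have "R ** matrix_inv R = mat 1 \<and> matrix_inv R ** R = mat 1"
    unfolding matrix_inv_def by (intro someI[of "\<lambda>A. R ** A = mat 1 \<and> A ** R = mat 1"]) auto
  then show ?thesis using R by (metis matrix_mul_assoc matrix_mul_lid matrix_mul_rid)
qed

lemma norm_orthogonal:
  fixes R :: "real ^ 'n ^ 'n::finite"
  assumes "orthogonal_matrix R" shows "norm (R *v x) = norm x"
  using assms orthogonal_transformation_matrix[of "\<lambda>x. R *v x"]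
  by (simp add: matrix_vector_mul_linear orthogonal_transformation_norm)

lemma rotation_transpose_cancel:
  fixes R :: "real ^ 'n ^ 'n::finite"
  assumes "rotation_matrix R" shows "transpose R *v (R *v x) = x" "R *v (transpose R *v x) = x"
  using rotation_orthogonal(1)[OF assms] by (auto simp: matrix_vector_mul_assoc orthogonal_matrix_def)

lemma is_fourier_L2_schrodinger_rep:
  assumes "0 < a" "rotation_matrix R" "is_fourier_L2 f g"
  shows "is_fourier_L2 (schrodinger_rep ((b, a), R) f) (frep ((b, a), R) g)"
proof -
  have "dilation_rotation a R f = sim (1 / sqrt a) (transpose R) f"
  proof -
    have "(1 / sqrt a) powr (real CARD('a) / 2) = a powr (- real CARD('a) / 4)"
      using assms(1) by (simp add: powr_half_sqrt[symmetric] powr_divide powr_powr powr_minus_divide)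
    moreover have "a powr (- 1 / 2) = 1 / sqrt a"
      using assms(1) by (simp add: powr_half_sqrt[symmetric] powr_minus_divide)
    ultimately show ?thesis
      by (simp only: dilation_rotation_def sim_def matrix_inv_orthogonal[OF rotation_orthogonal(1)[OF assms(2)]])
  qed
  moreover have "is_fourier_L2 (sim (1 / sqrt a) (transpose R) f) (sim (sqrt a) (transpose R) g)"
    by (rule is_fourier_L2_sim[OF rotation_orthogonal(2)[OF assms(2)] _ assms(3)]) (use assms(1) in simp)
  ultimately show ?thesis
    using is_fourier_L2_schrodinger_propagator[of "dilation_rotation a R f" _ b] by (simp add: schrodinger_rep_def frep_def)
qed

lemma carrier_schrodinger_group:
  "carrier (schrodinger_group :: 'n aff_rot monoid) = {((b, a), R). 0 < a \<and> rotation_matrix (R :: real ^ 'n ^ 'n::finite)}"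
  by (auto simp: schrodinger_group_def affine_group_def SO_group_def DirProd_def)

lemma one_schrodinger_group: "one (schrodinger_group :: 'n::finite aff_rot monoid) = ((0, 1), mat 1)"
  by (simp add: schrodinger_group_def affine_group_def SO_group_def DirProd_def)

lemma mult_schrodinger_group:
  "mult (schrodinger_group :: 'n::finite aff_rot monoid) ((b, a), R) ((b', a'), R') = ((b + a * b', a * a'), R ** R')"
  by (simp add: schrodinger_group_def affine_group_def SO_group_def DirProd_def)

lemma group_affine_group: "group affine_group"
proof (rule groupI)
  fix x assume "x \<in> carrier affine_group"
  then obtain b a where "x = (b, a)" "0 < a" by (auto simp: affine_group_def)
  then show "\<exists>y\<in>carrier affine_group. y \<otimes>\<^bsub>affine_group\<^esub> x = \<one>\<^bsub>affine_group\<^esub>"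
    by (intro bexI[of _ "(- b / a, 1 / a)"]) (auto simp: affine_group_def)
qed (auto simp: affine_group_def algebra_simps)

lemma group_SO_group: "group (SO_group :: (real ^ 'n ^ 'n::finite) monoid)"
proof (rule groupI)
  fix R :: "real ^ 'n ^ 'n" assume "R \<in> carrier SO_group"
  then show "\<exists>y\<in>carrier SO_group. y \<otimes>\<^bsub>SO_group\<^esub> R = \<one>\<^bsub>SO_group\<^esub>"
    by (intro bexI[of _ "transpose R"]) (auto simp: SO_group_def rotation_matrix_def orthogonal_matrix_def)
qed (auto simp: SO_group_def rotation_matrix_def orthogonal_matrix_mul det_mul matrix_mul_assoc orthogonal_matrix_id)

lemma group_schrodinger_group: "group (schrodinger_group :: 'n::finite aff_rot monoid)"
  unfolding schrodinger_group_def by (rule DirProd_group[OF group_affine_group group_SO_group])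

lemma frep_sq_int:
  assumes "g \<in> carrier schrodinger_group" "\<phi> \<in> sq_int lborel"
  shows "frep g \<phi> \<in> sq_int lborel" "nrm lborel (frep g \<phi>) = nrm lborel \<phi>"
proof -
  obtain b a R where g: "g = ((b, a), R)" "0 < a" "rotation_matrix R"
    using assms(1) by (cases g) (auto simp: carrier_schrodinger_group)
  note s = sim_sq_int[OF rotation_orthogonal(2)[OF g(3)] _ assms(2), of "sqrt a"]
  have "(\<lambda>\<xi>. cis (- 2 * pi * b * (\<xi> \<bullet> \<xi>)) * sim (sqrt a) (transpose R) \<phi> \<xi>) \<in> sq_int lborel"
    using s(1) g(2) by (intro sq_int_mult_bounded[of _ _ _ 1]) auto
  then show "frep g \<phi> \<in> sq_int lborel" by (simp add: g(1) frep_def)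
  have "nrm lborel (frep g \<phi>) = nrm lborel (sim (sqrt a) (transpose R) \<phi>)"
    by (simp add: g(1) frep_def nrm_def norm_mult)
  then show "nrm lborel (frep g \<phi>) = nrm lborel \<phi>" using s(2) g(2) by simp
qed

lemma frep_diff: "frep g (\<lambda>x. f x - h x) = (\<lambda>x. frep g f x - frep g h x)"
  by (cases g) (auto simp: frep_def sim_diff right_diff_distrib fun_eq_iff)

lemma frep_lincomb: "frep g (\<lambda>x. c * f x + h x) = (\<lambda>x. c * frep g f x + frep g h x)"
  by (cases g) (auto simp: frep_def sim_def algebra_simps fun_eq_iff)

lemma frep_one: "frep ((0, 1), mat 1) \<phi> = \<phi>"
  by (simp add: frep_def sim_def fun_eq_iff)

text \<open>
  The multiplier depends on \<open>\<xi> \<bullet> \<xi>\<close> only, so rotations commute with it, and the dilation by \<open>sqrt a\<close> replaces \<open>b'\<close> by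
  \<open>a * b'\<close>. This is the semidirect product law.
\<close>

lemma frep_mult:
  assumes "0 < a" "rotation_matrix R" "0 < a'" "rotation_matrix R'"
  shows "frep ((b + a * b', a * a'), R ** R') \<phi> = frep ((b, a), R) (frep ((b', a'), R') \<phi>)"
proof
  fix \<xi>
  have "norm (transpose R *v \<xi>) = norm \<xi>" by (rule norm_orthogonal[OF rotation_orthogonal(2)[OF assms(2)]])
  then have n: "(transpose R *v \<xi>) \<bullet> (transpose R *v \<xi>) = \<xi> \<bullet> \<xi>" by (simp add: norm_eq_sqrt_inner)
  have n2: "(sqrt a *\<^sub>R (transpose R *v \<xi>)) \<bullet> (sqrt a *\<^sub>R (transpose R *v \<xi>)) = a * (\<xi> \<bullet> \<xi>)"
    using assms(1) by (simp add: n mult.assoc[symmetric])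
  have arg: "sqrt a' *\<^sub>R (transpose R' *v (sqrt a *\<^sub>R (transpose R *v \<xi>))) = sqrt (a * a') *\<^sub>R (transpose (R ** R') *v \<xi>)"
    by (simp add: real_sqrt_mult matrix_transpose_mul matrix_vector_mul_assoc[symmetric] matrix_vector_mult_scaleR mult.commute)
  have c: "cis (- 2 * pi * (b + a * b') * (\<xi> \<bullet> \<xi>)) = cis (- 2 * pi * b * (\<xi> \<bullet> \<xi>)) * cis (- 2 * pi * b' * (a * (\<xi> \<bullet> \<xi>)))"
    unfolding cis_mult by (simp add: algebra_simps)
  have p: "sqrt (a * a') powr (real CARD('a) / 2) = sqrt a powr (real CARD('a) / 2) * sqrt a' powr (real CARD('a) / 2)"
    using assms(1,3) by (simp add: real_sqrt_mult powr_mult)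
  show "frep ((b + a * b', a * a'), R ** R') \<phi> \<xi> = frep ((b, a), R) (frep ((b', a'), R') \<phi>) \<xi>"
    unfolding frep_def sim_def prod.case n2 arg c p by (simp only: of_real_mult mult_ac)
qed

subsection \<open>Strong continuity and unitarity\<close>

lemma continuous_on_transpose_mult:
  assumes "continuous_on S f" "continuous_on S g"
  shows "continuous_on S (\<lambda>x. transpose (f x :: real ^ 'n ^ 'n::finite) *v g x)"
  unfolding matrix_vector_mult_def transpose_def
  by (simp, intro continuous_intros assms)

lemma continuous_on_matrix_mult:
  assumes "continuous_on S f" "continuous_on S g"
  shows "continuous_on S (\<lambda>x. (f x :: real ^ 'n ^ 'n::finite) *v g x)"
  unfolding matrix_vector_mult_def
  by (intro continuous_intros assms)

lemma frep_tendsto_pointwise: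
  assumes \<psi>: "continuous_on UNIV \<psi>" and g: "g \<in> carrier schrodinger_group" and X: "X \<longlonglongrightarrow> g"
  shows "(\<lambda>k. frep (X k) \<psi> \<xi>) \<longlonglongrightarrow> frep g \<psi> \<xi>"
proof -
  obtain b a R where gg: "g = ((b, a), R)" "0 < a" using g by (cases g) (auto simp: carrier_schrodinger_group)
  have f: "frep h \<psi> \<xi> = cis (- 2 * pi * fst (fst h) * (\<xi> \<bullet> \<xi>)) * 
     (complex_of_real (sqrt (snd (fst h)) powr (real CARD('a) / 2)) * \<psi> (sqrt (snd (fst h)) *\<^sub>R (transpose (snd h) *v \<xi>)))" for h
    by (cases h) (auto simp: frep_def sim_def)
  have c: "continuous_on UNIV (\<lambda>R. transpose (R :: real ^ 'a ^ 'a) *v \<xi>)"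
    by (intro continuous_on_transpose_mult continuous_intros)
  have R: "(\<lambda>k. transpose (snd (X k)) *v \<xi>) \<longlonglongrightarrow> transpose (snd g) *v \<xi>"
    by (rule continuous_on_tendsto_compose[OF c tendsto_snd[OF X]]) auto
  have a: "(\<lambda>k. sqrt (snd (fst (X k)))) \<longlonglongrightarrow> sqrt (snd (fst g))" by (intro tendsto_intros X)
  have b: "(\<lambda>k. cis (- 2 * pi * fst (fst (X k)) * (\<xi> \<bullet> \<xi>))) \<longlonglongrightarrow> cis (- 2 * pi * fst (fst g) * (\<xi> \<bullet> \<xi>))"
  proof (rule continuous_on_tendsto_compose[of UNIV cis])
    show "(\<lambda>k. - 2 * pi * fst (fst (X k)) * (\<xi> \<bullet> \<xi>)) \<longlonglongrightarrow> - 2 * pi * fst (fst g) * (\<xi> \<bullet> \<xi>)" by (intro tendsto_intros X)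
  qed (auto intro: continuous_intros)
  have p: "(\<lambda>k. \<psi> (sqrt (snd (fst (X k))) *\<^sub>R (transpose (snd (X k)) *v \<xi>))) \<longlonglongrightarrow> \<psi> (sqrt (snd (fst g)) *\<^sub>R (transpose (snd g) *v \<xi>))"
    by (rule continuous_on_tendsto_compose[OF \<psi> tendsto_scaleR[OF a R]]) auto
  show ?thesis unfolding f
    by (intro tendsto_mult b p tendsto_of_real tendsto_powr a tendsto_const) (use gg in auto)
qed

text \<open>
  For a continuous function the orbit map is pointwise continuous, and the norm is constant along the
  orbit, so \<open>sq_int_scheffe\<close> applies. Density of the continuous functions gives the general case.
\<close>

lemma frep_tendsto:
  assumes \<phi>: "\<phi> \<in> sq_int lborel" and g: "g \<in> carrier schrodinger_group"
    and X: "\<And>k. X k \<in> carrier schrodinger_group" "X \<longlonglongrightarrow> g"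
  shows "(\<lambda>k. nrm lborel (\<lambda>x. frep (X k) \<phi> x - frep g \<phi> x)) \<longlonglongrightarrow> 0"
proof (rule LIMSEQ_I)
  fix e :: real assume "0 < e"
  obtain \<psi> where \<psi>: "continuous_on UNIV \<psi>" "\<psi> \<in> sq_int lborel" "nrm lborel (\<lambda>x. \<phi> x - \<psi> x) < e/3"
    using continuous_dense_lborel[OF \<phi>, of "e/3"] \<open>0 < e\<close> by auto
  have "(\<lambda>k. nrm lborel (\<lambda>x. frep (X k) \<psi> x - frep g \<psi> x)) \<longlonglongrightarrow> 0"
    by (rule sq_int_scheffe)
      (auto simp: frep_sq_int[OF X(1) \<psi>(2)] frep_sq_int[OF g \<psi>(2)] intro!: AE_I2 frep_tendsto_pointwise[OF \<psi>(1) g X(2)])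
  then obtain N where N: "\<And>k. k \<ge> N \<Longrightarrow> nrm lborel (\<lambda>x. frep (X k) \<psi> x - frep g \<psi> x) < e/3"
    using LIMSEQ_D[of _ 0 "e/3"] \<open>0 < e\<close> by fastforce
  have "nrm lborel (\<lambda>x. frep (X k) \<phi> x - frep g \<phi> x) < e" if "k \<ge> N" for k
  proof -
    have *: "nrm lborel (\<lambda>x. frep h \<phi> x - frep h \<psi> x) < e/3" if "h \<in> carrier schrodinger_group" for h
      using frep_sq_int(2)[OF that sq_int_diff[OF \<phi> \<psi>(2)]] \<psi>(3) by (simp add: frep_diff)
    show ?thesis
      using nrm_triangle_diff[OF frep_sq_int(1)[OF X(1)[of k] \<phi>] frep_sq_int(1)[OF X(1)[of k] \<psi>(2)] frep_sq_int(1)[OF g \<phi>]]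
        nrm_triangle_diff[OF frep_sq_int(1)[OF X(1)[of k] \<psi>(2)] frep_sq_int(1)[OF g \<psi>(2)] frep_sq_int(1)[OF g \<phi>]]
        *[OF X(1)[of k]] *[OF g] N[OF that] nrm_minus_commute[of lborel "frep g \<phi>" "frep g \<psi>"]
      by linarith
  qed
  then show "\<exists>no. \<forall>k\<ge>no. norm (nrm lborel (\<lambda>x. frep (X k) \<phi> x - frep g \<phi> x) - 0) < e" by auto
qed

theorem unitary_schrodinger_rep:
  "unitary_rep_L2 (schrodinger_group :: 'n::finite aff_rot monoid) schrodinger_rep"
proof -
  let ?G = "schrodinger_group :: 'n aff_rot monoid"
  have F: "is_fourier_L2 (schrodinger_rep g f) (frep g \<phi>)" if "g \<in> carrier ?G" "is_fourier_L2 f \<phi>" for g f \<phi>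
    using that by (cases g) (auto simp: carrier_schrodinger_group intro: is_fourier_L2_schrodinger_rep)
  note ex = is_fourier_L2_fourier_L2
  note E = is_fourier_L2_AE_iff
  show ?thesis
    unfolding unitary_rep_L2_def L2_eq_sq_int L2_inner_eq_ip
  proof (intro conjI ballI allI)
    show "group ?G" by (rule group_schrodinger_group)
    fix g assume g: "g \<in> carrier ?G"
    fix f :: "real ^ 'n \<Rightarrow> complex" assume f: "f \<in> sq_int lborel"
    show "schrodinger_rep g f \<in> sq_int lborel"
      by (rule is_fourier_L2_sq_int(1)[OF F[OF g ex[OF f]]])
    fix h :: "real ^ 'n \<Rightarrow> complex" assume h: "h \<in> sq_int lborel"
    note l = is_fourier_L2_lincomb
    show "AE x in lborel. schrodinger_rep g (\<lambda>y. c * f y + h y) x = c * schrodinger_rep g f x + schrodinger_rep g h x" for c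
      using E[OF F[OF g l[OF ex[OF f] ex[OF h]]] l[OF F[OF g ex[OF f]] F[OF g ex[OF h]]], of c c]
      by (simp add: frep_lincomb)
    have "ip lborel (frep g (fourier_L2 f)) (frep g (fourier_L2 h)) = ip lborel (fourier_L2 f) (fourier_L2 h)"
      using frep_sq_int(2)[OF g sq_int_add[OF sq_int_cmult is_fourier_L2_sq_int(2)[OF ex[OF h]]]] ex f h
      by (intro ip_eq_of_nrm_eq) (auto simp: frep_lincomb intro!: frep_sq_int(1)[OF g] is_fourier_L2_sq_int(2)[OF ex])
    then show "ip lborel (schrodinger_rep g f) (schrodinger_rep g h) = ip lborel f h"
      using is_fourier_L2_ip[OF F[OF g ex[OF f]] F[OF g ex[OF h]]] is_fourier_L2_ip[OF ex[OF f] ex[OF h]] by simp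
  next
    fix f :: "real ^ 'n \<Rightarrow> complex" assume f: "f \<in> sq_int lborel"
    have "one ?G \<in> carrier ?G" by (rule monoid.one_closed[OF group.is_monoid[OF group_schrodinger_group]])
    from E[OF F[OF this ex[OF f]] ex[OF f]]
    show "AE x in lborel. schrodinger_rep (one ?G) f x = f x" by (simp add: one_schrodinger_group frep_one)
  next
    fix g h assume g: "g \<in> carrier ?G" and h: "h \<in> carrier ?G"
    fix f :: "real ^ 'n \<Rightarrow> complex" assume f: "f \<in> sq_int lborel"
    have gh: "mult ?G g h \<in> carrier ?G"
      by (rule monoid.m_closed[OF group.is_monoid[OF group_schrodinger_group] g h])
    have "frep (mult ?G g h) (fourier_L2 f) = frep g (frep h (fourier_L2 f))"
      using g h by (cases g; cases h) (auto simp: carrier_schrodinger_group mult_schrodinger_group frep_mult)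
    then show "AE x in lborel. schrodinger_rep (mult ?G g h) f x = schrodinger_rep g (schrodinger_rep h f) x"
      using E[OF F[OF gh ex[OF f]] F[OF g F[OF h ex[OF f]]]] by simp
  next
    fix f :: "real ^ 'n \<Rightarrow> complex" assume f: "f \<in> sq_int lborel"
    fix g assume g: "g \<in> carrier ?G"
    note \<phi> = is_fourier_L2_sq_int(2)[OF ex[OF f]]
    show "L2_tendsto (\<lambda>h. schrodinger_rep h f) (schrodinger_rep g f) (at g within carrier ?G)"
      unfolding L2_tendsto_def tendsto_at_iff_sequentially comp_def
    proof (intro allI impI)
      fix X assume X: "\<forall>i. X i \<in> carrier ?G - {g}" "X \<longlonglongrightarrow> g"
      have Xc: "X k \<in> carrier ?G" for k using X(1) by auto
      have eq: "nrm lborel (\<lambda>x. schrodinger_rep (X k) f x - schrodinger_rep g f x) =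
          nrm lborel (\<lambda>x. frep (X k) (fourier_L2 f) x - frep g (fourier_L2 f) x)" for k
        using is_fourier_L2_nrm[OF is_fourier_L2_lincomb[OF F[OF g ex[OF f]] F[OF Xc[of k] ex[OF f]], of "-1"]]
        by simp
      have "(\<lambda>x. schrodinger_rep (X k) f x - schrodinger_rep g f x) \<in> sq_int lborel" for k
        by (intro sq_int_diff is_fourier_L2_sq_int(1)[OF F[OF Xc ex[OF f]]] is_fourier_L2_sq_int(1)[OF F[OF g ex[OF f]]])
      then show "(\<lambda>k. \<integral>\<^sup>+x. ennreal ((cmod (schrodinger_rep (X k) f x - schrodinger_rep g f x))\<^sup>2) \<partial>lborel) \<longlonglongrightarrow> 0"
        by (subst nn_integral_tendsto_iff_nrm) (auto simp: eq intro!: frep_tendsto[OF \<phi> g Xc X(2)])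
    qed
  qed
qed

section \<open>Haar measure on the rotation group and polar coordinates\<close>

lemma continuous_on_matmul:
  "continuous_on S f \<Longrightarrow> continuous_on S g \<Longrightarrow> continuous_on S (\<lambda>x. (f x :: real ^ 'n ^ 'n::finite) ** g x)"
  unfolding matrix_matrix_mult_def by (intro continuous_intros)

lemma borel_measurable_matmul [measurable]:
  assumes [measurable]: "f \<in> borel_measurable M" "g \<in> borel_measurable M"
  shows "(\<lambda>x. (f x :: real ^ 'n ^ 'n::finite) ** g x) \<in> borel_measurable M"
  by (rule borel_measurable_continuous_Pair) (auto intro!: continuous_on_matmul continuous_intros)

lemma borel_measurable_matvec [measurable]:
  assumes [measurable]: "f \<in> borel_measurable M" "g \<in> borel_measurable M"
  shows "(\<lambda>x. (f x :: real ^ 'n ^ 'n::finite) *v g x) \<in> borel_measurable M"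
  by (rule borel_measurable_continuous_Pair) (auto intro!: continuous_on_matrix_mult continuous_intros)

lemma borel_measurable_transpose [measurable]:
  assumes [measurable]: "f \<in> borel_measurable M"
  shows "(\<lambda>x. transpose (f x :: real ^ 'n ^ 'n::finite)) \<in> borel_measurable M"
proof -
  have "continuous_on UNIV (transpose :: real ^ 'n ^ 'n \<Rightarrow> _)"
    unfolding transpose_def by (intro continuous_intros)
  then have [measurable]: "(transpose :: real ^ 'n ^ 'n \<Rightarrow> _) \<in> borel_measurable borel"
    by (rule borel_measurable_continuous_onI)
  show ?thesis by measurable
qed

lemma rotation_matrix_transpose:
  fixes R :: "real ^ 'n ^ 'n::finite"
  shows "rotation_matrix R \<Longrightarrow> rotation_matrix (transpose R)"
  by (auto simp: rotation_matrix_def)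

lemma rotation_matrix_mult:
  fixes R S :: "real ^ 'n ^ 'n::finite"
  shows "rotation_matrix R \<Longrightarrow> rotation_matrix S \<Longrightarrow> rotation_matrix (R ** S)"
  by (auto simp: rotation_matrix_def orthogonal_matrix_mul det_mul)

lemma norm_rotation:
  fixes R :: "real ^ 'n ^ 'n::finite"
  assumes "rotation_matrix R" shows "norm (R *v x) = norm x"
  by (rule norm_orthogonal[OF rotation_orthogonal(1)[OF assms]])

lemma rotation_matrix_transitive:
  fixes a b :: "real ^ 'n::finite"
  assumes "2 \<le> CARD('n)" "norm a = 1" "norm b = 1"
  shows "\<exists>R. rotation_matrix R \<and> R *v a = b"
proof -
  obtain k :: 'n where True by simp
  obtain A B where A: "rotation_matrix A" "A *v axis k 1 = a" and B: "rotation_matrix B" "B *v axis k 1 = b"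
    using rotation_matrix_exists_basis assms by metis
  have "(B ** transpose A) *v a = b"
    unfolding A(2)[symmetric] matrix_vector_mul_assoc[symmetric] rotation_transpose_cancel(1)[OF A(1)] B(2) ..
  then show ?thesis using rotation_matrix_mult[OF B(1) rotation_matrix_transpose[OF A(1)]] by blast
qed

text \<open>
  The Haar measure is regarded as a Borel measure on the space of all matrices that is concentrated
  on the rotation group; its integrands can then be Borel functions of a matrix. The unit vector \<open>e\<close> is the pole of
  the sphere.
\<close>

locale rotation_haar =
  fixes \<nu> :: "(real ^ 'n ^ 'n::finite) measure" and e :: "real ^ 'n"
  assumes sets_nu [measurable_cong, simp]: "sets \<nu> = sets borel"
    and prob_nu: "prob_space \<nu>"
    and AE_rotation: "AE R in \<nu>. rotation_matrix R"
    and left_invariant: "\<And>S. rotation_matrix S \<Longrightarrow> distr \<nu> borel (\<lambda>R. S ** R) = \<nu>"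
    and card_ge_2: "2 \<le> CARD('n)"
    and norm_e: "norm e = 1"
begin

sublocale nu: prob_space \<nu> by (rule prob_nu)

lemma space_nu [simp]: "space \<nu> = UNIV"
  using sets_eq_imp_space_eq[OF sets_nu] by simp

lemma nn_integral_left:
  assumes "rotation_matrix S" and [measurable]: "\<phi> \<in> borel_measurable borel"
  shows "(\<integral>\<^sup>+R. \<phi> (S ** R) \<partial>\<nu>) = (\<integral>\<^sup>+R. \<phi> R \<partial>\<nu>)"
  by (subst (2) left_invariant[OF assms(1), symmetric], subst nn_integral_distr) auto

text \<open>
  The convolution of \<open>\<nu>\<close> with its image under inversion can be evaluated from both sides, using left invariance
  once in each factor; the two values are the two sides of the identity.
\<close>

lemma nn_integral_transpose:
  assumes [measurable]: "\<phi> \<in> borel_measurable borel"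
  shows "(\<integral>\<^sup>+R. \<phi> (transpose R) \<partial>\<nu>) = (\<integral>\<^sup>+R. \<phi> R \<partial>\<nu>)"
proof -
  interpret pair_sigma_finite \<nu> \<nu> ..
  have "(\<integral>\<^sup>+R. \<phi> (transpose R) \<partial>\<nu>) = (\<integral>\<^sup>+S. (\<integral>\<^sup>+R. \<phi> (transpose R) \<partial>\<nu>) \<partial>\<nu>)"
    by (simp add: nu.emeasure_space_1[simplified])
  also have "\<dots> = (\<integral>\<^sup>+S. (\<integral>\<^sup>+R. \<phi> (transpose R ** S) \<partial>\<nu>) \<partial>\<nu>)"
  proof (rule nn_integral_cong_AE, use AE_rotation in eventually_elim)
    case (elim S)
    have "(\<integral>\<^sup>+R. \<phi> (transpose (transpose S ** R)) \<partial>\<nu>) = (\<integral>\<^sup>+R. \<phi> (transpose R) \<partial>\<nu>)"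
      by (rule nn_integral_left[OF rotation_matrix_transpose[OF elim]]) measurable
    then show ?case by (simp add: matrix_transpose_mul)
  qed
  also have "\<dots> = (\<integral>\<^sup>+R. (\<integral>\<^sup>+S. \<phi> (transpose R ** S) \<partial>\<nu>) \<partial>\<nu>)"
    by (rule Fubini') measurable
  also have "\<dots> = (\<integral>\<^sup>+R. (\<integral>\<^sup>+S. \<phi> S \<partial>\<nu>) \<partial>\<nu>)"
  proof (rule nn_integral_cong_AE, use AE_rotation in eventually_elim)
    case (elim R)
    show ?case by (rule nn_integral_left[OF rotation_matrix_transpose[OF elim]]) measurable
  qed
  also have "\<dots> = (\<integral>\<^sup>+R. \<phi> R \<partial>\<nu>)" by (simp add: nu.emeasure_space_1[simplified])
  finally show ?thesis .
qed

lemma nn_integral_right: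
  assumes Q: "rotation_matrix Q" and [measurable]: "\<phi> \<in> borel_measurable borel"
  shows "(\<integral>\<^sup>+R. \<phi> (R ** Q) \<partial>\<nu>) = (\<integral>\<^sup>+R. \<phi> R \<partial>\<nu>)"
proof -
  have "(\<integral>\<^sup>+R. \<phi> (R ** Q) \<partial>\<nu>) = (\<integral>\<^sup>+R. \<phi> (transpose R ** Q) \<partial>\<nu>)"
    by (rule nn_integral_transpose[symmetric]) measurable
  also have "\<dots> = (\<integral>\<^sup>+R. \<phi> (transpose (transpose Q ** R)) \<partial>\<nu>)" by (simp add: matrix_transpose_mul)
  also have "\<dots> = (\<integral>\<^sup>+R. \<phi> (transpose R) \<partial>\<nu>)"
    by (rule nn_integral_left[OF rotation_matrix_transpose[OF Q]]) measurable
  also have "\<dots> = (\<integral>\<^sup>+R. \<phi> R \<partial>\<nu>)" by (rule nn_integral_transpose) simp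
  finally show ?thesis .
qed

text \<open>
  The normalized surface measure of the unit sphere, obtained as the distribution of the image of the pole under a random
  rotation.
\<close>

definition sphere_measure :: "(real ^ 'n) measure" where
  "sphere_measure = distr \<nu> borel (\<lambda>R. R *v e)"

lemma sets_sphere_measure [measurable_cong, simp]: "sets sphere_measure = sets borel"
  by (simp add: sphere_measure_def)

lemma space_sphere_measure [simp]: "space sphere_measure = UNIV"
  by (simp add: sphere_measure_def)

sublocale sph: prob_space sphere_measure
  unfolding sphere_measure_def by (rule nu.prob_space_distr) measurable

lemma nn_integral_sphere:
  assumes [measurable]: "\<phi> \<in> borel_measurable borel"
  shows "(\<integral>\<^sup>+\<omega>. \<phi> \<omega> \<partial>sphere_measure) = (\<integral>\<^sup>+R. \<phi> (R *v e) \<partial>\<nu>)"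
  unfolding sphere_measure_def by (subst nn_integral_distr) auto

lemma AE_sphere: "AE \<omega> in sphere_measure. norm \<omega> = 1"
  unfolding sphere_measure_def
proof (subst AE_distr_iff)
  show "AE R in \<nu>. norm (R *v e) = 1" using AE_rotation by eventually_elim (simp add: norm_rotation norm_e)
qed measurable

text \<open>
  Any unit vector can serve as the pole: it is \<open>Q *v e\<close> for a rotation \<open>Q\<close>, and the Haar measure is invariant under right
  multiplication by \<open>Q\<close>.
\<close>

lemma nn_integral_orbit:
  assumes [measurable]: "\<phi> \<in> borel_measurable borel" and "norm u = 1"
  shows "(\<integral>\<^sup>+R. \<phi> (R *v u) \<partial>\<nu>) = (\<integral>\<^sup>+\<omega>. \<phi> \<omega> \<partial>sphere_measure)"
proof -
  obtain Q where Q: "rotation_matrix Q" "Q *v e = u"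
    using rotation_matrix_transitive[OF card_ge_2 norm_e assms(2)] by blast
  have "(\<integral>\<^sup>+R. \<phi> (R *v u) \<partial>\<nu>) = (\<integral>\<^sup>+R. \<phi> ((R ** Q) *v e) \<partial>\<nu>)" by (simp add: matrix_vector_mul_assoc[symmetric] Q(2))
  also have "\<dots> = (\<integral>\<^sup>+R. \<phi> (R *v e) \<partial>\<nu>)" by (rule nn_integral_right[OF Q(1)]) measurable
  finally show ?thesis by (simp add: nn_integral_sphere)
qed

lemma sphere_measure_invariant:
  assumes S: "rotation_matrix S" shows "distr sphere_measure borel (\<lambda>x. S *v x) = sphere_measure"
proof (rule measure_eqI)
  fix A assume "A \<in> sets (distr sphere_measure borel (\<lambda>x. S *v x))"
  then have [measurable]: "A \<in> sets borel" by simp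
  have "emeasure (distr sphere_measure borel (\<lambda>x. S *v x)) A = (\<integral>\<^sup>+x. indicator A x \<partial>distr sphere_measure borel (\<lambda>x. S *v x))" by simp
  also have "\<dots> = (\<integral>\<^sup>+x. indicator A (S *v x) \<partial>sphere_measure)" by (rule nn_integral_distr) auto
  also have "\<dots> = (\<integral>\<^sup>+R. indicator A (S *v (R *v e)) \<partial>\<nu>)" by (rule nn_integral_sphere) measurable
  also have "\<dots> = (\<integral>\<^sup>+R. indicator A ((S ** R) *v e) \<partial>\<nu>)" by (simp add: matrix_vector_mul_assoc)
  also have "\<dots> = (\<integral>\<^sup>+R. indicator A (R *v e) \<partial>\<nu>)" by (rule nn_integral_left[OF S]) measurable
  also have "\<dots> = (\<integral>\<^sup>+x. indicator A x \<partial>sphere_measure)" by (rule nn_integral_sphere[symmetric]) measurable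
  finally show "emeasure (distr sphere_measure borel (\<lambda>x. S *v x)) A = emeasure sphere_measure A" by simp
qed simp

lemma integral_sphere_rotate:
  fixes f :: "real ^ 'n \<Rightarrow> 'c::{banach, second_countable_topology}"
  assumes S: "rotation_matrix S" and [measurable]: "f \<in> borel_measurable borel"
  shows "(LINT x|sphere_measure. f (S *v x)) = (LINT x|sphere_measure. f x)"
  by (subst (2) sphere_measure_invariant[OF S, symmetric], subst integral_distr) auto

text \<open>
  If a ball with centre on the sphere were null, all balls of the same radius with centre on the sphere would be null
  by invariance, and finitely many of them cover the sphere. The lemma turns equality almost everywhere of polynomials
  into equality on the sphere.
\<close>

lemma sphere_full_support:
  fixes f :: "real ^ 'n \<Rightarrow> real"
  assumes f: "continuous_on UNIV f" "AE \<omega> in sphere_measure. f \<omega> = 0" and "norm \<omega> = 1"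
  shows "f \<omega> = 0"
proof (rule ccontr)
  assume "f \<omega> \<noteq> 0"
  have "open {x. f x \<noteq> 0}" using f(1) by (intro open_Collect_neq) auto
  then obtain d where d: "0 < d" "ball \<omega> d \<subseteq> {x. f x \<noteq> 0}"
    using \<open>f \<omega> \<noteq> 0\<close> open_contains_ball by blast
  have "AE x in sphere_measure. x \<notin> ball \<omega> d" using f(2) by eventually_elim (use d(2) in auto)
  then have z: "emeasure sphere_measure (ball \<omega> d) = 0" by (subst (asm) AE_iff_measurable[of "ball \<omega> d"]) auto
  have zu: "emeasure sphere_measure (ball u d) = 0" if u: "norm u = 1" for u
  proof -
    obtain S where S: "rotation_matrix S" "S *v \<omega> = u"
      using rotation_matrix_transitive[OF card_ge_2 assms(3) u] by blast
    have "(\<lambda>x. S *v x) -` ball u d = ball \<omega> d"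
      using norm_rotation[OF S(1)] unfolding S(2)[symmetric]
      by (auto simp: dist_norm matrix_vector_mult_diff_distrib[symmetric])
    moreover have "emeasure sphere_measure (ball u d) = emeasure (distr sphere_measure borel (\<lambda>x. S *v x)) (ball u d)"
      by (simp add: sphere_measure_invariant[OF S(1)])
    ultimately show ?thesis using z by (simp add: emeasure_distr)
  qed
  have "compact (sphere (0::real^'n) 1)" by simp
  moreover have "sphere (0::real^'n) 1 \<subseteq> (\<Union>u\<in>sphere 0 1. ball u d)" using d(1) by auto
  ultimately obtain D where D: "D \<subseteq> sphere (0::real^'n) 1" "finite D" "sphere 0 1 \<subseteq> (\<Union>u\<in>D. ball u d)"
    using compactE_image[of "sphere (0::real^'n) 1" "sphere (0::real^'n) 1" "\<lambda>u. ball u d"] open_ball by metis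
  have "AE x in sphere_measure. x \<notin> ball u d" if "u \<in> D" for u
    using zu[of u] D(1) that by (subst AE_iff_measurable[of "ball u d"]) auto
  then have "AE x in sphere_measure. \<forall>u\<in>D. x \<notin> ball u d" using D(2) by (simp add: AE_finite_all)
  with AE_sphere have "AE x in sphere_measure. False"
    by eventually_elim (use D(3) in auto)
  then show False by simp
qed

end

subsection \<open>Polar coordinates in terms of the squared radius\<close>

text \<open>
  The density, under Lebesgue measure in \<open>n\<close> dimensions, of the squared norm: the derivative of
  \<open>unit_ball_vol n * t powr (n / 2)\<close>, the volume of the ball of radius \<open>sqrt t\<close>.
\<close>

definition radial_density :: "nat \<Rightarrow> real \<Rightarrow> real" where
  "radial_density n t = (if 0 < t then real n / 2 * unit_ball_vol (real n) * t powr (real n / 2 - 1) else 0)"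

lemma radial_density_nonneg: "0 \<le> radial_density n t"
  by (simp add: radial_density_def)

lemma radial_density_measurable [measurable]: "radial_density n \<in> borel_measurable borel"
  unfolding radial_density_def[abs_def] by measurable

lemma nn_integral_radial_density:
  assumes "0 \<le> t"
  shows "(\<integral>\<^sup>+s. ennreal (radial_density CARD('n::finite) s) * indicator {..t} s \<partial>lborel) = ennreal (unit_ball_vol (real CARD('n)) * t powr (real CARD('n) / 2))"
proof -
  let ?n = "real CARD('n)" and ?V = "unit_ball_vol (real CARD('n))"
  have "((\<lambda>s. ?n / 2 * ?V * s powr (?n / 2 - 1)) has_integral (?V * t powr (?n / 2) - ?V * 0 powr (?n / 2))) {0..t}"
  (* In low dimensions the power is not differentiable at 0, hence interior derivatives. *)
  proof (rule fundamental_theorem_of_calculus_interior[OF assms])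
    show "continuous_on {0..t} (\<lambda>s. ?V * s powr (?n / 2))"
      by (intro continuous_intros continuous_on_powr') auto
    fix s assume "s \<in> {0<..<t}"
    then show "((\<lambda>s. ?V * s powr (?n / 2)) has_vector_derivative ?n / 2 * ?V * s powr (?n / 2 - 1)) (at s)"
      by (auto intro!: derivative_eq_intros simp: has_real_derivative_iff_has_vector_derivative[symmetric])
  qed
  then have "(\<integral>\<^sup>+s. ennreal (indicator {0..t} s * (?n / 2 * ?V * s powr (?n / 2 - 1))) \<partial>lborel) = ennreal (?V * t powr (?n / 2))"
    using nn_integral_has_integral_lebesgue[of "{0..t}" "\<lambda>s. ?n / 2 * ?V * s powr (?n / 2 - 1)"] by simp
  moreover have "(\<integral>\<^sup>+s. ennreal (radial_density CARD('n::finite) s) * indicator {..t} s \<partial>lborel) = (\<integral>\<^sup>+s. ennreal (indicator {0..t} s * (?n / 2 * ?V * s powr (?n / 2 - 1))) \<partial>lborel)"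
    by (intro nn_integral_cong) (auto simp: radial_density_def indicator_def)
  ultimately show ?thesis by simp
qed

lemma distr_norm_sq:
  "distr lborel borel (\<lambda>x::real ^ 'n::finite. (norm x)\<^sup>2) = density lborel (\<lambda>t. ennreal (radial_density CARD('n) t))"
proof (rule measure_eqI_generator_eq[where E="range (\<lambda>a::real. {..a})" and \<Omega>=UNIV and A="\<lambda>k. {..real k}"])
  let ?V = "unit_ball_vol (real CARD('n))"
  have eq: "emeasure (distr lborel borel (\<lambda>x::real ^ 'n. (norm x)\<^sup>2)) {..t} = (if 0 \<le> t then ennreal (?V * t powr (real CARD('n) / 2)) else 0)"
    (is "?L t = ?R t") for t
  proof -
    have L: "?L t = emeasure lborel {x::real ^ 'n. (norm x)\<^sup>2 \<le> t}"
      by (subst emeasure_distr) (auto simp: vimage_def)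
    show ?thesis
    proof (cases "0 \<le> t")
      case True
      have "{x::real ^ 'n. (norm x)\<^sup>2 \<le> t} = cball 0 (sqrt t)"
        using real_le_rsqrt sqrt_le_D by (auto simp: real_le_lsqrt True) (metis True norm_ge_zero real_sqrt_le_iff real_sqrt_pow2 power_mono)
      moreover have "sqrt t ^ CARD('n) = t powr (real CARD('n) / 2)"
        using True by (cases "t = 0") (auto simp: powr_half_sqrt[symmetric] powr_powr powr_realpow[symmetric])
      ultimately show ?thesis using True L by (simp add: emeasure_cball)
    next
      case False
      then have "{x::real ^ 'n. (norm x)\<^sup>2 \<le> t} = {}" by (auto simp: not_le intro: less_le_trans)
      then show ?thesis using False L by simp
    qed
  qed
  have eq2: "emeasure (density lborel (\<lambda>t. ennreal (radial_density CARD('n) t))) {..t} = (if 0 \<le> t then ennreal (?V * t powr (real CARD('n) / 2)) else 0)" for t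
  proof (cases "0 \<le> t")
    case True then show ?thesis by (simp add: emeasure_density nn_integral_radial_density)
  next
    case False
    then have "(\<integral>\<^sup>+s. ennreal (radial_density CARD('n) s) * indicator {..t} s \<partial>lborel) = (\<integral>\<^sup>+s. 0 \<partial>(lborel :: real measure))"
      by (intro nn_integral_cong) (auto simp: radial_density_def indicator_def)
    then show ?thesis using False by (simp add: emeasure_density)
  qed
  show "Int_stable (range (\<lambda>a::real. {..a}))"
  proof (rule Int_stableI, clarify)
    fix a b :: real
    show "{..a} \<inter> {..b} \<in> range atMost" by (intro range_eqI[of _ _ "min a b"]) auto
  qed
  show "emeasure (distr lborel borel (\<lambda>x::real ^ 'n. (norm x)\<^sup>2)) X = emeasure (density lborel (\<lambda>t. ennreal (radial_density CARD('n) t))) X"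
    if "X \<in> range (\<lambda>a::real. {..a})" for X using that eq eq2 by auto
  show "emeasure (distr lborel borel (\<lambda>x::real ^ 'n. (norm x)\<^sup>2)) {..real k} \<noteq> \<infinity>" for k unfolding eq by simp
  show "(\<Union>k. {..real k}) = UNIV" using real_arch_simple by auto
  have "sets (borel :: real measure) = sigma_sets UNIV (range (\<lambda>a::real. {..a}))"
    by (subst borel_eq_atMost) (simp add: sets_measure_of)
  then show "sets (distr lborel borel (\<lambda>x::real ^ 'n. (norm x)\<^sup>2)) = sigma_sets UNIV (range (\<lambda>a::real. {..a}))"
    "sets (density lborel (\<lambda>t. ennreal (radial_density CARD('n) t))) = sigma_sets UNIV (range (\<lambda>a::real. {..a}))"
    by simp_all
qed auto

context rotation_haar
begin

text \<open>
  Lebesgue measure is invariant under each rotation, hence under averaging over all of them, and the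
  average of \<open>\<Phi>\<close> over the orbit of \<open>x\<close> depends on \<open>norm x\<close> only.
\<close>

theorem nn_integral_polar:
  assumes [measurable]: "\<Phi> \<in> borel_measurable borel"
  shows "(\<integral>\<^sup>+x. \<Phi> x \<partial>lborel) = (\<integral>\<^sup>+t. ennreal (radial_density CARD('n) t) * (\<integral>\<^sup>+\<omega>. \<Phi> (sqrt t *\<^sub>R \<omega>) \<partial>sphere_measure) \<partial>lborel)"
proof -
  interpret pair_sigma_finite \<nu> "lborel :: (real ^ 'n) measure" ..
  define M where "M t = (\<integral>\<^sup>+\<omega>. \<Phi> (sqrt t *\<^sub>R \<omega>) \<partial>sphere_measure)" for t
  have [measurable]: "M \<in> borel_measurable borel" unfolding M_def by measurable
  have "(\<integral>\<^sup>+x. \<Phi> x \<partial>lborel) = (\<integral>\<^sup>+R. (\<integral>\<^sup>+x. \<Phi> x \<partial>lborel) \<partial>\<nu>)" by (simp add: nu.emeasure_space_1[simplified])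
  also have "\<dots> = (\<integral>\<^sup>+R. (\<integral>\<^sup>+x. \<Phi> (R *v x) \<partial>lborel) \<partial>\<nu>)"
    by (rule nn_integral_cong_AE, use AE_rotation in eventually_elim)
       (rule nn_integral_orthogonal[symmetric], auto simp: rotation_orthogonal)
  also have "\<dots> = (\<integral>\<^sup>+x. (\<integral>\<^sup>+R. \<Phi> (R *v x) \<partial>\<nu>) \<partial>lborel)" by (rule Fubini'[symmetric]) measurable
  also have "\<dots> = (\<integral>\<^sup>+(x::real ^ 'n). M ((norm x)\<^sup>2) \<partial>lborel)"
  proof (rule nn_integral_cong)
    fix x :: "real ^ 'n"
    (* The value at the origin only has to be a unit vector. *)
    define u where "u = (if x = 0 then e else x /\<^sub>R norm x)"
    have u: "norm u = 1" "x = norm x *\<^sub>R u" by (auto simp: u_def norm_e)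
    have "(\<integral>\<^sup>+R. \<Phi> (R *v x) \<partial>\<nu>) = (\<integral>\<^sup>+R. \<Phi> (norm x *\<^sub>R (R *v u)) \<partial>\<nu>)"
      by (subst u(2)) (simp add: matrix_vector_mult_scaleR)
    also have "\<dots> = M ((norm x)\<^sup>2)"
      unfolding M_def using nn_integral_orbit[of "\<lambda>y. \<Phi> (norm x *\<^sub>R y)" u] u(1) by simp
    finally show "(\<integral>\<^sup>+R. \<Phi> (R *v x) \<partial>\<nu>) = M ((norm x)\<^sup>2)" .
  qed
  also have "\<dots> = (\<integral>\<^sup>+t. M t \<partial>distr lborel borel (\<lambda>x::real ^ 'n. (norm x)\<^sup>2))" by (subst nn_integral_distr) auto
  also have "\<dots> = (\<integral>\<^sup>+t. ennreal (radial_density CARD('n) t) * M t \<partial>lborel)" unfolding distr_norm_sq by (subst nn_integral_density) auto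
  finally show ?thesis unfolding M_def .
qed

lemma lborel_polar:
  "lborel = distr (density (lborel \<Otimes>\<^sub>M sphere_measure) (\<lambda>x. ennreal (radial_density CARD('n) (fst x)))) borel (\<lambda>x. sqrt (fst x) *\<^sub>R snd x)"
proof (rule measure_eqI)
  fix A :: "(real ^ 'n) set" assume "A \<in> sets lborel"
  then have [measurable]: "A \<in> sets borel" by simp
  have "emeasure (distr (density (lborel \<Otimes>\<^sub>M sphere_measure) (\<lambda>x. ennreal (radial_density CARD('n) (fst x)))) borel (\<lambda>x. sqrt (fst x) *\<^sub>R snd x)) A
     = (\<integral>\<^sup>+x. indicator A x \<partial>distr (density (lborel \<Otimes>\<^sub>M sphere_measure) (\<lambda>x. ennreal (radial_density CARD('n) (fst x)))) borel (\<lambda>x. sqrt (fst x) *\<^sub>R snd x))" by simp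
  also have "\<dots> = (\<integral>\<^sup>+x. ennreal (radial_density CARD('n) (fst x)) * indicator A (sqrt (fst x) *\<^sub>R snd x) \<partial>(lborel \<Otimes>\<^sub>M sphere_measure))"
    by (subst nn_integral_distr, simp, simp, subst nn_integral_density) auto
  also have "\<dots> = (\<integral>\<^sup>+t. (\<integral>\<^sup>+\<omega>. ennreal (radial_density CARD('n) t) * indicator A (sqrt t *\<^sub>R \<omega>) \<partial>sphere_measure) \<partial>lborel)"
    by (subst sph.nn_integral_fst[symmetric]) auto
  also have "\<dots> = (\<integral>\<^sup>+x. indicator A x \<partial>lborel)"
    by (subst nn_integral_polar) (auto simp: nn_integral_cmult)
  finally show "emeasure lborel A = emeasure (distr (density (lborel \<Otimes>\<^sub>M sphere_measure) (\<lambda>x. ennreal (radial_density CARD('n) (fst x)))) borel (\<lambda>x. sqrt (fst x) *\<^sub>R snd x)) A"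
    by simp
qed simp

theorem integral_polar:
  fixes \<Phi> :: "real ^ 'n \<Rightarrow> complex"
  assumes \<Phi>: "integrable lborel \<Phi>"
  shows "integrable lborel (\<lambda>t. complex_of_real (radial_density CARD('n) t) * (LINT \<omega>|sphere_measure. \<Phi> (sqrt t *\<^sub>R \<omega>)))"
    and "(LINT x|lborel. \<Phi> x) = (LINT t|lborel. complex_of_real (radial_density CARD('n) t) * (LINT \<omega>|sphere_measure. \<Phi> (sqrt t *\<^sub>R \<omega>)))"
proof -
  interpret pair_sigma_finite "lborel :: real measure" sphere_measure ..
  have [measurable]: "\<Phi> \<in> borel_measurable borel" using borel_measurable_integrable[OF \<Phi>] by simp
  have "integrable (distr (density (lborel \<Otimes>\<^sub>M sphere_measure) (\<lambda>x. ennreal (radial_density CARD('n) (fst x)))) borel (\<lambda>x. sqrt (fst x) *\<^sub>R snd x)) \<Phi>"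
    using \<Phi> lborel_polar by simp
  then have "integrable (density (lborel \<Otimes>\<^sub>M sphere_measure) (\<lambda>x. ennreal (radial_density CARD('n) (fst x)))) (\<lambda>x. \<Phi> (sqrt (fst x) *\<^sub>R snd x))"
    by (subst (asm) integrable_distr_eq) auto
  then have "integrable (lborel \<Otimes>\<^sub>M sphere_measure) (\<lambda>x. radial_density CARD('n) (fst x) *\<^sub>R \<Phi> (sqrt (fst x) *\<^sub>R snd x))"
    by (subst (asm) integrable_density) (auto simp: radial_density_nonneg)
  then have i: "integrable (lborel \<Otimes>\<^sub>M sphere_measure) (\<lambda>(t, \<omega>). complex_of_real (radial_density CARD('n) t) * \<Phi> (sqrt t *\<^sub>R \<omega>))"
    by (simp add: case_prod_unfold scaleR_conv_of_real)
  have "(LINT x|lborel. \<Phi> x) = (LINT x|(distr (density (lborel \<Otimes>\<^sub>M sphere_measure) (\<lambda>x. ennreal (radial_density CARD('n) (fst x)))) borel (\<lambda>x. sqrt (fst x) *\<^sub>R snd x)). \<Phi> x)"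
    using lborel_polar by simp
  also have "\<dots> = (LINT x|density (lborel \<Otimes>\<^sub>M sphere_measure) (\<lambda>x. ennreal (radial_density CARD('n) (fst x))). \<Phi> (sqrt (fst x) *\<^sub>R snd x))"
    by (subst integral_distr) auto
  also have "\<dots> = (LINT x|(lborel \<Otimes>\<^sub>M sphere_measure). (radial_density CARD('n) (fst x)) *\<^sub>R \<Phi> (sqrt (fst x) *\<^sub>R snd x))"
    by (subst integral_density) (auto simp: radial_density_nonneg)
  also have "\<dots> = (LINT x|(lborel \<Otimes>\<^sub>M sphere_measure). (case x of (t, \<omega>) \<Rightarrow> complex_of_real (radial_density CARD('n) t) * \<Phi> (sqrt t *\<^sub>R \<omega>)))"
    by (simp add: case_prod_unfold scaleR_conv_of_real)
  also have "\<dots> = (LINT t|lborel. LINT \<omega>|sphere_measure. complex_of_real (radial_density CARD('n) t) * \<Phi> (sqrt t *\<^sub>R \<omega>))"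
    by (rule integral_fst[OF i, symmetric])
  finally show "(LINT x|lborel. \<Phi> x) = (LINT t|lborel. complex_of_real (radial_density CARD('n) t) * (LINT \<omega>|sphere_measure. \<Phi> (sqrt t *\<^sub>R \<omega>)))"
    by simp
  show "integrable lborel (\<lambda>t. complex_of_real (radial_density CARD('n) t) * (LINT \<omega>|sphere_measure. \<Phi> (sqrt t *\<^sub>R \<omega>)))"
    using integrable_fst[OF i] by simp
qed

end

section \<open>Polynomials on the sphere and zonal reproducing kernels\<close>

definition coord_index :: "nat \<Rightarrow> 'n::finite" where
  "coord_index = (SOME f. bij_betw f {..<CARD('n)} UNIV)"

lemma coord_index_surj: "\<exists>i<CARD('n). coord_index i = (j::'n::finite)"
proof -
  have "\<exists>f. bij_betw f {..<CARD('n)} (UNIV :: 'n set)"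
    using ex_bij_betw_nat_finite[of "UNIV :: 'n set"] by (auto simp: lessThan_atLeast0)
  then have "bij_betw coord_index {..<CARD('n)} (UNIV :: 'n set)"
    unfolding coord_index_def by (rule someI_ex)
  then show ?thesis unfolding bij_betw_def by (metis UNIV_I imageE lessThan_iff)
qed

text \<open>
  An enumeration of the monomials that never decreases the degree. An index \<open>i\<close> is read as a word over the \<open>d\<close> coordinates in
  bijective base \<open>d\<close>, and the monomial is the product of its letters; different words may give the
  same monomial. The words of length less than \<open>k\<close> are the first \<open>polydim d k\<close> ones.
\<close>

fun monomial_seq :: "nat \<Rightarrow> real ^ 'n::finite \<Rightarrow> real" where
  "monomial_seq 0 x = 1"
| "monomial_seq (Suc i) x = x $ coord_index (i mod CARD('n)) * monomial_seq (i div CARD('n)) x"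

primrec polydim :: "nat \<Rightarrow> nat \<Rightarrow> nat" where
  "polydim d 0 = 0"
| "polydim d (Suc k) = Suc (d * polydim d k)"

text \<open>
  The polynomials of degree less than \<open>k\<close>; in particular \<open>polys 0\<close> contains only the zero function.
\<close>

definition polys :: "nat \<Rightarrow> (real ^ 'n::finite \<Rightarrow> real) set" where
  "polys k = {f. \<exists>c. f = (\<lambda>x. \<Sum>i<polydim CARD('n) k. c i * monomial_seq i x)}"

lemma continuous_monomial_seq [continuous_intros]: "continuous_on S (monomial_seq i)"
proof (induction i rule: less_induct)
  case (less i)
  show ?case
  proof (cases i)
    case (Suc j)
    have "j div CARD('a) < i" using Suc by (simp add: le_imp_less_Suc)
    from less[OF this] show ?thesis unfolding Suc by (simp, intro continuous_intros)
  qed simp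
qed

lemma continuous_polys: "f \<in> polys k \<Longrightarrow> continuous_on S f"
  unfolding polys_def by (auto intro!: continuous_intros continuous_monomial_seq)

lemma polydim_mono:
  assumes "0 < d" "k \<le> l" shows "polydim d k \<le> polydim d l"
proof (rule lift_Suc_mono_le[OF _ assms(2)])
  fix n
  from assms(1) have "polydim d n \<le> d * polydim d n" by (cases d) auto
  then show "polydim d n \<le> polydim d (Suc n)" unfolding polydim.simps by (rule le_SucI)
qed

lemma polys_lincomb:
  assumes "f \<in> polys k" "g \<in> polys k" shows "(\<lambda>x. a * f x + g x) \<in> polys k"
proof -
  from assms obtain c c' where "f = (\<lambda>x. \<Sum>i<polydim CARD('a) k. c i * monomial_seq i x)" "g = (\<lambda>x. \<Sum>i<polydim CARD('a) k. c' i * monomial_seq i x)"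
    by (auto simp: polys_def)
  then have "(\<lambda>x. a * f x + g x) = (\<lambda>x. \<Sum>i<polydim CARD('a) k. (a * c i + c' i) * monomial_seq i x)"
    by (auto simp: sum_distrib_left sum.distrib[symmetric] algebra_simps)
  then show ?thesis unfolding polys_def by (intro CollectI exI[of _ "\<lambda>i. a * c i + c' i"])
qed

lemma polys_zero: "(\<lambda>x. 0) \<in> polys k"
  unfolding polys_def by (intro CollectI exI[of _ "\<lambda>i. 0"]) simp

lemma polys_cmult: "f \<in> polys k \<Longrightarrow> (\<lambda>x. a * f x) \<in> polys k"
  using polys_lincomb[OF _ polys_zero, of f k a] by simp

lemma polys_add: "f \<in> polys k \<Longrightarrow> g \<in> polys k \<Longrightarrow> (\<lambda>x. f x + g x) \<in> polys k"
  using polys_lincomb[of f k g 1] by simp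

lemma polys_diff: "f \<in> polys k \<Longrightarrow> g \<in> polys k \<Longrightarrow> (\<lambda>x. g x - f x) \<in> polys k"
  using polys_lincomb[of f k g "-1"] by simp

lemma polys_sum: "(\<And>i. i \<in> I \<Longrightarrow> f i \<in> polys k) \<Longrightarrow> (\<lambda>x. \<Sum>i\<in>I. f i x) \<in> polys k"
  by (induction I rule: infinite_finite_induct) (auto intro: polys_zero polys_add)

lemma monomial_seq_in_polys:
  assumes "i < polydim CARD('n) k" shows "(monomial_seq i :: real ^ 'n::finite \<Rightarrow> real) \<in> polys k"
  unfolding polys_def
  by (intro CollectI exI[of _ "\<lambda>j. if j = i then 1 else 0"]) (use assms in \<open>auto simp: fun_eq_iff if_distrib if_distribR cong: if_cong\<close>)

text \<open>
  Membership of \<open>T x * f (A x)\<close> is linear in \<open>f\<close>, so it can be checked on monomials. The multiplier \<open>T\<close> and the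
  substitution \<open>A\<close> together cover products, coordinate changes and the inclusion of one space in the next.
\<close>

lemma polys_inductI:
  fixes f :: "real ^ 'n::finite \<Rightarrow> real"
  assumes "f \<in> polys k" "\<And>i. i < polydim CARD('n) k \<Longrightarrow> (\<lambda>x. T x * monomial_seq i (A x)) \<in> polys l"
  shows "(\<lambda>x. T x * f (A x)) \<in> polys l"
proof -
  from assms(1) obtain c where "f = (\<lambda>x. \<Sum>i<polydim CARD('n) k. c i * monomial_seq i x)" by (auto simp: polys_def)
  then have "(\<lambda>x. T x * f (A x)) = (\<lambda>x. \<Sum>i<polydim CARD('n) k. c i * (T x * monomial_seq i (A x)))"
    by (simp add: sum_distrib_left mult_ac)
  then show ?thesis by (simp only:) (intro polys_sum polys_cmult assms(2), simp)
qed

lemma polys_mono: 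
  fixes f :: "real ^ 'n::finite \<Rightarrow> real"
  assumes "f \<in> polys k" "k \<le> l" shows "f \<in> polys l"
proof -
  have "(\<lambda>x. 1 * f x) \<in> polys l"
    using polydim_mono[of "CARD('n)", OF zero_less_card_finite assms(2)]
    by (intro polys_inductI[OF assms(1)]) (auto intro!: monomial_seq_in_polys)
  then show ?thesis by simp
qed

lemma polys_const: "(\<lambda>x. c) \<in> polys (Suc k)"
  using polys_cmult[OF monomial_seq_in_polys[of 0 "Suc k"], of c] by simp

lemma polys_coord:
  fixes f :: "real ^ 'n::finite \<Rightarrow> real"
  assumes "f \<in> polys k" shows "(\<lambda>x. x $ j * f x) \<in> polys (Suc k)"
proof (rule polys_inductI[OF assms])
  fix i assume i: "i < polydim CARD('n) k"
  obtain l where l: "l < CARD('n)" "coord_index l = j" using coord_index_surj by blast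
  have "CARD('n) * i + l < CARD('n) * polydim CARD('n) k"
  proof -
    have "CARD('n) * i + l < CARD('n) * Suc i" using l by simp
    also have "\<dots> \<le> CARD('n) * polydim CARD('n) k" using i by (intro mult_le_mono2) simp
    finally show ?thesis .
  qed
  then have "(monomial_seq (Suc (CARD('n) * i + l)) :: real ^ 'n \<Rightarrow> real) \<in> polys (Suc k)"
    by (intro monomial_seq_in_polys) simp
  moreover have "monomial_seq (Suc (CARD('n) * i + l)) = (\<lambda>x::real ^ 'n. x $ j * monomial_seq i x)"
    using l by (simp add: fun_eq_iff)
  ultimately show "(\<lambda>x. x $ j * monomial_seq i x) \<in> polys (Suc k)" by simp
qed

lemma polydim_cases:
  assumes "i < polydim d (Suc k)"
  obtains "i = 0" | j where "i = Suc j" "j div d < polydim d k"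
proof (cases i)
  case (Suc j)
  then have "j div d < polydim d k" using assms by (simp add: less_mult_imp_div_less mult.commute)
  with Suc that(2) show thesis by blast
qed (use that(1) in simp)

lemma polys_mult_monomial:
  fixes f :: "real ^ 'n::finite \<Rightarrow> real"
  assumes "f \<in> polys l" "i < polydim CARD('n) k" shows "(\<lambda>x. f x * monomial_seq i x) \<in> polys (k + l)"
  using assms(2)
proof (induction k arbitrary: i)
  case (Suc k)
  from Suc.prems show ?case
  proof (cases rule: polydim_cases)
    case 1 then show ?thesis using polys_mono[OF assms(1)] by simp
  next
    case (2 j)
    have "(\<lambda>x. x $ coord_index (j mod CARD('n)) * (f x * monomial_seq (j div CARD('n)) x)) \<in> polys (Suc (k + l))"
      by (rule polys_coord[OF Suc.IH[OF 2(2)]])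
    then show ?thesis by (simp add: 2(1) mult_ac)
  qed
qed simp

lemma polys_mult:
  assumes "f \<in> polys k" "g \<in> polys l" shows "(\<lambda>x. f x * g x) \<in> polys (k + l)"
proof -
  have "(\<lambda>x. f x * g x) \<in> polys (l + k)"
    by (rule polys_inductI[OF assms(2)]) (rule polys_mult_monomial[OF assms(1)])
  then show ?thesis by (simp only: add.commute)
qed

lemma polys_linear_map:
  fixes R :: "real ^ 'n ^ 'n::finite"
  assumes "f \<in> polys k" shows "(\<lambda>x. f (R *v x)) \<in> polys k"
proof -
  have "(\<lambda>x. monomial_seq i (R *v x)) \<in> polys k" if "i < polydim CARD('n) k" for i
    using that
  proof (induction k arbitrary: i)
    case (Suc k)
    from Suc.prems show ?case
    proof (cases rule: polydim_cases)
      case 1 then show ?thesis by (simp add: polys_const)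
    next
      case (2 j)
      let ?c = "coord_index (j mod CARD('n))"
      have "(\<lambda>x. \<Sum>l\<in>UNIV. R $ ?c $ l * (x $ l * monomial_seq (j div CARD('n)) (R *v x))) \<in> polys (Suc k)"
        by (intro polys_sum polys_cmult polys_coord Suc.IH 2(2))
      then show ?thesis by (simp add: 2(1) matrix_vector_mult_def sum_distrib_right mult_ac)
    qed
  qed simp
  then show ?thesis using polys_inductI[OF assms, of "\<lambda>x. 1" "\<lambda>x. R *v x" k] by simp
qed

lemma real_polynomial_function_polys:
  fixes f :: "real ^ 'n::finite \<Rightarrow> real"
  assumes "real_polynomial_function f" shows "\<exists>k. f \<in> polys k"
  using assms
proof induction
  case (linear f)
  then interpret bounded_linear f .
  have "f = (\<lambda>x. \<Sum>j\<in>UNIV. f (axis j 1) * (x $ j * 1))"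
  proof
    fix x :: "real ^ 'n"
    have "x = (\<Sum>j\<in>UNIV. x $ j *\<^sub>R axis j 1)"
      using basis_expansion[of x] by (simp add: scalar_mult_eq_scaleR)
    then have "f x = f (\<Sum>j\<in>UNIV. x $ j *\<^sub>R axis j 1)" by (rule arg_cong)
    also have "\<dots> = (\<Sum>j\<in>UNIV. f (axis j 1) * (x $ j * 1))" by (simp add: sum scaleR mult.commute)
    finally show "f x = (\<Sum>j\<in>UNIV. f (axis j 1) * (x $ j * 1))" .
  qed
  moreover have "(\<lambda>x::real^'n. \<Sum>j\<in>UNIV. f (axis j 1) * (x $ j * 1)) \<in> polys (Suc (Suc 0))"
    by (intro polys_sum polys_cmult polys_coord polys_const)
  ultimately show ?case by (intro exI[of _ "Suc (Suc 0)"]) simp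
next
  case (const c)
  then show ?case using polys_const by blast
next
  case (add f g)
  then obtain k l where "f \<in> polys k" "g \<in> polys l" by blast
  then show ?case by (intro exI[of _ "max k l"] polys_add) (auto elim: polys_mono)
next
  case (mult f g)
  then show ?case using polys_mult by blast
qed

subsection \<open>Orthonormalization\<close>

context rotation_haar
begin

lemma integrable_sphere_continuous:
  fixes f :: "real ^ 'n \<Rightarrow> real"
  assumes "continuous_on UNIV f" shows "integrable sphere_measure f"
proof -
  have "compact (f ` sphere 0 1)"
    by (intro compact_continuous_image continuous_on_subset[OF assms]) auto
  then have "bounded (f ` sphere 0 1)" by (rule compact_imp_bounded)
  then obtain B where "\<forall>y\<in>f ` sphere 0 1. norm y \<le> B" unfolding bounded_iff by blast
  then have B: "\<bar>f x\<bar> \<le> B" if "norm x = 1" for x using that by auto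
  show ?thesis
    by (rule sph.integrable_const_bound[where B=B])
       (use AE_sphere B borel_measurable_continuous_onI[OF assms] in \<open>auto elim!: eventually_mono\<close>)
qed

definition sip :: "(real ^ 'n \<Rightarrow> real) \<Rightarrow> (real ^ 'n \<Rightarrow> real) \<Rightarrow> real" where
  "sip f g = (LINT x|sphere_measure. f x * g x)"

lemma sip_commute: "sip f g = sip g f"
  by (simp add: sip_def mult.commute)

lemma sip_cmult: "sip (\<lambda>x. c * f x) g = c * sip f g"
  by (simp add: sip_def mult.assoc)

lemma sip_diff:
  assumes "continuous_on UNIV f" "continuous_on UNIV g" "continuous_on UNIV h"
  shows "sip (\<lambda>x. f x - g x) h = sip f h - sip g h"
  unfolding sip_def
  by (subst Bochner_Integration.integral_diff[symmetric])
     (auto simp: algebra_simps intro!: integrable_sphere_continuous continuous_intros assms)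

lemma sip_sum:
  assumes "\<And>i. i \<in> I \<Longrightarrow> continuous_on UNIV (f i)" "continuous_on UNIV h"
  shows "sip (\<lambda>x. \<Sum>i\<in>I. c i * f i x) h = (\<Sum>i\<in>I. c i * sip (f i) h)"
proof -
  have "sip (\<lambda>x. \<Sum>i\<in>I. c i * f i x) h = (LINT x|sphere_measure. (\<Sum>i\<in>I. c i * (f i x * h x)))"
    unfolding sip_def by (simp add: sum_distrib_right mult.assoc)
  also have "\<dots> = (\<Sum>i\<in>I. LINT x|sphere_measure. c i * (f i x * h x))"
    by (intro Bochner_Integration.integral_sum integrable_mult_right integrable_sphere_continuous continuous_intros assms)
  finally show ?thesis by (simp add: sip_def)
qed

lemma sip_self_zero:
  assumes f: "continuous_on UNIV f" and "sip f f = 0" and "norm x = 1"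
  shows "f x = 0"
proof -
  have "AE x in sphere_measure. f x * f x = 0"
    using assms(2) integrable_sphere_continuous[OF continuous_on_mult[OF f f]]
    unfolding sip_def by (subst (asm) integral_nonneg_eq_0_iff_AE) auto
  then have "AE x in sphere_measure. f x = 0" by simp
  from sphere_full_support[OF f this assms(3)] show ?thesis .
qed

text \<open>
  Gram--Schmidt orthonormalization of the monomials on the sphere. A monomial that depends linearly on its
  predecessors there has a residual of norm zero, and division by zero then produces the zero function.
\<close>

fun gs :: "nat \<Rightarrow> real ^ 'n \<Rightarrow> real" where
  "gs i = (let r = (\<lambda>x. monomial_seq i x - (\<Sum>j<i. sip (monomial_seq i) (gs j) * gs j x))
           in (\<lambda>x. r x / sqrt (sip r r)))"

declare gs.simps [simp del]

definition gs_residual :: "nat \<Rightarrow> real ^ 'n \<Rightarrow> real" where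
  "gs_residual i x = monomial_seq i x - (\<Sum>j<i. sip (monomial_seq i) (gs j) * gs j x)"

lemma gs_eq: "gs i x = inverse (sqrt (sip (gs_residual i) (gs_residual i))) * gs_residual i x"
  by (subst gs.simps) (simp add: Let_def gs_residual_def[abs_def] divide_inverse mult.commute)

lemma gs_in_polys: "i < polydim CARD('n) k \<Longrightarrow> gs i \<in> polys k"
proof (induction i rule: less_induct)
  case (less i)
  have "gs_residual i \<in> polys k" unfolding gs_residual_def[abs_def]
    by (intro polys_diff polys_sum polys_cmult less.IH monomial_seq_in_polys) (use less.prems in auto)
  then show ?case unfolding gs_eq[abs_def] by (rule polys_cmult)
qed

lemma polydim_ge: "k \<le> polydim CARD('n) k"
proof (induction k)
  case (Suc k)
  have "polydim CARD('n) k \<le> CARD('n) * polydim CARD('n) k" using zero_less_card_finite[where 'a='n] by (cases "CARD('n)") auto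
  with Suc show ?case unfolding polydim.simps by linarith
qed simp

lemma continuous_gs: "continuous_on S (gs i)"
  by (rule continuous_polys[OF gs_in_polys[of i "Suc i"]]) (use polydim_ge[of "Suc i"] in simp)

lemma continuous_gs_residual: "continuous_on S (gs_residual i)"
  unfolding gs_residual_def[abs_def]
  by (intro continuous_intros continuous_gs continuous_monomial_seq)

lemma gs_norm: "sip (gs i) (gs i) = 1 \<or> (\<forall>x. gs i x = 0)"
proof (cases "sip (gs_residual i) (gs_residual i) = 0")
  case True then show ?thesis by (simp add: gs_eq)
next
  case False
  let ?q = "sip (gs_residual i) (gs_residual i)"
  have "0 \<le> ?q" by (simp add: sip_def)
  with False have q: "0 < ?q" by simp
  have "sip (gs i) (gs i) = inverse (sqrt ?q) * (inverse (sqrt ?q) * ?q)"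
    unfolding gs_eq[abs_def] by (simp only: sip_cmult sip_commute[of "gs_residual i" "\<lambda>x. _ * gs_residual i x"])
  also have "\<dots> = 1" using q by (simp add: field_simps)
  finally show ?thesis by simp
qed

lemma gs_orthogonal_less: "j < i \<Longrightarrow> sip (gs i) (gs j) = 0"
proof (induction i arbitrary: j rule: less_induct)
  case (less i)
  have "sip (gs_residual i) (gs j) = sip (monomial_seq i) (gs j) - (\<Sum>l<i. sip (monomial_seq i) (gs l) * sip (gs l) (gs j))"
    unfolding gs_residual_def[abs_def]
    by (subst sip_diff, (intro continuous_intros continuous_gs continuous_monomial_seq)+)
       (subst sip_sum, auto intro: continuous_gs)
  also have "(\<Sum>l<i. sip (monomial_seq i) (gs l) * sip (gs l) (gs j)) = (\<Sum>l<i. if l = j then sip (monomial_seq i) (gs j) * sip (gs j) (gs j) else 0)"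
  proof (rule sum.cong[OF refl])
    fix l assume "l \<in> {..<i}"
    then have "l < i" by simp
    show "sip (monomial_seq i) (gs l) * sip (gs l) (gs j) = (if l = j then sip (monomial_seq i) (gs j) * sip (gs j) (gs j) else 0)"
      using less.IH[OF \<open>l < i\<close>, of j] less.IH[OF less.prems, of l] sip_commute[of "gs l" "gs j"]
      by (cases l j rule: linorder_cases) auto
  qed
  also have "\<dots> = sip (monomial_seq i) (gs j) * sip (gs j) (gs j)" using less.prems by simp
  also have "sip (monomial_seq i) (gs j) - sip (monomial_seq i) (gs j) * sip (gs j) (gs j) = 0"
    using gs_norm[of j] by (auto simp: sip_def)
  finally have "inverse (sqrt (sip (gs_residual i) (gs_residual i))) * sip (gs_residual i) (gs j) = 0" by simp
  moreover have "gs i = (\<lambda>x. inverse (sqrt (sip (gs_residual i) (gs_residual i))) * gs_residual i x)"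
    by (rule ext) (rule gs_eq)
  ultimately show ?case by (simp only: sip_cmult)
qed

lemma gs_orthogonal: "i \<noteq> j \<Longrightarrow> sip (gs i) (gs j) = 0"
  using gs_orthogonal_less[of i j] gs_orthogonal_less[of j i] sip_commute[of "gs i" "gs j"]
  by (cases i j rule: linorder_cases) auto

text \<open>
  A residual of norm zero vanishes everywhere on the sphere because the surface measure has full support. The
  expansion therefore holds at every point of the sphere.
\<close>

lemma monomial_gs_expansion:
  assumes "norm x = 1"
  shows "monomial_seq i x = sqrt (sip (gs_residual i) (gs_residual i)) * gs i x + (\<Sum>j<i. sip (monomial_seq i) (gs j) * gs j x)"
proof -
  let ?q = "sip (gs_residual i) (gs_residual i)"
  have "gs_residual i x = sqrt ?q * gs i x"
  proof (cases "?q = 0")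
    case True
    then show ?thesis using sip_self_zero[OF continuous_gs_residual True assms] by simp
  next
    case False then show ?thesis by (simp add: gs_eq)
  qed
  then show ?thesis by (simp add: gs_residual_def)
qed

lemma polys_gs_span:
  assumes "f \<in> polys k"
  shows "\<exists>a. \<forall>x. norm x = 1 \<longrightarrow> f x = (\<Sum>i<polydim CARD('n) k. a i * gs i x)"
proof -
  have mon: "\<exists>a. \<forall>x. norm x = 1 \<longrightarrow> monomial_seq i x = (\<Sum>j<polydim CARD('n) k. a j * gs j x)" if "i < polydim CARD('n) k" for i
  proof -
    define a where "a j = (if j = i then sqrt (sip (gs_residual i) (gs_residual i)) else if j < i then sip (monomial_seq i) (gs j) else 0)" for j
    have "(\<Sum>j<polydim CARD('n) k. a j * gs j x) = (\<Sum>j\<in>insert i {..<i}. a j * gs j x)" for x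
      by (rule sum.mono_neutral_right) (use that in \<open>auto simp: a_def\<close>)
    also have "\<dots> x = sqrt (sip (gs_residual i) (gs_residual i)) * gs i x + (\<Sum>j<i. sip (monomial_seq i) (gs j) * gs j x)" for x
      by (simp add: a_def)
    finally show ?thesis using monomial_gs_expansion by (intro exI[of _ a]) simp
  qed
  then obtain A where A: "\<And>i x. i < polydim CARD('n) k \<Longrightarrow> norm x = 1 \<Longrightarrow> monomial_seq i x = (\<Sum>j<polydim CARD('n) k. A i j * gs j x)"
    by metis
  from assms obtain c where c: "f = (\<lambda>x. \<Sum>i<polydim CARD('n) k. c i * monomial_seq i x)" by (auto simp: polys_def)
  have "f x = (\<Sum>j<polydim CARD('n) k. (\<Sum>i<polydim CARD('n) k. c i * A i j) * gs j x)" if "norm x = 1" for x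
  proof -
    have "f x = (\<Sum>i<polydim CARD('n) k. \<Sum>j<polydim CARD('n) k. c i * A i j * gs j x)"
      unfolding c by (intro sum.cong refl) (simp add: A that sum_distrib_left mult.assoc)
    also have "\<dots> = (\<Sum>j<polydim CARD('n) k. \<Sum>i<polydim CARD('n) k. c i * A i j * gs j x)" by (rule sum.swap)
    finally show ?thesis by (simp add: sum_distrib_right)
  qed
  then show ?thesis by (intro exI[of _ "\<lambda>j. \<Sum>i<polydim CARD('n) k. c i * A i j"]) simp
qed

lemma polys_gs_expansion:
  assumes "f \<in> polys k" "norm x = 1"
  shows "f x = (\<Sum>i<polydim CARD('n) k. sip f (gs i) * gs i x)"
proof -
  obtain a where a: "\<And>x. norm x = 1 \<Longrightarrow> f x = (\<Sum>i<polydim CARD('n) k. a i * gs i x)" using polys_gs_span[OF assms(1)] by blast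
  have "sip f (gs j) * gs j x = a j * gs j x" if "j < polydim CARD('n) k" for j
  proof -
    have "sip f (gs j) = sip (\<lambda>x. \<Sum>i<polydim CARD('n) k. a i * gs i x) (gs j)"
      unfolding sip_def
      by (rule integral_cong_AE) (use AE_sphere a borel_measurable_continuous_onI[OF continuous_polys[OF assms(1)]]
          borel_measurable_continuous_onI[OF continuous_gs] in \<open>auto elim!: eventually_mono\<close>)
    also have "\<dots> = (\<Sum>i<polydim CARD('n) k. a i * sip (gs i) (gs j))" by (rule sip_sum) (auto intro: continuous_gs)
    also have "\<dots> = (\<Sum>i<polydim CARD('n) k. if i = j then a j * sip (gs j) (gs j) else 0)"
      by (rule sum.cong) (auto simp: gs_orthogonal)
    also have "\<dots> = a j * sip (gs j) (gs j)" using that by simp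
    finally show ?thesis using gs_norm[of j] by auto
  qed
  then have "a j * gs j x = sip f (gs j) * gs j x" if "j < polydim CARD('n) k" for j using that by presburger
  then show ?thesis unfolding a[OF assms(2)] by (intro sum.cong[OF refl]) (simp only: lessThan_iff)
qed

subsection \<open>The zonal kernels\<close>

text \<open>
  The kernel of the orthogonal projection onto the polynomials of degree less than \<open>k\<close> on the sphere.
\<close>

definition repro_kernel :: "nat \<Rightarrow> real ^ 'n \<Rightarrow> real ^ 'n \<Rightarrow> real" where
  "repro_kernel k x y = (\<Sum>i<polydim CARD('n) k. gs i x * gs i y)"

lemma repro_kernel_reproducing:
  assumes "f \<in> polys k" "norm x = 1" shows "sip f (repro_kernel k x) = f x"
proof -
  have "sip f (repro_kernel k x) = sip (\<lambda>y. \<Sum>i<polydim CARD('n) k. gs i x * gs i y) f"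
    by (simp add: sip_commute repro_kernel_def[abs_def])
  also have "\<dots> = (\<Sum>i<polydim CARD('n) k. gs i x * sip (gs i) f)"
    by (rule sip_sum) (auto intro: continuous_gs continuous_polys[OF assms(1)])
  finally show ?thesis using polys_gs_expansion[OF assms] by (simp add: mult.commute sip_commute)
qed

lemma repro_kernel_polys: "repro_kernel k x \<in> polys k"
  unfolding repro_kernel_def[abs_def] by (intro polys_sum polys_cmult gs_in_polys) simp

text \<open>
  The kernel of a rotation invariant space is invariant because it is unique. Concretely, the
  function \<open>v\<close> in the proof is a polynomial, and by invariance of the measure its \<open>i\<close>-th
  coefficient is the reproducing formula for the polynomial \<open>gs i\<close> composed with the inverse rotation.
\<close>

lemma repro_kernel_rotate:
  assumes R: "rotation_matrix R" and "norm x = 1" "norm y = 1"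
  shows "repro_kernel k (R *v x) (R *v y) = repro_kernel k x y"
proof -
  have Rx: "norm (R *v x) = 1" using assms(2) by (simp add: norm_rotation[OF R])
  define v where "v z = repro_kernel k (R *v x) (R *v z)" for z
  have v: "v \<in> polys k" unfolding v_def[abs_def] by (rule polys_linear_map[OF repro_kernel_polys])
  have "sip v (gs i) = gs i x" if "i < polydim CARD('n) k" for i
  proof -
    let ?h = "\<lambda>z. gs i (transpose R *v z)"
    have h: "?h \<in> polys k" by (rule polys_linear_map[OF gs_in_polys[OF that]])
    have [measurable]: "gs i \<in> borel_measurable borel" "repro_kernel k u \<in> borel_measurable borel" for u
      by (intro borel_measurable_continuous_onI continuous_gs continuous_polys[OF repro_kernel_polys])+
    have "sip v (gs i) = (LINT z|sphere_measure. repro_kernel k (R *v x) (R *v z) * ?h (R *v z))"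
      by (simp add: sip_def v_def rotation_transpose_cancel(1)[OF R])
    also have "\<dots> = (LINT z|sphere_measure. repro_kernel k (R *v x) z * ?h z)"
      by (rule integral_sphere_rotate[OF R, of "\<lambda>z. repro_kernel k (R *v x) z * ?h z"]) measurable
    also have "\<dots> = sip ?h (repro_kernel k (R *v x))" by (simp add: sip_def mult.commute)
    also have "\<dots> = ?h (R *v x)" by (rule repro_kernel_reproducing[OF h Rx])
    finally show ?thesis by (simp add: rotation_transpose_cancel(1)[OF R])
  qed
  then have "v y = (\<Sum>i<polydim CARD('n) k. gs i x * gs i y)" using polys_gs_expansion[OF v assms(3)] by simp
  then show ?thesis by (simp add: v_def repro_kernel_def)
qed

definition block :: "nat \<Rightarrow> nat set" where "block k = {polydim CARD('n) k..<polydim CARD('n) (Suc k)}"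

text \<open>
  The kernel of the projection onto the polynomials of degree \<open>k\<close> that are orthogonal to those of smaller degree, that
  is, the zonal spherical harmonic of degree \<open>k\<close> with pole \<open>y\<close>.
\<close>

definition zonal :: "nat \<Rightarrow> real ^ 'n \<Rightarrow> real ^ 'n \<Rightarrow> real" where
  "zonal k x y = (\<Sum>i\<in>block k. gs i x * gs i y)"

lemma sum_block:
  fixes f :: "nat \<Rightarrow> 'c::ab_group_add"
  shows "(\<Sum>i\<in>block k. f i) = (\<Sum>i<polydim CARD('n) (Suc k). f i) - (\<Sum>i<polydim CARD('n) k. f i)"
proof -
  have "polydim CARD('n) k \<le> polydim CARD('n) (Suc k)" by (rule polydim_mono) auto
  then show ?thesis unfolding block_def
    using sum_diff_nat_ivl[of 0 "polydim CARD('n) k" "polydim CARD('n) (Suc k)" f] by (simp add: lessThan_atLeast0)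
qed

lemma sum_block_less:
  fixes f :: "nat \<Rightarrow> 'c::ab_group_add"
  shows "(\<Sum>k<m. \<Sum>i\<in>block k. f i) = (\<Sum>i<polydim CARD('n) m. f i)"
  by (induction m) (simp_all add: sum_block)

lemma zonal_rotate:
  assumes "rotation_matrix R" "norm x = 1" "norm y = 1"
  shows "zonal k (R *v x) (R *v y) = zonal k x y"
  using repro_kernel_rotate[OF assms] by (simp only: zonal_def sum_block repro_kernel_def)

lemma continuous_zonal: "continuous_on UNIV (\<lambda>x. zonal k x y)" "continuous_on UNIV (zonal k y)"
  unfolding zonal_def[abs_def] by (intro continuous_intros continuous_gs)+

definition coeff_gs :: "(real ^ 'n \<Rightarrow> complex) \<Rightarrow> nat \<Rightarrow> complex" where
  "coeff_gs F i = (LINT x|sphere_measure. F x * complex_of_real (gs i x))"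

lemma sq_int_sphere_continuous:
  fixes f :: "real ^ 'n \<Rightarrow> real"
  assumes "continuous_on UNIV f" shows "(\<lambda>x. complex_of_real (f x)) \<in> sq_int sphere_measure"
  using integrable_sphere_continuous[OF continuous_on_power[OF assms, of 2]] borel_measurable_continuous_onI[OF assms]
  by (simp add: sq_int_def)

lemma ip_gs_combination:
  assumes F: "F \<in> sq_int sphere_measure" and "finite I"
  shows "ip sphere_measure F (\<lambda>x. \<Sum>i\<in>I. a i * complex_of_real (gs i x)) = (\<Sum>i\<in>I. coeff_gs F i * cnj (a i))"
proof -
  have "ip sphere_measure F (\<lambda>x. \<Sum>i\<in>I. a i * complex_of_real (gs i x)) = (LINT x|sphere_measure. (\<Sum>i\<in>I. cnj (a i) * (F x * cnj (complex_of_real (gs i x)))))"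
    unfolding ip_def by (simp add: sum_distrib_left mult_ac)
  also have "\<dots> = (\<Sum>i\<in>I. LINT x|sphere_measure. cnj (a i) * (F x * cnj (complex_of_real (gs i x))))"
    by (intro Bochner_Integration.integral_sum integrable_mult_right integrable_ip[OF F sq_int_sphere_continuous[OF continuous_gs]])
  finally show ?thesis by (simp add: coeff_gs_def mult.commute)
qed

lemma sq_int_gs_combination:
  "finite I \<Longrightarrow> (\<lambda>x. \<Sum>i\<in>I. a i * complex_of_real (gs i x)) \<in> sq_int sphere_measure"
  by (induction I rule: finite_induct) (auto intro!: sq_int_add sq_int_cmult sq_int_sphere_continuous continuous_gs)

lemma coeff_gs_combination:
  assumes "finite I"
  shows "coeff_gs (\<lambda>x. \<Sum>i\<in>I. a i * complex_of_real (gs i x)) j = (if j \<in> I then a j * complex_of_real (sip (gs j) (gs j)) else 0)"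
proof -
  have "coeff_gs (\<lambda>x. \<Sum>i\<in>I. a i * complex_of_real (gs i x)) j = cnj (ip sphere_measure (\<lambda>x. complex_of_real (gs j x)) (\<lambda>x. \<Sum>i\<in>I. a i * complex_of_real (gs i x)))"
    unfolding ip_cnj by (simp add: coeff_gs_def ip_def)
  also have "\<dots> = (\<Sum>i\<in>I. complex_of_real (sip (gs j) (gs i)) * a i)"
    by (subst ip_gs_combination[OF sq_int_sphere_continuous[OF continuous_gs] assms])
       (simp add: coeff_gs_def sip_def flip: of_real_mult)
  also have "\<dots> = (\<Sum>i\<in>I. if i = j then a j * complex_of_real (sip (gs j) (gs j)) else 0)"
    by (rule sum.cong) (auto simp: gs_orthogonal)
  finally show ?thesis using assms by simp
qed

lemma nrm_gs_combination:
  assumes "finite I"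
  shows "(nrm sphere_measure (\<lambda>x. \<Sum>i\<in>I. a i * complex_of_real (gs i x)))\<^sup>2 = (\<Sum>i\<in>I. (cmod (a i))\<^sup>2 * sip (gs i) (gs i))"
proof -
  have "complex_of_real ((nrm sphere_measure (\<lambda>x. \<Sum>i\<in>I. a i * complex_of_real (gs i x)))\<^sup>2) = (\<Sum>i\<in>I. a i * complex_of_real (sip (gs i) (gs i)) * cnj (a i))"
    unfolding ip_self[symmetric] by (subst ip_gs_combination[OF sq_int_gs_combination[OF assms] assms]) (simp add: coeff_gs_combination[OF assms])
  also have "\<dots> = complex_of_real (\<Sum>i\<in>I. (cmod (a i))\<^sup>2 * sip (gs i) (gs i))"
    unfolding of_real_sum of_real_mult complex_norm_square by (simp add: mult_ac)
  finally show ?thesis by (simp only: of_real_eq_iff)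
qed

lemma coeff_gs_null: "sip (gs i) (gs i) \<noteq> 1 \<Longrightarrow> coeff_gs F i = 0"
  using gs_norm[of i] by (simp add: coeff_gs_def)

lemma sip_gs_cases: "sip (gs i) (gs i) = 1 \<or> sip (gs i) (gs i) = 0"
  using gs_norm[of i] by (auto simp: sip_def)

lemma coeff_gs_sip: "(cmod (coeff_gs F i))\<^sup>2 * sip (gs i) (gs i) = (cmod (coeff_gs F i))\<^sup>2"
  using sip_gs_cases[of i] coeff_gs_null[of i F] by auto

text \<open>
  For each index \<open>|a|\<^sup>2 - 2 * Re (c * cnj a) \<ge> - |c|\<^sup>2\<close>, where \<open>c\<close> is the coefficient of \<open>F\<close>. If \<open>gs i\<close> is the zero
  function, then \<open>c\<close> and the contribution of \<open>a\<close> vanish.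
\<close>

lemma gs_best_approximation:
  assumes F: "F \<in> sq_int sphere_measure" and I: "finite I"
  shows "(nrm sphere_measure F)\<^sup>2 - (\<Sum>i\<in>I. (cmod (coeff_gs F i))\<^sup>2) \<le> (nrm sphere_measure (\<lambda>x. F x - (\<Sum>i\<in>I. a i * complex_of_real (gs i x))))\<^sup>2"
proof -
  let ?c = "coeff_gs F"
  have "(nrm sphere_measure (\<lambda>x. F x - (\<Sum>i\<in>I. a i * complex_of_real (gs i x))))\<^sup>2 =
      (nrm sphere_measure (\<lambda>x. F x + (\<Sum>i\<in>I. - a i * complex_of_real (gs i x))))\<^sup>2" by (simp add: sum_negf)
  also have "\<dots> = (nrm sphere_measure F)\<^sup>2 + (\<Sum>i\<in>I. (cmod (- a i))\<^sup>2 * sip (gs i) (gs i)) + 2 * Re (\<Sum>i\<in>I. ?c i * cnj (- a i))"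
    by (subst nrm_add_sq[OF F sq_int_gs_combination[OF I]]) (simp only: nrm_gs_combination[OF I] ip_gs_combination[OF F I])
  also have "\<dots> = (nrm sphere_measure F)\<^sup>2 + (\<Sum>i\<in>I. (cmod (a i))\<^sup>2 * sip (gs i) (gs i) - 2 * Re (?c i * cnj (a i)))"
    by (simp add: sum_subtractf sum_negf sum_distrib_left)
  also have "\<dots> \<ge> (nrm sphere_measure F)\<^sup>2 + (\<Sum>i\<in>I. - (cmod (?c i))\<^sup>2)"
  proof (intro add_left_mono sum_mono)
    fix i
    have "0 \<le> (cmod (a i - ?c i))\<^sup>2" by simp
    also have "(cmod (a i - ?c i))\<^sup>2 = (cmod (a i))\<^sup>2 + (cmod (?c i))\<^sup>2 - 2 * Re (?c i * cnj (a i))"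
      by (simp only: cmod_power2) (simp add: power2_eq_square algebra_simps)
    finally show "- (cmod (?c i))\<^sup>2 \<le> (cmod (a i))\<^sup>2 * sip (gs i) (gs i) - 2 * Re (?c i * cnj (a i))"
      using sip_gs_cases[of i] coeff_gs_null[of i F] by auto
  qed
  finally show ?thesis by (simp add: sum_negf)
qed

lemma gs_bessel:
  assumes F: "F \<in> sq_int sphere_measure" and I: "finite I"
  shows "(\<Sum>i\<in>I. (cmod (coeff_gs F i))\<^sup>2) \<le> (nrm sphere_measure F)\<^sup>2"
proof -
  let ?c = "coeff_gs F"
  let ?P = "\<lambda>x. \<Sum>i\<in>I. ?c i * complex_of_real (gs i x)"
  define q where "q = (\<Sum>i\<in>I. (cmod (?c i))\<^sup>2)"
  have "(nrm sphere_measure ?P)\<^sup>2 = q"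
    unfolding nrm_gs_combination[OF I] q_def
    by (simp only: coeff_gs_sip)
  moreover have "ip sphere_measure F ?P = complex_of_real q"
    unfolding ip_gs_combination[OF F I] q_def of_real_sum complex_norm_square ..
  ultimately have "cmod (complex_of_real q) \<le> nrm sphere_measure F * sqrt q"
    using norm_ip_le[OF F sq_int_gs_combination[OF I, of ?c]] nrm_nonneg[of sphere_measure ?P] by (metis real_sqrt_unique)
  moreover have "0 \<le> q" unfolding q_def by (intro sum_nonneg) simp
  ultimately have q: "sqrt q * sqrt q \<le> nrm sphere_measure F * sqrt q" by simp
  have "sqrt q \<le> nrm sphere_measure F"
  proof (cases "q = 0")
    case False
    then have "0 < sqrt q" using \<open>0 \<le> q\<close> by simp
    then show ?thesis by (rule mult_right_le_imp_le[OF q])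
  qed simp
  then have "(sqrt q)\<^sup>2 \<le> (nrm sphere_measure F)\<^sup>2" using \<open>0 \<le> q\<close> by (intro power_mono) auto
  then show ?thesis using \<open>0 \<le> q\<close> by (simp add: q_def)
qed

text \<open>
  Continuous functions are dense for the surface measure, and on the compact sphere they are uniform
  limits of polynomials. The real and the imaginary part are approximated separately.
\<close>

lemma gs_dense:
  assumes F: "F \<in> sq_int sphere_measure" and "0 < \<epsilon>"
  shows "\<exists>k a. nrm sphere_measure (\<lambda>x. F x - (\<Sum>i<polydim CARD('n) k. a i * complex_of_real (gs i x))) < \<epsilon>"
proof -
  have fin: "finite_measure sphere_measure" by unfold_locales
  obtain \<psi> B where \<psi>: "continuous_on UNIV \<psi>" "\<forall>x. cmod (\<psi> x) \<le> B" "nrm sphere_measure (\<lambda>x. F x - \<psi> x) < \<epsilon> / 2"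
    using continuous_dense_finite[OF fin sets_sphere_measure F, of "\<epsilon> / 2"] \<open>0 < \<epsilon>\<close> by auto
  have \<psi>s: "\<psi> \<in> sq_int sphere_measure"
    using \<psi> borel_measurable_continuous_onI[OF \<psi>(1)] by (intro sq_int_bounded_finite[OF fin, of _ B]) auto
  have e4: "0 < \<epsilon> / 4" using \<open>0 < \<epsilon>\<close> by simp
  have approx: "\<exists>k p. p \<in> polys k \<and> (\<forall>x. norm x = 1 \<longrightarrow> \<bar>h x - p x\<bar> < \<epsilon> / 4)" if h: "continuous_on UNIV h" for h :: "real ^ 'n \<Rightarrow> real"
  proof -
    obtain p where p: "real_polynomial_function p" "\<And>x. x \<in> sphere 0 1 \<Longrightarrow> \<bar>h x - p x\<bar> < \<epsilon> / 4"
      using Stone_Weierstrass_real_polynomial_function[of "sphere (0::real^'n) 1" h, OF _ continuous_on_subset[OF h] e4] by auto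
    then show ?thesis using real_polynomial_function_polys[OF p(1)] by auto
  qed
  obtain k1 p1 where p1: "p1 \<in> polys k1" "\<forall>x. norm x = 1 \<longrightarrow> \<bar>Re (\<psi> x) - p1 x\<bar> < \<epsilon> / 4"
    using approx[of "\<lambda>x. Re (\<psi> x)"] \<psi>(1) by (auto intro: continuous_on_Re)
  obtain k2 p2 where p2: "p2 \<in> polys k2" "\<forall>x. norm x = 1 \<longrightarrow> \<bar>Im (\<psi> x) - p2 x\<bar> < \<epsilon> / 4"
    using approx[of "\<lambda>x. Im (\<psi> x)"] \<psi>(1) by (auto intro: continuous_on_Im)
  define k where "k = max k1 k2"
  have pk: "p1 \<in> polys k" "p2 \<in> polys k" using polys_mono[OF p1(1)] polys_mono[OF p2(1)] by (auto simp: k_def)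
  define a where "a i = complex_of_real (sip p1 (gs i)) + \<i> * complex_of_real (sip p2 (gs i))" for i
  define P where "P x = (\<Sum>i<polydim CARD('n) k. a i * complex_of_real (gs i x))" for x
  have Ps: "P \<in> sq_int sphere_measure" unfolding P_def by (rule sq_int_gs_combination) simp
  have Px: "P x = complex_of_real (p1 x) + \<i> * complex_of_real (p2 x)" if "norm x = 1" for x
    unfolding P_def a_def polys_gs_expansion[OF pk(1) that] polys_gs_expansion[OF pk(2) that]
    by (simp add: sum_distrib_left sum.distrib[symmetric] distrib_right mult.assoc)
  have bound: "cmod (\<psi> x - P x) \<le> \<epsilon> / 2" if "norm x = 1" for x
  proof -
    have "cmod (\<psi> x - P x) \<le> \<bar>Re (\<psi> x - P x)\<bar> + \<bar>Im (\<psi> x - P x)\<bar>" by (rule cmod_le)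
    also have "\<dots> \<le> \<epsilon> / 4 + \<epsilon> / 4" using p1(2) p2(2) that by (intro add_mono) (auto simp: Px less_imp_le)
    finally show ?thesis by simp
  qed
  have "nrm sphere_measure (\<lambda>x. \<psi> x - P x) \<le> \<epsilon> / 2"
  proof (rule nrm_leI(2))
    show "(\<lambda>x. \<psi> x - P x) \<in> borel_measurable sphere_measure" using sq_int_measurable[OF sq_int_diff[OF \<psi>s Ps]] .
    have "(\<integral>\<^sup>+x. ennreal ((cmod (\<psi> x - P x))\<^sup>2) \<partial>sphere_measure) \<le> (\<integral>\<^sup>+x. ennreal ((\<epsilon> / 2)\<^sup>2) \<partial>sphere_measure)"
      by (rule nn_integral_mono_AE, use AE_sphere in eventually_elim) (intro ennreal_leI power_mono bound, auto)
    then show "(\<integral>\<^sup>+x. ennreal ((cmod (\<psi> x - P x))\<^sup>2) \<partial>sphere_measure) \<le> ennreal ((\<epsilon> / 2)\<^sup>2)"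
      by (simp add: sph.emeasure_space_1[simplified])
  qed (use \<open>0 < \<epsilon>\<close> in simp)
  then have "nrm sphere_measure (\<lambda>x. F x - P x) < \<epsilon>"
    using nrm_triangle_diff[OF F \<psi>s Ps] \<psi>(3) by linarith
  then show ?thesis unfolding P_def by blast
qed

theorem gs_parseval:
  assumes F: "F \<in> sq_int sphere_measure"
  shows "(\<lambda>k. \<Sum>i\<in>block k. (cmod (coeff_gs F i))\<^sup>2) sums (nrm sphere_measure F)\<^sup>2"
  unfolding sums_def sum_block_less
proof (rule LIMSEQ_I)
  fix r :: real assume "0 < r"
  then obtain k a where k: "nrm sphere_measure (\<lambda>x. F x - (\<Sum>i<polydim CARD('n) k. a i * complex_of_real (gs i x))) < sqrt r"
    using gs_dense[OF F, of "sqrt r"] by auto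
  have "(nrm sphere_measure (\<lambda>x. F x - (\<Sum>i<polydim CARD('n) k. a i * complex_of_real (gs i x))))\<^sup>2 < (sqrt r)\<^sup>2"
    using k by (intro power_strict_mono) auto
  then have lower: "(nrm sphere_measure F)\<^sup>2 - (\<Sum>i<polydim CARD('n) k. (cmod (coeff_gs F i))\<^sup>2) < r"
    using gs_best_approximation[OF F, of "{..<polydim CARD('n) k}" a] \<open>0 < r\<close> by simp
  have "norm ((\<Sum>i<polydim CARD('n) m. (cmod (coeff_gs F i))\<^sup>2) - (nrm sphere_measure F)\<^sup>2) < r" if "m \<ge> k" for m
  proof -
    have "(\<Sum>i<polydim CARD('n) k. (cmod (coeff_gs F i))\<^sup>2) \<le> (\<Sum>i<polydim CARD('n) m. (cmod (coeff_gs F i))\<^sup>2)"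
      using polydim_mono[of "CARD('n)", OF zero_less_card_finite that] by (intro sum_mono2) auto
    then show ?thesis using lower gs_bessel[OF F, of "{..<polydim CARD('n) m}"] by simp
  qed
  then show "\<exists>no. \<forall>m\<ge>no. norm ((\<Sum>i<polydim CARD('n) m. (cmod (coeff_gs F i))\<^sup>2) - (nrm sphere_measure F)\<^sup>2) < r" by blast
qed

lemma zonal_convolution:
  assumes F: "F \<in> sq_int sphere_measure"
  shows "(LINT \<omega>|sphere_measure. F \<omega> * complex_of_real (zonal k \<omega> y)) = (\<Sum>i\<in>block k. coeff_gs F i * complex_of_real (gs i y))"
proof -
  have fin: "finite (block k)" by (simp add: block_def)
  have "(LINT \<omega>|sphere_measure. F \<omega> * complex_of_real (zonal k \<omega> y)) =
     ip sphere_measure F (\<lambda>x. \<Sum>i\<in>block k. complex_of_real (gs i y) * complex_of_real (gs i x))"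
    by (simp add: ip_def zonal_def mult.commute)
  also have "\<dots> = (\<Sum>i\<in>block k. coeff_gs F i * complex_of_real (gs i y))"
    by (subst ip_gs_combination[OF F fin]) simp
  finally show ?thesis .
qed

text \<open>
  Parseval's identity, grouped by degree: convolution with \<open>zonal k\<close> is the projection onto the \<open>k\<close>-th block of
  orthonormal functions.
\<close>

theorem zonal_resolution_of_identity:
  assumes F: "F \<in> sq_int sphere_measure"
  shows "(\<Sum>k. \<integral>\<^sup>+y. ennreal ((cmod (LINT \<omega>|sphere_measure. F \<omega> * complex_of_real (zonal k \<omega> y)))\<^sup>2) \<partial>sphere_measure)
     = (\<integral>\<^sup>+y. ennreal ((cmod (F y))\<^sup>2) \<partial>sphere_measure)"
proof -
  have fin: "finite (block k)" for k by (simp add: block_def)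
  have "(\<integral>\<^sup>+y. ennreal ((cmod (LINT \<omega>|sphere_measure. F \<omega> * complex_of_real (zonal k \<omega> y)))\<^sup>2) \<partial>sphere_measure)
     = ennreal (\<Sum>i\<in>block k. (cmod (coeff_gs F i))\<^sup>2)" for k
  proof -
    have "(\<integral>\<^sup>+y. ennreal ((cmod (LINT \<omega>|sphere_measure. F \<omega> * complex_of_real (zonal k \<omega> y)))\<^sup>2) \<partial>sphere_measure)
       = ennreal (\<Sum>i\<in>block k. (cmod (coeff_gs F i))\<^sup>2 * sip (gs i) (gs i))"
      unfolding zonal_convolution[OF F] nn_integral_sq_eq_nrm[OF sq_int_gs_combination[OF fin]] nrm_gs_combination[OF fin] ..
    also have "(\<Sum>i\<in>block k. (cmod (coeff_gs F i))\<^sup>2 * sip (gs i) (gs i)) = (\<Sum>i\<in>block k. (cmod (coeff_gs F i))\<^sup>2)"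
      by (simp only: coeff_gs_sip)
    finally show ?thesis .
  qed
  then show ?thesis
    unfolding nn_integral_sq_eq_nrm[OF F]
    by (simp only:) (rule suminf_ennreal_eq[OF _ gs_parseval[OF F]], intro sum_nonneg, simp)
qed

section \<open>The admissible vector on the Fourier side\<close>

text \<open>
  The cost of the \<open>k\<close>-th zonal function in the norm of the admissible vector.
\<close>

definition zonal_energy :: "nat \<Rightarrow> real" where
  "zonal_energy k = (LINT \<omega>|sphere_measure. (zonal k \<omega> e)\<^sup>2)"

text \<open>
  The edges decrease to zero so fast that \<open>shell_edge k * zonal_energy k\<close> is summable. Their reciprocals grow with the sum of
  all energies up to \<open>k\<close>, which keeps the sequence strictly decreasing.
\<close>

definition shell_edge :: "nat \<Rightarrow> real" where
  "shell_edge k = (1/2) ^ k / (1 + (\<Sum>i\<le>k. zonal_energy i))"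

definition shell :: "nat \<Rightarrow> real set" where
  "shell k = {shell_edge (Suc k)<..shell_edge k}"

definition shell_width :: "nat \<Rightarrow> real" where
  "shell_width k = shell_edge k - shell_edge (Suc k)"

definition unit_radial :: real where
  "unit_radial = real CARD('n) / 2 * unit_ball_vol (real CARD('n))"

text \<open>
  The factor for which each shell has weight one after integration over all dilations; this calculation is
  carried out in \<open>radial_coeff_average\<close> and \<open>radial_coeff_dilation_integral\<close>.
\<close>

definition shell_gain :: "nat \<Rightarrow> real" where
  "shell_gain k = 1 / sqrt (unit_radial * shell_width k)"

text \<open>
  The Fourier transform of the admissible vector. For each \<open>x\<close> at most one summand is nonzero. The
  exponent is fixed by homogeneity: with the squared radius \<open>s = a * t\<close>, the factor \<open>s powr (2 - d / 2)\<close> from the squared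
  amplitude cancels the power of \<open>a\<close> in \<open>a powr (d / 2) / a\<^sup>2\<close>, so that the integral over \<open>a\<close> is taken with respect to
  Lebesgue measure.
\<close>

definition mother :: "real ^ 'n \<Rightarrow> real" where
  "mother x = (\<Sum>k. indicator (shell k) ((norm x)\<^sup>2) *
      (shell_gain k * ((norm x)\<^sup>2) powr (1 - real CARD('n) / 4) * zonal k (x /\<^sub>R norm x) e))"

lemma zonal_energy_nonneg: "0 \<le> zonal_energy k"
  by (simp add: zonal_energy_def)

lemma shell_edge_pos: "0 < shell_edge k"
  unfolding shell_edge_def using sum_nonneg[of "{..k}" zonal_energy] zonal_energy_nonneg
  by (intro divide_pos_pos) (auto intro: add_pos_nonneg)

lemma shell_width_pos: "0 < shell_width k"
proof -
  have s: "0 \<le> (\<Sum>i\<le>k. zonal_energy i)" by (intro sum_nonneg zonal_energy_nonneg)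
  have "shell_edge (Suc k) \<le> (1/2) ^ Suc k / (1 + (\<Sum>i\<le>k. zonal_energy i))"
    unfolding shell_edge_def using s zonal_energy_nonneg[of "Suc k"] by (intro divide_left_mono mult_pos_pos) auto
  also have "\<dots> < shell_edge k" unfolding shell_edge_def using s by (intro divide_strict_right_mono) auto
  finally show ?thesis by (simp add: shell_width_def)
qed

lemma shell_edge_mono:
  assumes "k \<le> l" shows "shell_edge l \<le> shell_edge k"
proof (rule lift_Suc_antimono_le[OF _ assms])
  show "shell_edge (Suc m) \<le> shell_edge m" for m using shell_width_pos[of m] by (simp add: shell_width_def)
qed

lemma shell_disjoint: "t \<in> shell k \<Longrightarrow> t \<in> shell l \<Longrightarrow> k = l"
  using shell_edge_mono[of "Suc k" l] shell_edge_mono[of "Suc l" k]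
  by (cases k l rule: linorder_cases) (auto simp: shell_def)

lemma shell_pos: "t \<in> shell k \<Longrightarrow> 0 < t"
  using shell_edge_pos[of "Suc k"] by (auto simp: shell_def)

lemma shell_edge_energy_le: "shell_edge k * zonal_energy k \<le> (1/2) ^ k"
proof -
  define s where "s = (\<Sum>i\<le>k. zonal_energy i)"
  have "zonal_energy k \<le> s" unfolding s_def by (rule member_le_sum) (auto simp: zonal_energy_nonneg)
  moreover have "0 \<le> s" unfolding s_def by (intro sum_nonneg zonal_energy_nonneg)
  ultimately have "zonal_energy k / (1 + s) \<le> 1" by simp
  from mult_left_mono[OF this, of "(1/2) ^ k"] show ?thesis unfolding shell_edge_def s_def by simp
qed

lemma unit_radial_pos: "0 < unit_radial"
  unfolding unit_radial_def by (simp add: unit_ball_vol_pos)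

lemma shell_gain_sq: "(shell_gain k)\<^sup>2 = 1 / (unit_radial * shell_width k)"
  unfolding shell_gain_def using unit_radial_pos shell_width_pos[of k] by (simp add: power_divide)

lemma radial_density_eq: "0 < t \<Longrightarrow> radial_density CARD('n) t = unit_radial * t powr (real CARD('n) / 2 - 1)"
  by (simp add: radial_density_def unit_radial_def)

lemma shell_sets [measurable]: "shell k \<in> sets borel"
  by (simp add: shell_def)

lemma suminf_shell:
  fixes f :: "nat \<Rightarrow> 'c::{semiring_1, t2_space}"
  assumes "t \<in> shell k" shows "(\<Sum>j. indicator (shell j) t * f j) = f k"
proof -
  have "(\<Sum>j. indicator (shell j) t * f j) = (\<Sum>j\<in>{k}. indicator (shell j) t * f j)"
    by (rule suminf_finite) (use shell_disjoint[OF assms] in \<open>auto simp: indicator_def\<close>)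
  then show ?thesis using assms by simp
qed

lemma suminf_no_shell:
  fixes f :: "nat \<Rightarrow> 'c::{semiring_1, t2_space}"
  assumes "\<And>k. t \<notin> shell k" shows "(\<Sum>j. indicator (shell j) t * f j) = 0"
  using assms by (simp add: indicator_def)

lemma zonal_measurable [measurable]: "(\<lambda>x. zonal k x y) \<in> borel_measurable borel" "zonal k y \<in> borel_measurable borel"
  by (intro borel_measurable_continuous_onI continuous_zonal)+

lemma mother_measurable [measurable]: "mother \<in> borel_measurable borel"
  unfolding mother_def[abs_def] by measurable

lemma mother_on_shell:
  assumes "t \<in> shell k" "norm \<omega> = 1"
  shows "mother (sqrt t *\<^sub>R \<omega>) = shell_gain k * t powr (1 - real CARD('n) / 4) * zonal k \<omega> e"
proof -
  have n: "norm (sqrt t *\<^sub>R \<omega>) = sqrt t" "(sqrt t)\<^sup>2 = t" "sqrt t *\<^sub>R \<omega> /\<^sub>R sqrt t = \<omega>"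
    using shell_pos[OF assms(1)] assms(2) by auto
  show ?thesis unfolding mother_def n by (rule suminf_shell[OF assms(1)])
qed

lemma mother_off_shells:
  assumes "\<And>k. t \<notin> shell k" "norm \<omega> = 1" "0 \<le> t"
  shows "mother (sqrt t *\<^sub>R \<omega>) = 0"
proof -
  have n: "norm (sqrt t *\<^sub>R \<omega>) = sqrt t" "(sqrt t)\<^sup>2 = t" using assms by auto
  show ?thesis unfolding mother_def n by (rule suminf_no_shell[OF assms(1)])
qed

text \<open>
  In polar coordinates the \<open>k\<close>-th shell contributes the mean of \<open>t * zonal_energy k\<close> over the shell, which is at most
  \<open>(1/2)^k\<close>.
\<close>

lemma mother_sq_int: "(\<lambda>x. complex_of_real (mother x)) \<in> sq_int lborel"
proof (rule sq_intI)
  let ?n = "real CARD('n)"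
  have inner: "ennreal (radial_density CARD('n) t) * (\<integral>\<^sup>+\<omega>. ennreal ((mother (sqrt t *\<^sub>R \<omega>))\<^sup>2) \<partial>sphere_measure)
      \<le> (\<Sum>k. indicator (shell k) t * ennreal ((1/2) ^ k / shell_width k))" for t
  proof (cases "0 < t")
    case False then show ?thesis by (simp add: radial_density_def)
  next
    case t: True
    show ?thesis
    proof (cases "\<exists>k. t \<in> shell k")
      case False
      then have "(\<integral>\<^sup>+\<omega>. ennreal ((mother (sqrt t *\<^sub>R \<omega>))\<^sup>2) \<partial>sphere_measure) = (\<integral>\<^sup>+\<omega>. 0 \<partial>sphere_measure)"
        by (intro nn_integral_cong_AE, use AE_sphere in eventually_elim) (use t in \<open>simp add: mother_off_shells\<close>)
      then show ?thesis by simp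
    next
      case True
      then obtain k where k: "t \<in> shell k" by blast
      have p: "(t powr (1 - ?n / 4))\<^sup>2 = t powr (2 - ?n / 2)"
        by (simp add: power2_eq_square powr_add[symmetric])
      have "(\<integral>\<^sup>+\<omega>. ennreal ((mother (sqrt t *\<^sub>R \<omega>))\<^sup>2) \<partial>sphere_measure) =
          (\<integral>\<^sup>+\<omega>. ennreal ((shell_gain k)\<^sup>2 * t powr (2 - ?n / 2)) * ennreal ((zonal k \<omega> e)\<^sup>2) \<partial>sphere_measure)"
        by (intro nn_integral_cong_AE, use AE_sphere in eventually_elim)
           (simp add: mother_on_shell[OF k] power_mult_distrib p ennreal_mult[symmetric])
      also have "\<dots> = ennreal ((shell_gain k)\<^sup>2 * t powr (2 - ?n / 2)) * (\<integral>\<^sup>+\<omega>. ennreal ((zonal k \<omega> e)\<^sup>2) \<partial>sphere_measure)"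
        by (rule nn_integral_cmult) measurable
      also have "(\<integral>\<^sup>+\<omega>. ennreal ((zonal k \<omega> e)\<^sup>2) \<partial>sphere_measure) = ennreal (zonal_energy k)"
        unfolding zonal_energy_def
        by (intro nn_integral_eq_integral integrable_sphere_continuous continuous_intros continuous_zonal) simp
      finally have "ennreal (radial_density CARD('n) t) * (\<integral>\<^sup>+\<omega>. ennreal ((mother (sqrt t *\<^sub>R \<omega>))\<^sup>2) \<partial>sphere_measure) =
         ennreal (radial_density CARD('n) t * ((shell_gain k)\<^sup>2 * t powr (2 - ?n / 2) * zonal_energy k))"
        by (simp add: ennreal_mult[symmetric] radial_density_nonneg zonal_energy_nonneg)
      also have "radial_density CARD('n) t * ((shell_gain k)\<^sup>2 * t powr (2 - ?n / 2) * zonal_energy k) = t * zonal_energy k / shell_width k"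
      proof -
        have "t powr (?n / 2 - 1) * t powr (2 - ?n / 2) = t" using t by (simp add: powr_add[symmetric])
        then show ?thesis unfolding radial_density_eq[OF t] shell_gain_sq
          using unit_radial_pos shell_width_pos[of k] by (simp add: field_simps)
      qed
      also have "ennreal (t * zonal_energy k / shell_width k) \<le> ennreal ((1/2) ^ k / shell_width k)"
      proof (intro ennreal_leI divide_right_mono)
        have "t * zonal_energy k \<le> shell_edge k * zonal_energy k"
          using k by (intro mult_right_mono zonal_energy_nonneg) (simp add: shell_def)
        then show "t * zonal_energy k \<le> (1/2) ^ k" using shell_edge_energy_le[of k] by linarith
      qed (use shell_width_pos[of k] in simp)
      also have "\<dots> = (\<Sum>k. indicator (shell k) t * ennreal ((1/2) ^ k / shell_width k))"
        by (rule suminf_shell[OF k, symmetric])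
      finally show ?thesis .
    qed
  qed
  have "(\<integral>\<^sup>+x. ennreal ((cmod (complex_of_real (mother x)))\<^sup>2) \<partial>lborel) = (\<integral>\<^sup>+x. ennreal ((mother x)\<^sup>2) \<partial>lborel)" by simp
  also have "\<dots> = (\<integral>\<^sup>+t. ennreal (radial_density CARD('n) t) * (\<integral>\<^sup>+\<omega>. ennreal ((mother (sqrt t *\<^sub>R \<omega>))\<^sup>2) \<partial>sphere_measure) \<partial>lborel)"
    by (rule nn_integral_polar) measurable
  also have "\<dots> \<le> (\<integral>\<^sup>+t. (\<Sum>k. indicator (shell k) t * ennreal ((1/2) ^ k / shell_width k)) \<partial>lborel)"
    by (intro nn_integral_mono inner)
  also have "\<dots> = (\<Sum>k. \<integral>\<^sup>+t. indicator (shell k) t * ennreal ((1/2) ^ k / shell_width k) \<partial>lborel)"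
    by (rule nn_integral_suminf) measurable
  also have "\<dots> = (\<Sum>k. ennreal ((1/2) ^ k))"
  proof (rule suminf_cong)
    fix k
    have "(\<integral>\<^sup>+t. indicator (shell k) t * ennreal ((1/2) ^ k / shell_width k) \<partial>lborel) = emeasure lborel (shell k) * ennreal ((1/2) ^ k / shell_width k)"
      by (simp add: nn_integral_multc)
    also have "emeasure lborel (shell k) = ennreal (shell_width k)"
      unfolding shell_def shell_width_def by (intro emeasure_lborel_Ioc shell_edge_mono) simp
    finally show "(\<integral>\<^sup>+t. indicator (shell k) t * ennreal ((1/2) ^ k / shell_width k) \<partial>lborel) = ennreal ((1/2) ^ k)"
      using shell_width_pos[of k] by (simp add: ennreal_mult[symmetric])
  qed
  also have "\<dots> < \<infinity>" by (simp add: suminf_ennreal2 summable_geometric)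
  finally show "(\<integral>\<^sup>+x. ennreal ((cmod (complex_of_real (mother x)))\<^sup>2) \<partial>lborel) < \<infinity>" .
qed measurable

subsection \<open>The spherical averages of the matrix coefficients\<close>

text \<open>
  The function of the squared radius \<open>t\<close> whose Fourier transform, as a function of \<open>b\<close>, is the coefficient of \<open>\<phi>\<close> against
  the transformed \<open>mother\<close>; see \<open>fourier_coeff_eq_FT\<close>.
\<close>

definition radial_coeff :: "(real ^ 'n \<Rightarrow> complex) \<Rightarrow> real \<Rightarrow> real ^ 'n ^ 'n \<Rightarrow> real \<Rightarrow> complex" where
  "radial_coeff \<phi> a R t = complex_of_real (radial_density CARD('n) t) *
     (LINT \<omega>|sphere_measure. \<phi> (sqrt t *\<^sub>R \<omega>) *
        complex_of_real (sqrt a powr (real CARD('n) / 2) * mother (sqrt a *\<^sub>R (transpose R *v (sqrt t *\<^sub>R \<omega>)))))"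

lemma radial_coeff_measurable [measurable (raw)]:
  assumes [measurable]: "\<phi> \<in> borel_measurable borel" "f \<in> borel_measurable M" "g \<in> borel_measurable M" "h \<in> borel_measurable M"
  shows "(\<lambda>x. radial_coeff \<phi> (f x) (g x) (h x)) \<in> borel_measurable M"
  unfolding radial_coeff_def by measurable

definition zonal_part :: "(real ^ 'n \<Rightarrow> complex) \<Rightarrow> nat \<Rightarrow> ennreal" where
  "zonal_part F k = (\<integral>\<^sup>+y. ennreal ((cmod (LINT \<omega>|sphere_measure. F \<omega> * complex_of_real (zonal k \<omega> y)))\<^sup>2) \<partial>sphere_measure)"

text \<open>
  The transformed \<open>mother\<close> is zonal with pole \<open>R *v e\<close>, by rotation invariance of the kernel.
\<close>

lemma radial_coeff_on_shell:
  assumes [measurable]: "\<phi> \<in> borel_measurable borel" and "0 < a" "0 < t" and R: "rotation_matrix R" and k: "a * t \<in> shell k"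
  shows "radial_coeff \<phi> a R t = complex_of_real (radial_density CARD('n) t * sqrt a powr (real CARD('n) / 2) * shell_gain k * (a * t) powr (1 - real CARD('n) / 4))
     * (LINT \<omega>|sphere_measure. \<phi> (sqrt t *\<^sub>R \<omega>) * complex_of_real (zonal k \<omega> (R *v e)))"
proof -
  have E: "(LINT \<omega>|sphere_measure. \<phi> (sqrt t *\<^sub>R \<omega>) * complex_of_real (sqrt a powr (real CARD('n) / 2) * mother (sqrt a *\<^sub>R (transpose R *v (sqrt t *\<^sub>R \<omega>)))))
     = (LINT \<omega>|sphere_measure. complex_of_real (sqrt a powr (real CARD('n) / 2) * shell_gain k * (a * t) powr (1 - real CARD('n) / 4)) * (\<phi> (sqrt t *\<^sub>R \<omega>) * complex_of_real (zonal k \<omega> (R *v e))))"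
  proof (rule integral_cong_AE)
    show "AE \<omega> in sphere_measure. \<phi> (sqrt t *\<^sub>R \<omega>) * complex_of_real (sqrt a powr (real CARD('n) / 2) * mother (sqrt a *\<^sub>R (transpose R *v (sqrt t *\<^sub>R \<omega>))))
       = complex_of_real (sqrt a powr (real CARD('n) / 2) * shell_gain k * (a * t) powr (1 - real CARD('n) / 4)) * (\<phi> (sqrt t *\<^sub>R \<omega>) * complex_of_real (zonal k \<omega> (R *v e)))"
      using AE_sphere
    proof eventually_elim
      case (elim \<omega>)
      have n: "norm (transpose R *v \<omega>) = 1" using elim by (simp add: norm_rotation[OF rotation_matrix_transpose[OF R]])
      have "sqrt a *\<^sub>R (transpose R *v (sqrt t *\<^sub>R \<omega>)) = sqrt (a * t) *\<^sub>R (transpose R *v \<omega>)"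
        by (simp add: matrix_vector_mult_scaleR real_sqrt_mult)
      moreover have "zonal k (transpose R *v \<omega>) e = zonal k \<omega> (R *v e)"
        using zonal_rotate[OF R n norm_e, of k] by (simp add: rotation_transpose_cancel(2)[OF R])
      ultimately show ?case by (simp add: mother_on_shell[OF k n] mult_ac)
    qed
  qed measurable
  show ?thesis unfolding radial_coeff_def E integral_mult_right_zero by (simp only: of_real_mult mult.assoc)
qed

lemma radial_coeff_off_shells:
  assumes [measurable]: "\<phi> \<in> borel_measurable borel" and "0 < a" "0 < t" and R: "rotation_matrix R" and k: "\<And>k. a * t \<notin> shell k"
  shows "radial_coeff \<phi> a R t = 0"
proof -
  have "(LINT \<omega>|sphere_measure. \<phi> (sqrt t *\<^sub>R \<omega>) * complex_of_real (sqrt a powr (real CARD('n) / 2) * mother (sqrt a *\<^sub>R (transpose R *v (sqrt t *\<^sub>R \<omega>)))))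
     = (LINT \<omega>|sphere_measure. 0)"
  proof (rule integral_cong_AE)
    show "AE \<omega> in sphere_measure. \<phi> (sqrt t *\<^sub>R \<omega>) * complex_of_real (sqrt a powr (real CARD('n) / 2) * mother (sqrt a *\<^sub>R (transpose R *v (sqrt t *\<^sub>R \<omega>)))) = 0"
      using AE_sphere
    proof eventually_elim
      case (elim \<omega>)
      have n: "norm (transpose R *v \<omega>) = 1" using elim by (simp add: norm_rotation[OF rotation_matrix_transpose[OF R]])
      have "sqrt a *\<^sub>R (transpose R *v (sqrt t *\<^sub>R \<omega>)) = sqrt (a * t) *\<^sub>R (transpose R *v \<omega>)"
        by (simp add: matrix_vector_mult_scaleR real_sqrt_mult)
      then show ?case using mother_off_shells[OF k n] \<open>0 < a\<close> \<open>0 < t\<close> by simp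
    qed
  qed measurable
  then show ?thesis unfolding radial_coeff_def by simp
qed

text \<open>
  On the \<open>k\<close>-th shell the coefficient is a constant times the \<open>k\<close>-th zonal part of \<open>\<phi>\<close> on the sphere,
  evaluated at \<open>R *v e\<close>; integrating over \<open>R\<close> gives the norm of that part. All powers of \<open>a\<close> cancel.
\<close>

lemma radial_coeff_average:
  assumes [measurable]: "\<phi> \<in> borel_measurable borel" and a: "0 < a" and t: "0 < t"
  shows "ennreal (1 / a\<^sup>2) * (\<integral>\<^sup>+R. ennreal ((cmod (radial_coeff \<phi> a R t))\<^sup>2) \<partial>\<nu>)
     = (\<Sum>k. indicator (shell k) (a * t) * (ennreal (radial_density CARD('n) t * (t / shell_width k)) * zonal_part (\<lambda>\<omega>. \<phi> (sqrt t *\<^sub>R \<omega>)) k))"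
proof (cases "\<exists>k. a * t \<in> shell k")
  case False
  then have "(\<integral>\<^sup>+R. ennreal ((cmod (radial_coeff \<phi> a R t))\<^sup>2) \<partial>\<nu>) = (\<integral>\<^sup>+R. 0 \<partial>\<nu>)"
    by (intro nn_integral_cong_AE, use AE_rotation in eventually_elim) (use a t in \<open>simp add: radial_coeff_off_shells\<close>)
  then show ?thesis using False by (subst suminf_no_shell) auto
next
  case True
  then obtain k where k: "a * t \<in> shell k" by blast
  let ?n = "real CARD('n)"
  define C where "C = radial_density CARD('n) t * sqrt a powr (?n / 2) * shell_gain k * (a * t) powr (1 - ?n / 4)"
  define T where "T y = (LINT \<omega>|sphere_measure. \<phi> (sqrt t *\<^sub>R \<omega>) * complex_of_real (zonal k \<omega> y))" for y
  have [measurable]: "(\<lambda>(\<omega>, y). zonal k \<omega> y) \<in> borel_measurable (borel \<Otimes>\<^sub>M borel)"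
    unfolding zonal_def case_prod_unfold using borel_measurable_continuous_onI[OF continuous_gs] by measurable
  have [measurable]: "T \<in> borel_measurable borel" unfolding T_def by measurable
  have "(\<integral>\<^sup>+R. ennreal ((cmod (radial_coeff \<phi> a R t))\<^sup>2) \<partial>\<nu>) = (\<integral>\<^sup>+R. ennreal (C\<^sup>2) * ennreal ((cmod (T (R *v e)))\<^sup>2) \<partial>\<nu>)"
    by (intro nn_integral_cong_AE, use AE_rotation in eventually_elim)
       (simp add: radial_coeff_on_shell[OF assms(1) a t _ k] C_def[symmetric] T_def norm_mult power_mult_distrib ennreal_mult del: of_real_mult)
  also have "\<dots> = ennreal (C\<^sup>2) * (\<integral>\<^sup>+R. ennreal ((cmod (T (R *v e)))\<^sup>2) \<partial>\<nu>)" by (rule nn_integral_cmult) measurable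
  also have "(\<integral>\<^sup>+R. ennreal ((cmod (T (R *v e)))\<^sup>2) \<partial>\<nu>) = zonal_part (\<lambda>\<omega>. \<phi> (sqrt t *\<^sub>R \<omega>)) k"
    unfolding zonal_part_def T_def[symmetric] by (rule nn_integral_sphere[symmetric]) measurable
  finally have "ennreal (1 / a\<^sup>2) * (\<integral>\<^sup>+R. ennreal ((cmod (radial_coeff \<phi> a R t))\<^sup>2) \<partial>\<nu>) = ennreal (1 / a\<^sup>2 * C\<^sup>2) * zonal_part (\<lambda>\<omega>. \<phi> (sqrt t *\<^sub>R \<omega>)) k"
    by (subst ennreal_mult) (simp_all only: mult.assoc zero_le_power2 zero_le_divide_1_iff)
  also have "1 / a\<^sup>2 * C\<^sup>2 = radial_density CARD('n) t * (t / shell_width k)"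
  proof -
    have s: "(sqrt a powr (?n / 2))\<^sup>2 = a powr (?n / 2)"
      using a by (simp add: powr_half_sqrt[symmetric] powr_powr power2_eq_square powr_add[symmetric])
    have "((a * t) powr (1 - ?n / 4))\<^sup>2 = (a * t) powr (2 - ?n / 2)"
      by (simp add: power2_eq_square powr_add[symmetric])
    also have "\<dots> = a powr (2 - ?n / 2) * t powr (2 - ?n / 2)" using a t by (simp add: powr_mult)
    finally have p: "((a * t) powr (1 - ?n / 4))\<^sup>2 = a powr (2 - ?n / 2) * t powr (2 - ?n / 2)" .
    have a2: "a powr (?n / 2) * a powr (2 - ?n / 2) = a\<^sup>2" using a by (simp add: powr_add[symmetric])
    have t1: "t powr (?n / 2 - 1) * t powr (2 - ?n / 2) = t" using t by (simp add: powr_add[symmetric])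
    have "C\<^sup>2 = (radial_density CARD('n) t)\<^sup>2 * a powr (?n / 2) * (1 / (unit_radial * shell_width k)) * (a powr (2 - ?n / 2) * t powr (2 - ?n / 2))"
      unfolding C_def power_mult_distrib s p shell_gain_sq ..
    also have "\<dots> = (a powr (?n / 2) * a powr (2 - ?n / 2)) * radial_density CARD('n) t * (unit_radial * (t powr (?n / 2 - 1) * t powr (2 - ?n / 2)) / (unit_radial * shell_width k))"
      unfolding power2_eq_square[of "radial_density _ _"] by (subst (2) radial_density_eq[OF t]) (simp add: mult_ac)
    also have "\<dots> = a\<^sup>2 * (radial_density CARD('n) t * (t / shell_width k))"
      unfolding a2 t1 using unit_radial_pos by simp
    finally show ?thesis using a by simp
  qed
  also have "ennreal (radial_density CARD('n) t * (t / shell_width k)) * zonal_part (\<lambda>\<omega>. \<phi> (sqrt t *\<^sub>R \<omega>)) k =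
     (\<Sum>k. indicator (shell k) (a * t) * (ennreal (radial_density CARD('n) t * (t / shell_width k)) * zonal_part (\<lambda>\<omega>. \<phi> (sqrt t *\<^sub>R \<omega>)) k))"
    by (rule suminf_shell[OF k, symmetric])
  finally show ?thesis .
qed

lemma nn_integral_shell_dilation:
  assumes "0 < t"
  shows "(\<integral>\<^sup>+a. indicator {0<..} a * indicator (shell k) (a * t) \<partial>lborel) = ennreal (shell_width k / t)"
proof -
  have "(\<integral>\<^sup>+a. indicator {0<..} a * indicator (shell k) (a * t) \<partial>lborel) = (\<integral>\<^sup>+a. indicator {shell_edge (Suc k) / t<..shell_edge k / t} a \<partial>lborel)"
  proof (rule nn_integral_cong)
    fix a :: real
    have "a * t \<in> shell k \<longleftrightarrow> a \<in> {shell_edge (Suc k) / t<..shell_edge k / t}"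
      using assms by (simp add: shell_def field_simps)
    moreover have "0 < a" if "a * t \<in> shell k" using shell_pos[OF that] assms by (simp add: zero_less_mult_iff)
    ultimately show "indicator {0<..} a * indicator (shell k) (a * t) = (indicator {shell_edge (Suc k) / t<..shell_edge k / t} a :: ennreal)"
      by (auto simp: indicator_def)
  qed
  also have "\<dots> = ennreal (shell_edge k / t - shell_edge (Suc k) / t)"
    using assms shell_edge_mono[of k "Suc k"] by (simp add: divide_right_mono)
  finally show ?thesis by (simp add: shell_width_def diff_divide_distrib)
qed

text \<open>
  The values of \<open>a\<close> for which \<open>a * t\<close> lies in the \<open>k\<close>-th shell form an interval of length
  \<open>shell_width k / t\<close>. It cancels the factor \<open>t / shell_width k\<close>, and the zonal parts add up.
\<close>

lemma radial_coeff_dilation_integral: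
  assumes [measurable]: "\<phi> \<in> borel_measurable borel" and t: "0 < t" and F: "(\<lambda>\<omega>. \<phi> (sqrt t *\<^sub>R \<omega>)) \<in> sq_int sphere_measure"
  shows "(\<integral>\<^sup>+a. (\<integral>\<^sup>+R. indicator {0<..} a * ennreal (1 / a\<^sup>2) * ennreal ((cmod (radial_coeff \<phi> a R t))\<^sup>2) \<partial>\<nu>) \<partial>lborel)
     = ennreal (radial_density CARD('n) t) * (\<integral>\<^sup>+\<omega>. ennreal ((cmod (\<phi> (sqrt t *\<^sub>R \<omega>)))\<^sup>2) \<partial>sphere_measure)"
proof -
  let ?F = "\<lambda>\<omega>. \<phi> (sqrt t *\<^sub>R \<omega>)"
  let ?w = "radial_density CARD('n) t"
  have "(\<integral>\<^sup>+a. (\<integral>\<^sup>+R. indicator {0<..} a * ennreal (1 / a\<^sup>2) * ennreal ((cmod (radial_coeff \<phi> a R t))\<^sup>2) \<partial>\<nu>) \<partial>lborel)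
    = (\<integral>\<^sup>+a. (\<Sum>k. (indicator {0<..} a * indicator (shell k) (a * t)) * (ennreal (?w * (t / shell_width k)) * zonal_part ?F k)) \<partial>lborel)"
  proof (rule nn_integral_cong)
    fix a :: real
    have "(\<integral>\<^sup>+R. indicator {0<..} a * ennreal (1 / a\<^sup>2) * ennreal ((cmod (radial_coeff \<phi> a R t))\<^sup>2) \<partial>\<nu>)
       = indicator {0<..} a * (ennreal (1 / a\<^sup>2) * (\<integral>\<^sup>+R. ennreal ((cmod (radial_coeff \<phi> a R t))\<^sup>2) \<partial>\<nu>))"
      by (simp add: nn_integral_cmult mult.assoc)
    also have "\<dots> = indicator {0<..} a * (\<Sum>k. indicator (shell k) (a * t) * (ennreal (?w * (t / shell_width k)) * zonal_part ?F k))"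
      using radial_coeff_average[OF assms(1) _ t, of a] by (cases "0 < a") auto
    also have "\<dots> = (\<Sum>k. (indicator {0<..} a * indicator (shell k) (a * t)) * (ennreal (?w * (t / shell_width k)) * zonal_part ?F k))"
      by (simp add: mult.assoc)
    finally show "(\<integral>\<^sup>+R. indicator {0<..} a * ennreal (1 / a\<^sup>2) * ennreal ((cmod (radial_coeff \<phi> a R t))\<^sup>2) \<partial>\<nu>) = \<dots>" .
  qed
  also have "\<dots> = (\<Sum>k. \<integral>\<^sup>+a. (indicator {0<..} a * indicator (shell k) (a * t)) * (ennreal (?w * (t / shell_width k)) * zonal_part ?F k) \<partial>lborel)"
    by (rule nn_integral_suminf) measurable
  also have "\<dots> = (\<Sum>k. ennreal ?w * zonal_part ?F k)"
  proof (rule suminf_cong)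
    fix k
    have "(\<integral>\<^sup>+a. (indicator {0<..} a * indicator (shell k) (a * t)) * (ennreal (?w * (t / shell_width k)) * zonal_part ?F k) \<partial>lborel)
      = ennreal (shell_width k / t) * (ennreal (?w * (t / shell_width k)) * zonal_part ?F k)"
      by (subst nn_integral_multc) (auto simp: nn_integral_shell_dilation[OF t])
    also have "\<dots> = ennreal (shell_width k / t * (?w * (t / shell_width k))) * zonal_part ?F k"
    proof -
      have "0 \<le> shell_width k / t" "0 \<le> ?w * (t / shell_width k)"
        using t shell_width_pos[of k] by (simp_all add: radial_density_nonneg)
      then show ?thesis by (simp only: ennreal_mult mult.assoc)
    qed
    also have "shell_width k / t * (?w * (t / shell_width k)) = ?w" using t shell_width_pos[of k] by simp
    finally show "(\<integral>\<^sup>+a. (indicator {0<..} a * indicator (shell k) (a * t)) * (ennreal (?w * (t / shell_width k)) * zonal_part ?F k) \<partial>lborel) = ennreal ?w * zonal_part ?F k" .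
  qed
  also have "\<dots> = ennreal ?w * (\<integral>\<^sup>+\<omega>. ennreal ((cmod (?F \<omega>))\<^sup>2) \<partial>sphere_measure)"
    unfolding zonal_resolution_of_identity[OF F, symmetric] zonal_part_def by simp
  finally show ?thesis .
qed

text \<open>
  After Tonelli's theorem the integral over \<open>t\<close> is outermost. For almost every \<open>t\<close> the restriction of \<open>\<phi>\<close> to the
  sphere is square integrable, so the inner integrals are known, and polar coordinates give the norm of \<open>\<phi>\<close>.
\<close>

theorem radial_coeff_total:
  assumes \<phi>: "\<phi> \<in> sq_int lborel"
  shows "(\<integral>\<^sup>+R. (\<integral>\<^sup>+a. indicator {0<..} a * ennreal (1 / a\<^sup>2) * (\<integral>\<^sup>+t. ennreal ((cmod (radial_coeff \<phi> a R t))\<^sup>2) \<partial>lborel) \<partial>lborel) \<partial>\<nu>)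
     = ennreal ((nrm lborel \<phi>)\<^sup>2)"
proof -
  interpret A: pair_sigma_finite \<nu> "lborel :: real measure" ..
  have [measurable]: "\<phi> \<in> borel_measurable borel" using sq_int_measurable[OF \<phi>] by simp
  let ?g = "\<lambda>R a t. indicator {0<..} a * ennreal (1 / a\<^sup>2) * ennreal ((cmod (radial_coeff \<phi> a R t))\<^sup>2)"
  have polar: "(\<integral>\<^sup>+t. ennreal (radial_density CARD('n) t) * (\<integral>\<^sup>+\<omega>. ennreal ((cmod (\<phi> (sqrt t *\<^sub>R \<omega>)))\<^sup>2) \<partial>sphere_measure) \<partial>lborel) = ennreal ((nrm lborel \<phi>)\<^sup>2)"
    unfolding nn_integral_sq_eq_nrm[OF \<phi>, symmetric] by (rule nn_integral_polar[symmetric]) measurable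
  have "AE t in lborel. ennreal (radial_density CARD('n) t) * (\<integral>\<^sup>+\<omega>. ennreal ((cmod (\<phi> (sqrt t *\<^sub>R \<omega>)))\<^sup>2) \<partial>sphere_measure) \<noteq> \<infinity>"
    by (rule nn_integral_noteq_infinite) (auto simp: polar)
  then have AE: "AE t in lborel. (\<integral>\<^sup>+a. (\<integral>\<^sup>+R. ?g R a t \<partial>\<nu>) \<partial>lborel)
     = ennreal (radial_density CARD('n) t) * (\<integral>\<^sup>+\<omega>. ennreal ((cmod (\<phi> (sqrt t *\<^sub>R \<omega>)))\<^sup>2) \<partial>sphere_measure)"
  proof eventually_elim
    case (elim t)
    show ?case
    proof (cases "0 < t")
      case True
      have "0 < radial_density CARD('n) t" using unit_radial_pos True by (simp add: radial_density_eq)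
      with elim have "(\<integral>\<^sup>+\<omega>. ennreal ((cmod (\<phi> (sqrt t *\<^sub>R \<omega>)))\<^sup>2) \<partial>sphere_measure) < \<infinity>"
        by (auto simp: ennreal_mult_eq_top_iff less_top)
      then have "(\<lambda>\<omega>. \<phi> (sqrt t *\<^sub>R \<omega>)) \<in> sq_int sphere_measure" by (intro sq_intI) auto
      then show ?thesis by (intro radial_coeff_dilation_integral True) measurable
    next
      case False then show ?thesis by (simp add: radial_density_def radial_coeff_def)
    qed
  qed
  have "(\<integral>\<^sup>+R. (\<integral>\<^sup>+a. indicator {0<..} a * ennreal (1 / a\<^sup>2) * (\<integral>\<^sup>+t. ennreal ((cmod (radial_coeff \<phi> a R t))\<^sup>2) \<partial>lborel) \<partial>lborel) \<partial>\<nu>)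
    = (\<integral>\<^sup>+R. (\<integral>\<^sup>+a. (\<integral>\<^sup>+t. ?g R a t \<partial>lborel) \<partial>lborel) \<partial>\<nu>)"
    by (intro nn_integral_cong nn_integral_cmult[symmetric]) measurable
  also have "\<dots> = (\<integral>\<^sup>+R. (\<integral>\<^sup>+t. (\<integral>\<^sup>+a. ?g R a t \<partial>lborel) \<partial>lborel) \<partial>\<nu>)"
    by (intro nn_integral_cong lborel_pair.Fubini') measurable
  also have "\<dots> = (\<integral>\<^sup>+t. (\<integral>\<^sup>+R. (\<integral>\<^sup>+a. ?g R a t \<partial>lborel) \<partial>\<nu>) \<partial>lborel)"
    by (intro A.Fubini'[symmetric]) measurable
  also have "\<dots> = (\<integral>\<^sup>+t. (\<integral>\<^sup>+a. (\<integral>\<^sup>+R. ?g R a t \<partial>\<nu>) \<partial>lborel) \<partial>lborel)"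
    by (intro nn_integral_cong A.Fubini'[symmetric]) measurable
  also have "\<dots> = (\<integral>\<^sup>+t. ennreal (radial_density CARD('n) t) * (\<integral>\<^sup>+\<omega>. ennreal ((cmod (\<phi> (sqrt t *\<^sub>R \<omega>)))\<^sup>2) \<partial>sphere_measure) \<partial>lborel)"
    by (rule nn_integral_cong_AE[OF AE])
  finally show ?thesis using polar by simp
qed

end

section \<open>The reproducing formula\<close>

definition fourier_coeff :: "(real ^ 'n::finite \<Rightarrow> complex) \<Rightarrow> (real ^ 'n \<Rightarrow> complex) \<Rightarrow> real \<Rightarrow> real \<Rightarrow> real ^ 'n ^ 'n \<Rightarrow> complex" where
  "fourier_coeff \<phi> \<psi> b a R = ip lborel \<phi> (frep ((b, a), R) \<psi>)"

lemma fourier_coeff_measurable [measurable (raw)]: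
  fixes \<phi> \<psi> :: "real ^ 'n::finite \<Rightarrow> complex"
  assumes [measurable]: "\<phi> \<in> borel_measurable borel" "\<psi> \<in> borel_measurable borel"
    "f \<in> borel_measurable M" "g \<in> borel_measurable M" "h \<in> borel_measurable M"
  shows "(\<lambda>x. fourier_coeff \<phi> \<psi> (f x) (g x) (h x)) \<in> borel_measurable M"
  unfolding fourier_coeff_def ip_def frep_def sim_def prod.case by measurable

context rotation_haar
begin

text \<open>
  On the sphere of squared radius \<open>t\<close> the multiplier of the propagator is the constant \<open>cis (- 2 * pi * b * t)\<close> and leaves the
  spherical integral.
\<close>

lemma fourier_coeff_eq_FT:
  assumes \<phi>: "\<phi> \<in> sq_int lborel" and a: "0 < a" and R: "rotation_matrix R"
  shows "integrable lborel (radial_coeff \<phi> a R)"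
    and "fourier_coeff \<phi> (\<lambda>x. complex_of_real (mother x)) b a R = FT (radial_coeff \<phi> a R) (- b)"
proof -
  have [measurable]: "\<phi> \<in> borel_measurable borel" using sq_int_measurable[OF \<phi>] by simp
  define \<Phi> where "\<Phi> b x = \<phi> x * cnj (frep ((b, a), R) (\<lambda>x. complex_of_real (mother x)) x)" for b x
  have g: "((b, a), R) \<in> carrier schrodinger_group" for b using a R by (simp add: carrier_schrodinger_group)
  have \<Phi>: "integrable lborel (\<Phi> b)" for b
    unfolding \<Phi>_def by (rule integrable_ip[OF \<phi> frep_sq_int(1)[OF g mother_sq_int]])
  have eq: "complex_of_real (radial_density CARD('n) t) * (LINT \<omega>|sphere_measure. \<Phi> b (sqrt t *\<^sub>R \<omega>)) = radial_coeff \<phi> a R t * cis (- 2 * pi * (t \<bullet> (- b)))" for b t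
  proof (cases "0 < t")
    case t: True
    let ?m = "\<lambda>\<omega>. complex_of_real (sqrt a powr (real CARD('n) / 2) * mother (sqrt a *\<^sub>R (transpose R *v (sqrt t *\<^sub>R \<omega>))))"
    have E: "(LINT \<omega>|sphere_measure. \<Phi> b (sqrt t *\<^sub>R \<omega>)) = (LINT \<omega>|sphere_measure. (\<phi> (sqrt t *\<^sub>R \<omega>) * ?m \<omega>) * cis (- 2 * pi * (t \<bullet> (- b))))"
    proof (rule integral_cong_AE)
      show "AE \<omega> in sphere_measure. \<Phi> b (sqrt t *\<^sub>R \<omega>) = (\<phi> (sqrt t *\<^sub>R \<omega>) * ?m \<omega>) * cis (- 2 * pi * (t \<bullet> (- b)))"
        using AE_sphere
      proof eventually_elim
        case (elim \<omega>)
        have "(sqrt t *\<^sub>R \<omega>) \<bullet> (sqrt t *\<^sub>R \<omega>) = (norm (sqrt t *\<^sub>R \<omega>))\<^sup>2" by (simp only: power2_norm_eq_inner)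
        then have n: "(sqrt t *\<^sub>R \<omega>) \<bullet> (sqrt t *\<^sub>R \<omega>) = t" using elim t by simp
        have c: "cnj (cis (- 2 * pi * b * t)) = cis (- 2 * pi * (t \<bullet> (- b)))" by (simp add: cis_cnj mult_ac)
        show ?case unfolding \<Phi>_def frep_def sim_def prod.case n complex_cnj_mult c by (simp add: mult_ac)
      qed
    next
      show "(\<lambda>\<omega>. \<Phi> b (sqrt t *\<^sub>R \<omega>)) \<in> borel_measurable sphere_measure"
        unfolding \<Phi>_def frep_def prod.case by measurable
    qed measurable
    show ?thesis unfolding radial_coeff_def E integral_mult_left_zero by (rule mult.assoc[symmetric])
  next
    case False then show ?thesis by (simp add: radial_density_def radial_coeff_def)
  qed
  note p = integral_polar[OF \<Phi>, unfolded eq]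
  show "integrable lborel (radial_coeff \<phi> a R)" using p(1)[of 0] by simp
  show "fourier_coeff \<phi> (\<lambda>x. complex_of_real (mother x)) b a R = FT (radial_coeff \<phi> a R) (- b)"
    using p(2)[of b] by (simp add: fourier_coeff_def ip_def \<Phi>_def FT_def)
qed

text \<open>
  Plancherel's theorem on the line. The assumption \<open>fin\<close> is available for almost all \<open>a\<close> and \<open>R\<close> once the total integral is
  known to be finite.
\<close>

lemma translation_integral:
  assumes \<phi>: "\<phi> \<in> sq_int lborel" and a: "0 < a" and R: "rotation_matrix R"
    and fin: "(\<integral>\<^sup>+t. ennreal ((cmod (radial_coeff \<phi> a R t))\<^sup>2) \<partial>lborel) < \<infinity>"
  shows "(\<integral>\<^sup>+b. ennreal ((cmod (fourier_coeff \<phi> (\<lambda>x. complex_of_real (mother x)) b a R))\<^sup>2) \<partial>lborel)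
     = (\<integral>\<^sup>+t. ennreal ((cmod (radial_coeff \<phi> a R t))\<^sup>2) \<partial>lborel)"
proof -
  have [measurable]: "\<phi> \<in> borel_measurable borel" using sq_int_measurable[OF \<phi>] by simp
  note i = fourier_coeff_eq_FT(1)[OF \<phi> a R]
  have s: "radial_coeff \<phi> a R \<in> sq_int lborel" by (rule sq_intI[OF _ fin]) measurable
  have "(\<integral>\<^sup>+b. ennreal ((cmod (fourier_coeff \<phi> (\<lambda>x. complex_of_real (mother x)) b a R))\<^sup>2) \<partial>lborel)
     = (\<integral>\<^sup>+b. ennreal ((cmod (FT (radial_coeff \<phi> a R) (- b)))\<^sup>2) \<partial>lborel)"
    by (simp add: fourier_coeff_eq_FT(2)[OF \<phi> a R])
  also have "\<dots> = (\<integral>\<^sup>+b. ennreal ((cmod (FT (radial_coeff \<phi> a R) b))\<^sup>2) \<partial>lborel)"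
    by (subst (2) lborel_distr_uminus[symmetric], subst nn_integral_distr) auto
  also have "\<dots> = (\<integral>\<^sup>+t. ennreal ((cmod (radial_coeff \<phi> a R t))\<^sup>2) \<partial>lborel)"
    using plancherel_L1_L2[OF i s] by (simp add: nn_integral_sq_eq_nrm s)
  finally show ?thesis .
qed

theorem reproducing_formula:
  assumes \<phi>: "\<phi> \<in> sq_int lborel"
  shows "(\<integral>\<^sup>+R. (\<integral>\<^sup>+a. indicator {0<..} a * ennreal (1 / a\<^sup>2) *
       (\<integral>\<^sup>+b. ennreal ((cmod (fourier_coeff \<phi> (\<lambda>x. complex_of_real (mother x)) b a R))\<^sup>2) \<partial>lborel) \<partial>lborel) \<partial>\<nu>)
     = ennreal ((nrm lborel \<phi>)\<^sup>2)"
proof -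
  have [measurable]: "\<phi> \<in> borel_measurable borel" using sq_int_measurable[OF \<phi>] by simp
  let ?J = "\<lambda>a R. \<integral>\<^sup>+t. ennreal ((cmod (radial_coeff \<phi> a R t))\<^sup>2) \<partial>lborel"
  let ?N = "\<lambda>a R. \<integral>\<^sup>+b. ennreal ((cmod (fourier_coeff \<phi> (\<lambda>x. complex_of_real (mother x)) b a R))\<^sup>2) \<partial>lborel"
  have "AE R in \<nu>. (\<integral>\<^sup>+a. indicator {0<..} a * ennreal (1 / a\<^sup>2) * ?J a R \<partial>lborel) \<noteq> \<infinity>"
    by (rule nn_integral_noteq_infinite) (auto simp: radial_coeff_total[OF \<phi>])
  with AE_rotation have "AE R in \<nu>. (\<integral>\<^sup>+a. indicator {0<..} a * ennreal (1 / a\<^sup>2) * ?N a R \<partial>lborel)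
      = (\<integral>\<^sup>+a. indicator {0<..} a * ennreal (1 / a\<^sup>2) * ?J a R \<partial>lborel)"
  proof eventually_elim
    case (elim R)
    have "AE a in lborel. indicator {0<..} a * ennreal (1 / a\<^sup>2) * ?J a R \<noteq> \<infinity>"
      by (rule nn_integral_noteq_infinite[OF _ elim(2)]) measurable
    then show ?case
    proof (intro nn_integral_cong_AE, eventually_elim)
      case (elim a)
      show ?case
      proof (cases "0 < a")
        case True
        then have "?J a R < \<infinity>" using elim by (auto simp: ennreal_mult_eq_top_iff less_top)
        then show ?thesis using translation_integral[OF \<phi> True \<open>rotation_matrix R\<close>] by simp
      qed simp
    qed
  qed
  then show ?thesis unfolding radial_coeff_total[OF \<phi>, symmetric] by (rule nn_integral_cong_AE)
qed

end

lemma closed_rotation_matrices: "closed {R :: real ^ 'n ^ 'n::finite. rotation_matrix R}"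
proof -
  have "continuous_on UNIV (\<lambda>R :: real ^ 'n ^ 'n. transpose R ** R)"
    by (intro continuous_on_matmul continuous_on_id) (simp add: transpose_def, intro continuous_intros)
  moreover have "continuous_on UNIV (\<lambda>R :: real ^ 'n ^ 'n. det R)"
    unfolding det_def by (intro continuous_intros)
  ultimately have "closed ({R :: real ^ 'n ^ 'n. transpose R ** R = mat 1} \<inter> {R. det R = 1})"
    by (intro closed_Int closed_Collect_eq continuous_on_const)
  moreover have "{R :: real ^ 'n ^ 'n. rotation_matrix R} = {R. transpose R ** R = mat 1} \<inter> {R. det R = 1}"
    by (auto simp: rotation_matrix_def orthogonal_matrix)
  ultimately show ?thesis by simp
qed

lemma normalized_haar_SO_space:
  assumes "normalized_haar_SO \<mu>" shows "space \<mu> = {R. rotation_matrix R}"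
  using assms sets_eq_imp_space_eq[of \<mu> "restrict_space borel (carrier SO_group)"]
  by (simp add: normalized_haar_SO_def space_restrict_space SO_group_def)

lemma normalized_haar_SO_measurable:
  assumes "normalized_haar_SO \<mu>" shows "(\<lambda>R. R) \<in> borel_measurable \<mu>"
proof -
  have s: "sets \<mu> = sets (restrict_space borel (carrier SO_group))" using assms by (simp add: normalized_haar_SO_def)
  show ?thesis unfolding measurable_cong_sets[OF s refl] by (rule measurable_restrict_space1) simp
qed

text \<open>
  The given Haar measure lives on the subspace of rotations, which is a closed set of matrices; its image under the inclusion
  is the measure required by the locale.
\<close>

lemma normalized_haar_SO_rotation_haar:
  fixes \<mu> :: "(real ^ 'n ^ 'n::finite) measure"
  assumes \<mu>: "normalized_haar_SO \<mu>" and "2 \<le> CARD('n)" and "norm (e :: real ^ 'n) = 1"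
  shows "rotation_haar (distr \<mu> borel (\<lambda>R. R)) e"
proof (rule rotation_haar.intro)
  note [measurable] = normalized_haar_SO_measurable[OF \<mu>]
  have C: "carrier SO_group = {R :: real ^ 'n ^ 'n. rotation_matrix R}" by (simp add: SO_group_def)
  have s: "sets \<mu> = sets (restrict_space borel {R. rotation_matrix R})" using \<mu> by (simp add: normalized_haar_SO_def C)
  have sp: "space \<mu> = {R. rotation_matrix R}" by (rule normalized_haar_SO_space[OF \<mu>])
  interpret prob_space \<mu> by (rule prob_spaceI) (use \<mu> in \<open>simp add: normalized_haar_SO_def\<close>)
  show "prob_space (distr \<mu> borel (\<lambda>R. R))" by (rule prob_space_distr[OF normalized_haar_SO_measurable[OF \<mu>]])
  have [measurable]: "{R :: real ^ 'n ^ 'n. rotation_matrix R} \<in> sets borel" by (rule borel_closed[OF closed_rotation_matrices])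
  show "AE R in distr \<mu> borel (\<lambda>R. R). rotation_matrix R"
  proof (subst AE_distr_iff)
    show "AE R in \<mu>. rotation_matrix R" by (rule AE_I2) (simp add: sp)
  qed simp_all
  fix S :: "real ^ 'n ^ 'n" assume S: "rotation_matrix S"
  have mS: "(\<lambda>R. S ** R) \<in> measurable \<mu> \<mu>"
    unfolding measurable_cong_sets[OF refl s]
    by (rule measurable_restrict_space2) (auto simp: sp rotation_matrix_mult[OF S])
  have "distr (distr \<mu> borel (\<lambda>R. R)) borel (\<lambda>R. S ** R) = distr \<mu> borel (\<lambda>R. S ** R)"
    by (subst distr_distr) (auto simp: comp_def)
  also have "\<dots> = distr (distr \<mu> \<mu> (\<lambda>R. S ** R)) borel (\<lambda>R. R)"
    by (subst distr_distr[OF _ mS]) (auto simp: comp_def)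
  also have "distr \<mu> \<mu> (\<lambda>R. S ** R) = \<mu>" using \<mu> S by (simp add: normalized_haar_SO_def C)
  finally show "distr (distr \<mu> borel (\<lambda>R. R)) borel (\<lambda>R. S ** R) = distr \<mu> borel (\<lambda>R. R)" .
qed (use assms in simp_all)

lemma nn_integral_schrodinger_haar:
  fixes \<mu> :: "(real ^ 'n ^ 'n::finite) measure" and F :: "real \<Rightarrow> real \<Rightarrow> real ^ 'n ^ 'n \<Rightarrow> ennreal"
  assumes \<mu>: "normalized_haar_SO \<mu>"
    and F[measurable]: "(\<lambda>((b, a), R). F b a R) \<in> borel_measurable ((borel \<Otimes>\<^sub>M borel) \<Otimes>\<^sub>M borel)"
  shows "(\<integral>\<^sup>+((b, a), R). F b a R \<partial>schrodinger_haar \<mu>)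
     = (\<integral>\<^sup>+R. (\<integral>\<^sup>+a. indicator {0<..} a * ennreal (1 / a\<^sup>2) * (\<integral>\<^sup>+b. F b a R \<partial>lborel) \<partial>lborel) \<partial>distr \<mu> borel (\<lambda>R. R))"
proof -
  note [measurable] = normalized_haar_SO_measurable[OF \<mu>]
  interpret prob_space \<mu> by (rule prob_spaceI) (use \<mu> in \<open>simp add: normalized_haar_SO_def\<close>)
  define D where "D = density (restrict_space lborel {0<..}) (\<lambda>a::real. ennreal (1 / a\<^sup>2))"
  have rs: "sigma_finite_measure (restrict_space lborel {0<..} :: real measure)"
    by (rule sigma_finite_measure_restrict_space) (auto intro: lborel.sigma_finite_measure_axioms)
  have m1[measurable]: "(\<lambda>a::real. a) \<in> borel_measurable (restrict_space lborel {0<..})"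
    by (rule measurable_restrict_space1) simp
  have "sigma_finite_measure D"
    unfolding D_def by (subst sigma_finite_measure.sigma_finite_iff_density_finite[OF rs]) auto
  then interpret D: sigma_finite_measure D .
  have [measurable]: "(\<lambda>a::real. a) \<in> borel_measurable D" unfolding D_def by simp
  interpret P: pair_sigma_finite "lborel :: real measure" D ..
  interpret Q: pair_sigma_finite "(lborel :: real measure) \<Otimes>\<^sub>M D" \<mu> ..
  have F'[measurable]: "(\<lambda>x. F (f x) (g x) (h x)) \<in> borel_measurable M" if [measurable]: "f \<in> borel_measurable M" "g \<in> borel_measurable M" "h \<in> borel_measurable M" for f g h and M :: "'z measure"
  proof -
    have "(\<lambda>x. (\<lambda>((b, a), R). F b a R) ((f x, g x), h x)) \<in> borel_measurable M" by (rule measurable_compose[OF _ F]) measurable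
    then show ?thesis by simp
  qed
  have "(\<integral>\<^sup>+((b, a), R). F b a R \<partial>schrodinger_haar \<mu>) = (\<integral>\<^sup>+R. (\<integral>\<^sup>+(b, a). F b a R \<partial>(lborel \<Otimes>\<^sub>M D)) \<partial>\<mu>)"
    unfolding schrodinger_haar_def D_def[symmetric] 
    by (subst Q.nn_integral_snd[symmetric]) (auto simp: case_prod_unfold intro!: F')
  also have "\<dots> = (\<integral>\<^sup>+R. (\<integral>\<^sup>+a. (\<integral>\<^sup>+b. F b a R \<partial>lborel) \<partial>D) \<partial>\<mu>)"
    by (subst P.nn_integral_snd[symmetric]) (auto simp: case_prod_unfold intro!: F')
  also have "\<dots> = (\<integral>\<^sup>+R. (\<integral>\<^sup>+a. indicator {0<..} a * ennreal (1 / a\<^sup>2) * (\<integral>\<^sup>+b. F b a R \<partial>lborel) \<partial>lborel) \<partial>\<mu>)"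
  proof (rule nn_integral_cong)
    fix R
    have "(\<integral>\<^sup>+a. (\<integral>\<^sup>+b. F b a R \<partial>lborel) \<partial>D) = (\<integral>\<^sup>+a. ennreal (1 / a\<^sup>2) * (\<integral>\<^sup>+b. F b a R \<partial>lborel) \<partial>restrict_space lborel {0<..})"
      unfolding D_def by (rule nn_integral_density) measurable
    also have "\<dots> = (\<integral>\<^sup>+a. ennreal (1 / a\<^sup>2) * (\<integral>\<^sup>+b. F b a R \<partial>lborel) * indicator {0<..} a \<partial>lborel)"
      by (rule nn_integral_restrict_space) simp
    finally show "(\<integral>\<^sup>+a. (\<integral>\<^sup>+b. F b a R \<partial>lborel) \<partial>D) = (\<integral>\<^sup>+a. indicator {0<..} a * ennreal (1 / a\<^sup>2) * (\<integral>\<^sup>+b. F b a R \<partial>lborel) \<partial>lborel)"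
      by (simp add: mult_ac)
  qed
  also have "\<dots> = (\<integral>\<^sup>+R. (\<integral>\<^sup>+a. indicator {0<..} a * ennreal (1 / a\<^sup>2) * (\<integral>\<^sup>+b. F b a R \<partial>lborel) \<partial>lborel) \<partial>distr \<mu> borel (\<lambda>R. R))"
    by (subst nn_integral_distr) measurable
  finally show ?thesis .
qed

lemma space_schrodinger_haar:
  assumes "normalized_haar_SO \<mu>"
  shows "space (schrodinger_haar \<mu>) = carrier schrodinger_group"
  using normalized_haar_SO_space[OF assms]
  by (auto simp: schrodinger_haar_def space_pair_measure space_restrict_space carrier_schrodinger_group)

theorem proposition3p1:
  fixes \<mu> :: "(real ^ 'n ^ 'n::finite) measure"
  assumes "CARD('n) \<ge> 2"
    and "normalized_haar_SO \<mu>"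
  shows "reproducing_rep (schrodinger_group :: ((real \<times> real) \<times> (real ^ 'n ^ 'n)) monoid)
           (schrodinger_haar \<mu>)
           (schrodinger_rep ::
              (real \<times> real) \<times> (real ^ 'n ^ 'n) \<Rightarrow> (real ^ 'n \<Rightarrow> complex) \<Rightarrow> real ^ 'n \<Rightarrow> complex)"
proof -
  define e :: "real ^ 'n" where "e = axis undefined 1"
  interpret rotation_haar "distr \<mu> borel (\<lambda>R. R)" e
    by (rule normalized_haar_SO_rotation_haar) (use assms in \<open>simp_all add: e_def\<close>)
  let ?\<psi> = "\<lambda>x. complex_of_real (mother x)"
  obtain \<eta> where \<eta>: "is_fourier_L2 \<eta> ?\<psi>" using is_fourier_L2_surj[OF mother_sq_int] by blast
  have "ennreal ((L2_norm f)\<^sup>2) = (\<integral>\<^sup>+g. ennreal ((cmod (L2_inner f (schrodinger_rep g \<eta>)))\<^sup>2) \<partial>schrodinger_haar \<mu>)"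
    if "f \<in> L2" for f :: "real ^ 'n \<Rightarrow> complex"
  proof -
    have f: "f \<in> sq_int lborel" using that by (simp add: L2_eq_sq_int)
    define \<phi> where "\<phi> = fourier_L2 f"
    have \<phi>: "is_fourier_L2 f \<phi>" unfolding \<phi>_def by (rule is_fourier_L2_fourier_L2[OF f])
    note s = is_fourier_L2_sq_int(2)[OF \<phi>]
    have [measurable]: "\<phi> \<in> borel_measurable borel" using sq_int_measurable[OF s] by simp
    have "(\<integral>\<^sup>+g. ennreal ((cmod (L2_inner f (schrodinger_rep g \<eta>)))\<^sup>2) \<partial>schrodinger_haar \<mu>)
       = (\<integral>\<^sup>+((b, a), R). ennreal ((cmod (fourier_coeff \<phi> ?\<psi> b a R))\<^sup>2) \<partial>schrodinger_haar \<mu>)"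
    proof (rule nn_integral_cong)
      fix g assume "g \<in> space (schrodinger_haar \<mu>)"
      then obtain b a R where g: "g = ((b, a), R)" "0 < a" "rotation_matrix R"
        by (cases g) (auto simp: space_schrodinger_haar[OF assms(2)] carrier_schrodinger_group)
      have "ip lborel f (schrodinger_rep g \<eta>) = ip lborel \<phi> (frep g ?\<psi>)"
        unfolding g(1) by (rule is_fourier_L2_ip[OF \<phi> is_fourier_L2_schrodinger_rep[OF g(2,3) \<eta>], symmetric])
      then show "ennreal ((cmod (L2_inner f (schrodinger_rep g \<eta>)))\<^sup>2) = (\<lambda>((b, a), R). ennreal ((cmod (fourier_coeff \<phi> ?\<psi> b a R))\<^sup>2)) g"
        by (simp add: g(1) L2_inner_eq_ip fourier_coeff_def)
    qed
    also have "\<dots> = ennreal ((nrm lborel \<phi>)\<^sup>2)"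
    proof -
      have "(\<lambda>((b, a), R). ennreal ((cmod (fourier_coeff \<phi> ?\<psi> b a R))\<^sup>2)) \<in> borel_measurable ((borel \<Otimes>\<^sub>M borel) \<Otimes>\<^sub>M borel)"
        unfolding case_prod_unfold by measurable
      from nn_integral_schrodinger_haar[OF assms(2) this] show ?thesis using reproducing_formula[OF s] by simp
    qed
    also have "\<dots> = ennreal ((L2_norm f)\<^sup>2)" by (simp add: is_fourier_L2_nrm[OF \<phi>] L2_norm_eq_nrm)
    finally show ?thesis ..
  qed
  then have "admissible_vector (schrodinger_haar \<mu>) schrodinger_rep \<eta>"
    unfolding admissible_vector_def using is_fourier_L2_sq_int(1)[OF \<eta>] by (simp add: L2_eq_sq_int)
  then show ?thesis unfolding reproducing_rep_def using unitary_schrodinger_rep by blast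
qed

end
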